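(* Let $(\mathbf M,\mathbf N,\mathbf J)$ be an arithmetic $\mathcal G$-family in which all the modules $\mathbf M_K$, $K\in\mathcal K$, are finite. Let $K/\mathbb Q$ be a cyclic extension and assume that for all sub-extensions $k/k'$ of $K/\mathbb Q$ the maps $\mathbf N_{k/k'}:\mathbf M_k\to\mathbf M_{k'}$ are surjective. Then $$\#\mathbf M_K=\prod_{\chi\in\mathcal X_K}\#\mathbf M^{\rm ar}_\chi,\qquad\text{where }\ \mathbf M^{\rm ar}_\chi:=\{x\in\mathbf M_{K_\chi},\ \mathbf N_{K_\chi/k}(x)=1\ \text{for all subfields }k\subsetneq K_\chi\}.$$ Let $p$ be a prime, $\mathcal M_K:=\mathbf M_K\otimes\mathbb Z_p$ and $\mathcal M^{\rm ar}_\chi:=\mathbf M^{\rm ar}_\chi\otimes\mathbb Z_p$. If, instead of the cyclicity of the abelian extension $K/\mathbb Q$, one assumes only the cyclicity of the $p$-Sylow subgroup of $\mathrm{Gal}(K/\mathbb Q)$ (the surjectivity assumption on the norms being kept), then $\#\mathcal M_K=\prod_{\chi\in\mathcal X_K}\#\mathcal M^{\rm ar}_\chi$.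
   Context: $\mathbb Q^{\rm ab}$ is the maximal abelian extension of $\mathbb Q$, $\mathcal G:=\mathrm{Gal}(\mathbb Q^{\rm ab}/\mathbb Q)$, and $\mathcal K$ is the set of finite extensions of $\mathbb Q$ contained in $\mathbb Q^{\rm ab}$. An arithmetic $\mathcal G$-family $(\mathbf M,\mathbf N,\mathbf J)$ consists of (multiplicatively written) $\mathbb Z[\mathcal G]$-modules $\mathbf M_K$, $K\in\mathcal K$, and, for all $k\subseteq K$ in $\mathcal K$, of $\mathcal G$-module homomorphisms $\mathbf N_{K/k}:\mathbf M_K\to\mathbf M_k$ (arithmetic norms) and $\mathbf J_{K/k}:\mathbf M_k\to\mathbf M_K$ (transfers) such that: (a) $\mathrm{Gal}(\mathbb Q^{\rm ab}/K)$ acts trivially on $\mathbf M_K$; (b) $\mathbf N_{K/k}\circ\mathbf N_{L/K}=\mathbf N_{L/k}$ and $\mathbf J_{L/K}\circ\mathbf J_{K/k}=\mathbf J_{L/k}$ for $k\subseteq K\subseteq L$; (c) $\mathbf J_{K/k}\circ\mathbf N_{K/k}=\nu_{K/k}$ on $\mathbf M_K$, where $\nu_{K/k}:=\sum_{\sigma\in\mathrm{Gal}(K/k)}\sigma$. An irreducible rational character $\chi$ of $\mathcal G$ is the sum of the $\mathrm{Gal}(\overline{\mathbb Q}/\mathbb Q)$-conjugates of a degree one character $\psi$ of finite order; $K_\chi$ is the (cyclic) subfield of $\mathbb Q^{\rm ab}$ fixed by $\mathrm{Ker}(\psi)$; $\mathcal X_K$ is the set of irreducible rational characters $\chi$ with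 $K_\chi\subseteq K$. *)

theory Defs
  imports
    "HOL-Algebra.Algebra"
    "HOL-Algebra.Algebraic_Closure_Type"
    "HOL-Algebra.Group_Action"
    "HOL-Algebra.Elementary_Groups"
    "HOL-Computational_Algebra.Computational_Algebra"
begin

section \<open>Abelian number fields inside the complex numbers\<close>

abbreviation complex_field :: "complex ring" where
  "complex_field \<equiv> ring_of_type_algebra"

text \<open>Automorphisms are extensional functions on \<open>L\<close> (as in \<^const>\<open>BijGroup\<close>), so that
  distinct elements of the carrier are distinct automorphisms of \<open>L\<close>.\<close>

definition galois_group :: "complex set \<Rightarrow> complex set \<Rightarrow> (complex \<Rightarrow> complex) monoid" where
  "galois_group L k = (BijGroup L)\<lparr>carrier :=
     {\<sigma> \<in> Bij L. \<sigma> \<in> ring_hom (complex_field\<lparr>carrier := L\<rparr>) (complex_field\<lparr>carrier := L\<rparr>)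
        \<and> (\<forall>x\<in>k. \<sigma> x = x)}\<rparr>"

definition fixed_field :: "complex set \<Rightarrow> (complex \<Rightarrow> complex) set \<Rightarrow> complex set" where
  "fixed_field L H = {x \<in> L. \<forall>\<sigma>\<in>H. \<sigma> x = x}"

definition finite_abelian_extension :: "complex set \<Rightarrow> bool" where
  "finite_abelian_extension L \<longleftrightarrow>
     subfield L complex_field \<and> ring.finite_dimension complex_field \<rat> L \<and>
     fixed_field L (carrier (galois_group L \<rat>)) = \<rat> \<and>
     comm_group (galois_group L \<rat>)"

text \<open>The maximal abelian extension of the rationals, as the compositum of all finite ones.\<close>

definition Qab :: "complex set" where
  "Qab = generate_field complex_field (\<Union>{L. finite_abelian_extension L})"

abbreviation Gab :: "(complex \<Rightarrow> complex) monoid" where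
  "Gab \<equiv> galois_group Qab \<rat>"

definition abelian_fields :: "complex set set" where
  "abelian_fields = {K. subfield K complex_field \<and> K \<subseteq> Qab \<and>
     ring.finite_dimension complex_field \<rat> K}"


section \<open>Arithmetic families\<close>

definition galois_lift :: "complex set \<Rightarrow> (complex \<Rightarrow> complex) \<Rightarrow> complex \<Rightarrow> complex" where
  "galois_lift K \<tau> = (SOME \<sigma>. \<sigma> \<in> carrier Gab \<and> restrict \<sigma> K = \<tau>)"

text \<open>The modules \<open>M K\<close> are abelian groups written multiplicatively, with \<open>\<sigma>\<close> acting on \<open>M K\<close>
  by \<open>act K \<sigma>\<close>; \<open>N K k\<close> and \<open>J K k\<close> are the norm \<open>M K \<rightarrow> M k\<close> and the transfer
  \<open>M k \<rightarrow> M K\<close> for \<open>k \<subseteq> K\<close>.  In \<open>transfer_norm\<close> the group \<open>Gal(K/k)\<close> acts on \<open>M K\<close> through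
  lifts to \<^const>\<open>Qab\<close>; by \<open>act_trivial\<close> the choice of the lift does not matter.\<close>

locale arithmetic_family =
  fixes M :: "complex set \<Rightarrow> 'a monoid"
    and act :: "complex set \<Rightarrow> (complex \<Rightarrow> complex) \<Rightarrow> 'a \<Rightarrow> 'a"
    and N :: "complex set \<Rightarrow> complex set \<Rightarrow> 'a \<Rightarrow> 'a"
    and J :: "complex set \<Rightarrow> complex set \<Rightarrow> 'a \<Rightarrow> 'a"
  assumes comm_group_M: "K \<in> abelian_fields \<Longrightarrow> comm_group (M K)"
    and action: "K \<in> abelian_fields \<Longrightarrow> group_action Gab (carrier (M K)) (act K)"
    and act_hom: "\<lbrakk>K \<in> abelian_fields; \<sigma> \<in> carrier Gab\<rbrakk> \<Longrightarrow> act K \<sigma> \<in> hom (M K) (M K)"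
    and norm_hom: "\<lbrakk>k \<in> abelian_fields; K \<in> abelian_fields; k \<subseteq> K\<rbrakk>
      \<Longrightarrow> N K k \<in> hom (M K) (M k)"
    and norm_equivariant: "\<lbrakk>k \<in> abelian_fields; K \<in> abelian_fields; k \<subseteq> K;
        \<sigma> \<in> carrier Gab; x \<in> carrier (M K)\<rbrakk> \<Longrightarrow> N K k (act K \<sigma> x) = act k \<sigma> (N K k x)"
    and transfer_hom: "\<lbrakk>k \<in> abelian_fields; K \<in> abelian_fields; k \<subseteq> K\<rbrakk>
      \<Longrightarrow> J K k \<in> hom (M k) (M K)"
    and transfer_equivariant: "\<lbrakk>k \<in> abelian_fields; K \<in> abelian_fields; k \<subseteq> K;
        \<sigma> \<in> carrier Gab; x \<in> carrier (M k)\<rbrakk> \<Longrightarrow> J K k (act k \<sigma> x) = act K \<sigma> (J K k x)"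
    and act_trivial: "\<lbrakk>K \<in> abelian_fields; \<sigma> \<in> carrier (galois_group Qab K); x \<in> carrier (M K)\<rbrakk>
      \<Longrightarrow> act K \<sigma> x = x"
    and norm_trans: "\<lbrakk>k \<in> abelian_fields; K \<in> abelian_fields; L \<in> abelian_fields;
        k \<subseteq> K; K \<subseteq> L; x \<in> carrier (M L)\<rbrakk> \<Longrightarrow> N K k (N L K x) = N L k x"
    and transfer_trans: "\<lbrakk>k \<in> abelian_fields; K \<in> abelian_fields; L \<in> abelian_fields;
        k \<subseteq> K; K \<subseteq> L; x \<in> carrier (M k)\<rbrakk> \<Longrightarrow> J L K (J K k x) = J L k x"
    and transfer_norm: "\<lbrakk>k \<in> abelian_fields; K \<in> abelian_fields; k \<subseteq> K; x \<in> carrier (M K)\<rbrakk>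
      \<Longrightarrow> J K k (N K k x) =
          finprod (M K) (\<lambda>\<tau>. act K (galois_lift K \<tau>) x) (carrier (galois_group K k))"


section \<open>Irreducible rational characters\<close>

text \<open>Characters of the profinite group \<open>Gal(Qab/Q)\<close> are continuous; for those of finite order
  this means that the kernel is open, i.e. contains \<open>Gal(Qab/L)\<close> for some number field
  \<open>L \<subseteq> Qab\<close>.\<close>

definition linear_characters :: "((complex \<Rightarrow> complex) \<Rightarrow> complex) set" where
  "linear_characters = {\<psi> \<in> hom Gab (units_of complex_field) \<inter> extensional (carrier Gab).
     (\<exists>n>0. \<forall>\<sigma>\<in>carrier Gab. \<psi> \<sigma> ^ n = 1) \<and>
     (\<exists>L\<in>abelian_fields. carrier (galois_group Qab L)
        \<subseteq> kernel Gab (units_of complex_field) \<psi>)}"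

definition Qbar :: "complex set" where
  "Qbar = {z. algebraic z}"

definition conjugate_characters ::
    "((complex \<Rightarrow> complex) \<Rightarrow> complex) \<Rightarrow> ((complex \<Rightarrow> complex) \<Rightarrow> complex) set" where
  "conjugate_characters \<psi> =
     (\<lambda>\<tau>. \<lambda>\<sigma>\<in>carrier Gab. \<tau> (\<psi> \<sigma>)) ` carrier (galois_group Qbar \<rat>)"

text \<open>Each of the (finitely many) distinct conjugates of \<open>\<psi>\<close> occurs once in the sum.\<close>

definition rational_character ::
    "((complex \<Rightarrow> complex) \<Rightarrow> complex) \<Rightarrow> (complex \<Rightarrow> complex) \<Rightarrow> complex" where
  "rational_character \<psi> = (\<lambda>\<sigma>\<in>carrier Gab. \<Sum>\<psi>'\<in>conjugate_characters \<psi>. \<psi>' \<sigma>)"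

definition irreducible_rational_characters :: "((complex \<Rightarrow> complex) \<Rightarrow> complex) set" where
  "irreducible_rational_characters = rational_character ` linear_characters"

text \<open>The field is independent of the constituent \<open>\<psi>\<close> of \<open>\<chi>\<close>, since distinct characters are
  linearly independent and conjugate ones have the same kernel.\<close>

definition character_field :: "((complex \<Rightarrow> complex) \<Rightarrow> complex) \<Rightarrow> complex set" where
  "character_field \<chi> = (THE L. \<exists>\<psi>\<in>linear_characters. \<chi> = rational_character \<psi> \<and>
     L = fixed_field Qab (kernel Gab (units_of complex_field) \<psi>))"

definition characters_of_field :: "complex set \<Rightarrow> ((complex \<Rightarrow> complex) \<Rightarrow> complex) set" where
  "characters_of_field K = {\<chi> \<in> irreducible_rational_characters. character_field \<chi> \<subseteq> K}"

definition arithmetic_component :: "(complex set \<Rightarrow> 'a monoid) \<Rightarrow>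
    (complex set \<Rightarrow> complex set \<Rightarrow> 'a \<Rightarrow> 'a) \<Rightarrow> ((complex \<Rightarrow> complex) \<Rightarrow> complex) \<Rightarrow> 'a monoid" where
  "arithmetic_component M N \<chi> = (M (character_field \<chi>))\<lparr>carrier :=
     {x \<in> carrier (M (character_field \<chi>)).
        \<forall>k. subfield k complex_field \<and> k \<subset> character_field \<chi>
          \<longrightarrow> N (character_field \<chi>) k x = \<one>\<^bsub>M k\<^esub>}\<rparr>"


section \<open>Tensor products with the p-adic integers\<close>

text \<open>The inverse limit of the rings \<open>Z/p^n\<close>, with residues in \<open>{0..<p^n}\<close>.\<close>

definition padic_integers :: "nat \<Rightarrow> (nat \<Rightarrow> int) ring" where
  "padic_integers p =
     \<lparr>carrier = {x. \<forall>n. x n \<in> {0..<int p ^ n} \<and> x (Suc n) mod int p ^ n = x n},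
      monoid.mult = (\<lambda>x y n. (x n * y n) mod int p ^ n),
      one = (\<lambda>n. 1 mod int p ^ n),
      ring.zero = (\<lambda>n. 0),
      add = (\<lambda>x y n. (x n + y n) mod int p ^ n)\<rparr>"

definition bilinear_relations ::
    "('a, 'c) monoid_scheme \<Rightarrow> ('b, 'd) monoid_scheme \<Rightarrow> ('a \<times> 'b \<Rightarrow>\<^sub>0 int) set" where
  "bilinear_relations A B =
     {frag_of (a \<otimes>\<^bsub>A\<^esub> a', b) - frag_of (a, b) - frag_of (a', b) | a a' b.
        a \<in> carrier A \<and> a' \<in> carrier A \<and> b \<in> carrier B} \<union>
     {frag_of (a, b \<otimes>\<^bsub>B\<^esub> b') - frag_of (a, b) - frag_of (a, b') | a b b'.
        a \<in> carrier A \<and> b \<in> carrier B \<and> b' \<in> carrier B}"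

definition tensor_Z :: "('a, 'c) monoid_scheme \<Rightarrow> ('b, 'd) monoid_scheme
    \<Rightarrow> ('a \<times> 'b \<Rightarrow>\<^sub>0 int) set monoid" where
  "tensor_Z A B = (let F = free_Abelian_group (carrier A \<times> carrier B)
     in F Mod generate F (bilinear_relations A B))"

abbreviation tensor_Zp :: "('a, 'c) monoid_scheme \<Rightarrow> nat
    \<Rightarrow> ('a \<times> (nat \<Rightarrow> int) \<Rightarrow>\<^sub>0 int) set monoid" where
  "tensor_Zp A p \<equiv> tensor_Z A (add_monoid (padic_integers p))"

definition sylow_subgroup :: "nat \<Rightarrow> ('a, 'b) monoid_scheme \<Rightarrow> 'a set \<Rightarrow> bool" where
  "sylow_subgroup p G P \<longleftrightarrow> subgroup P G \<and> card P = p ^ multiplicity p (Coset.order G)"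

end

theory Submission
  imports Defs
begin

text \<open>Both halves are statements about valuations. For a finite abelian group \<open>A\<close> the tensor product of
\<open>A\<close> with the \<open>p\<close>-adic integers has order \<open>p ^ multiplicity p (card A)\<close> (\<open>order_tensor_Zp\<close>), and two
positive integers agree as soon as their multiplicities at all primes do. So everything follows from
one formula for one prime \<open>p\<close> (\<open>multiplicity_card_M\<close>): if a \<open>p\<close>-Sylow subgroup \<open>P\<close> of
\<open>G = Gal(K/\<rat>)\<close> is cyclic, then the \<open>p\<close>-multiplicity of the order of \<open>M K\<close> is the sum, over the
subfields \<open>k\<close> of \<open>K\<close> that are cyclic over \<open>\<rat>\<close>, of the \<open>p\<close>-multiplicities of the orders of
\<open>A k = {x \<in> M k. all norms of x to proper subfields of k are trivial}\<close>. When \<open>G\<close> is cyclic this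
applies to every prime.

The formula is group theory. Index the modules by subgroups of \<open>G\<close>, so that \<open>M H\<close> belongs to the
fixed field of \<open>H\<close>, the module of \<open>K\<close> itself is \<open>M 1\<close>, and norms go from \<open>M H\<close> to \<open>M H'\<close> for
\<open>H \<subseteq> H'\<close>. Filter \<open>M 1\<close> by the joint kernels of the norms \<open>M 1 \<rightarrow> M H\<close>, with \<open>H\<close> in an upward closed
set of subgroups. Adding a maximal new \<open>H\<close> to the set, the norm embeds the corresponding quotient of
the filtration into \<open>A H\<close>. This embedding has image of index prime to \<open>p\<close> (\<open>lift_component\<close>): let
\<open>x \<in> M 1\<close> have norm \<open>a \<in> A H\<close>. Since a transfer after a norm is a trace, the trace of \<open>C\<close> kills an
element of \<open>M H\<close> whose norm to \<open>M (HC)\<close> is trivial (\<open>trace_trivial\<close>). Hence the operators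
\<open>|C| - trace C\<close>, for the subgroups \<open>C\<close> of order prime to \<open>p\<close> not contained in \<open>H\<close>, followed by the
trace of the prime-to-\<open>p\<close> part of \<open>H\<close>, raise \<open>a\<close> to a power prime to \<open>p\<close>; and they kill the norm of
\<open>x\<close> in every \<open>M H'\<close> with \<open>H'\<close> not contained in \<open>H\<close>. The last claim is where \<open>P\<close> has to be cyclic: the
\<open>p\<close>-parts of \<open>H\<close> and \<open>H'\<close> are then comparable. Summing over the filtration gives the formula with all
subgroups \<open>H\<close>. If \<open>G/H\<close> is not cyclic, it contains two independent elements of some prime order
\<open>q \<noteq> p\<close>, and a relation between traces shows that \<open>A H\<close> is killed by \<open>q\<close> (\<open>comp_torsion\<close>); so such
\<open>H\<close> do not contribute.

Finally \<open>\<chi> \<mapsto> K\<^sub>\<chi>\<close> is a bijection from the characters of \<open>K\<close> onto the subfields of \<open>K\<close> that are cyclic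
over \<open>\<rat>\<close> (\<open>inj_character_field\<close>, \<open>character_field_image\<close>). A finite cyclic group has a faithful
character. Two characters with the same kernel take a generator to primitive roots of unity of
the same order, which are conjugate over \<open>\<rat>\<close> because the cyclotomic polynomials are irreducible
(\<open>root_of_unity_conjugate\<close>). And \<open>\<chi>\<close> determines the kernel of \<open>\<psi>\<close> as the set where \<open>\<chi>\<close> takes its
value at the identity. The Galois theory used here rests on the extension of embeddings to the
algebraic numbers (\<open>extend_emb\<close>) and on Artin's theorem (\<open>artin\<close>).\<close>

section \<open>Finite abelian groups\<close>

lemma (in group) cauchy_theorem:
  assumes "Factorial_Ring.prime p" "finite (carrier G)" "p dvd Coset.order G"
  obtains x where "x \<in> carrier G" "x \<noteq> \<one>" "x [^] p = \<one>"
proof -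
  obtain m where "Coset.order G = p ^ 1 * m" using assms(3) by auto
  then obtain H where H: "subgroup H G" "card H = p"
    using sylow_thm[of p G 1 m] assms is_group by auto
  interpret H: group "G\<lparr>carrier := H\<rparr>" using subgroup_imp_group[OF H(1)] .
  have "card H \<noteq> 1" using H(2) assms(1) by (metis not_prime_1)
  then obtain x where x: "x \<in> H" "x \<noteq> \<one>"
    using subgroup.one_closed[OF H(1)] by (metis is_singletonI' is_singleton_altdef empty_iff)
  have "x [^]\<^bsub>G\<lparr>carrier := H\<rparr>\<^esub> p = \<one>"
    using H.pow_order_eq_1[of x] x H(2) by (simp add: Coset.order_def)
  hence "x [^] p = \<one>" by (metis nat_pow_consistent)
  then show ?thesis using that[of x] x subgroup.mem_carrier[OF H(1)] by blast
qed

text \<open>Otherwise Cauchy's theorem would give an element of order \<open>p\<close>. In this form the lemma shows that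
a group has no \<open>p\<close>-part from exponents that may depend on the element.\<close>

lemma (in group) prime_not_dvd_order:
  assumes "Factorial_Ring.prime p" "finite (carrier G)"
    and "\<And>x. x \<in> carrier G \<Longrightarrow> \<exists>m::nat. \<not> p dvd m \<and> x [^] m = \<one>"
  shows "\<not> p dvd Coset.order G"
proof
  assume "p dvd Coset.order G"
  then obtain x where x: "x \<in> carrier G" "x \<noteq> \<one>" "x [^] p = \<one>"
    using cauchy_theorem assms(1,2) by metis
  then obtain m :: nat where m: "\<not> p dvd m" "x [^] m = \<one>" using assms(3) by blast
  have "ord x dvd p" "ord x dvd m" using x m pow_eq_id by auto
  then have "ord x = 1" using assms(1) m(1) by (metis prime_nat_iff)
  then show False using x ord_eq_1 by auto
qed

lemma hom_finprod:
  assumes "comm_monoid G" "comm_monoid H" "h \<in> hom G H" "h \<one>\<^bsub>G\<^esub> = \<one>\<^bsub>H\<^esub>"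
    and "\<And>a. a \<in> A \<Longrightarrow> f a \<in> carrier G"
  shows "h (finprod G f A) = finprod H (\<lambda>a. h (f a)) A"
proof (cases "finite A")
  case True
  interpret G: comm_monoid G by fact
  interpret H: comm_monoid H by fact
  have hc: "\<And>x. x \<in> carrier G \<Longrightarrow> h x \<in> carrier H" using assms(3) by (auto simp: hom_def)
  show ?thesis using True assms(5)
  proof (induction A)
    case (insert a A)
    then have "h (finprod G f (insert a A)) = h (f a \<otimes>\<^bsub>G\<^esub> finprod G f A)"
      by (subst G.finprod_insert) auto
    also have "\<dots> = h (f a) \<otimes>\<^bsub>H\<^esub> h (finprod G f A)"
      using insert assms(3) by (intro hom_mult) (auto intro!: G.finprod_closed)
    finally show ?case using insert hc by (subst H.finprod_insert) auto
  qed (simp add: assms(4))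
next
  case False
  interpret G: comm_monoid G by fact
  interpret H: comm_monoid H by fact
  show ?thesis using False by (simp add: assms(4))
qed

lemma (in comm_group) pow_hom: "(\<lambda>x. x [^] (n::nat)) \<in> hom G G"
  by (auto simp: hom_def nat_pow_distrib)

lemma (in comm_group) finprod_pow:
  assumes "\<And>a. a \<in> A \<Longrightarrow> f a \<in> carrier G"
  shows "(finprod G f A) [^] (n::nat) = finprod G (\<lambda>a. f a [^] n) A"
proof -
  have "(\<lambda>x. x [^] n) \<one> = \<one>" by simp
  then show ?thesis
    using hom_finprod[where h = "\<lambda>x. x [^] n", OF comm_monoid_axioms comm_monoid_axioms pow_hom _ assms]
    by simp
qed

text \<open>A product over \<open>C\<close> whose factors depend only on the class \<open>f c\<close> of \<open>c\<close>, where all classes have the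
same size: the trace of a group factors in this way through its action on a quotient.\<close>

lemma (in comm_group) finprod_fibers:
  assumes "finite C" "\<And>r. r \<in> f ` C \<Longrightarrow> h r \<in> carrier G"
    and "\<And>r. r \<in> f ` C \<Longrightarrow> card {c\<in>C. f c = r} = e"
  shows "finprod G (\<lambda>c. h (f c)) C = (finprod G h (f ` C)) [^] (e::nat)"
proof -
  have U: "C = (\<Union>r\<in>f ` C. {c\<in>C. f c = r})" by auto
  have "finprod G (\<lambda>c. h (f c)) C = finprod G (\<lambda>c. h (f c)) (\<Union>r\<in>f ` C. {c\<in>C. f c = r})"
    using U by simp
  also have "\<dots> = finprod G (\<lambda>r. finprod G (\<lambda>c. h (f c)) {c\<in>C. f c = r}) (f ` C)"
    using assms(1,2) by (intro finprod_UN_disjoint) (auto simp: pairwise_def disjnt_def)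
  also have "\<dots> = finprod G (\<lambda>r. h r [^] e) (f ` C)"
  proof (intro finprod_cong' refl)
    fix r assume r: "r \<in> f ` C"
    have "finprod G (\<lambda>c. h (f c)) {c\<in>C. f c = r} = finprod G (\<lambda>c. h r) {c\<in>C. f c = r}"
      using assms(2) r by (intro finprod_cong') auto
    also have "\<dots> = h r [^] e" using finprod_const[of "h r" "{c\<in>C. f c = r}"] assms(2)[OF r] assms(3)[OF r] by simp
    finally show "finprod G (\<lambda>c. h (f c)) {c\<in>C. f c = r} = h r [^] e" .
  qed (use assms(2) in auto)
  also have "\<dots> = (finprod G h (f ` C)) [^] e" using assms(2) by (simp add: finprod_pow)
  finally show ?thesis .
qed

lemma card_hom_kernel_image:
  assumes "group G" "group H" "h \<in> hom G H" "finite (carrier G)"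
  shows "card (carrier G) = card {x\<in>carrier G. h x = \<one>\<^bsub>H\<^esub>} * card (h ` carrier G)"
proof -
  interpret G: group G by fact
  interpret h: group_hom G H h using assms by (simp add: group_hom_def group_hom_axioms_def)
  have fib: "card {x\<in>carrier G. h x = y} = card {x\<in>carrier G. h x = \<one>\<^bsub>H\<^esub>}" if y: "y \<in> h ` carrier G" for y
  proof -
    obtain a where a: "a \<in> carrier G" "h a = y" using y by auto
    have "bij_betw (\<lambda>x. x \<otimes>\<^bsub>G\<^esub> a) {x\<in>carrier G. h x = \<one>\<^bsub>H\<^esub>} {x\<in>carrier G. h x = y}"
      using a by (intro bij_betw_byWitness[where f' = "\<lambda>x. x \<otimes>\<^bsub>G\<^esub> inv\<^bsub>G\<^esub> a"])
        (auto simp: G.m_assoc)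
    from bij_betw_same_card[OF this] show ?thesis by (rule sym)
  qed
  have "carrier G = (\<Union>y\<in>h ` carrier G. {x\<in>carrier G. h x = y})" by auto
  then have "card (carrier G) = card (\<Union>y\<in>h ` carrier G. {x\<in>carrier G. h x = y})" by simp
  also have "\<dots> = (\<Sum>y\<in>h ` carrier G. card {x\<in>carrier G. h x = y})"
    using assms(4) by (intro card_UN_disjoint) auto
  finally have "card (carrier G) = (\<Sum>y\<in>h ` carrier G. card {x\<in>carrier G. h x = y})" .
  also have "\<dots> = card {x\<in>carrier G. h x = \<one>\<^bsub>H\<^esub>} * card (h ` carrier G)" by (simp add: fib)
  finally show ?thesis .
qed

text \<open>Induction on \<open>d\<close>: for a prime divisor \<open>q\<close> of \<open>d\<close>, raising to the \<open>q\<close>-th power maps the solutions of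
\<open>x [^] d = \<one>\<close> to those of \<open>x [^] (d div q) = \<one>\<close>, with kernel of order at most \<open>q\<close>.\<close>

lemma (in comm_group) card_roots_of_unity_le:
  assumes "finite (carrier G)"
    and bound: "\<And>q. Factorial_Ring.prime q \<Longrightarrow> card {x\<in>carrier G. x [^] q = \<one>} \<le> q"
    and "d > 0"
  shows "card {x\<in>carrier G. x [^] (d::nat) = \<one>} \<le> d"
  using \<open>d > 0\<close>
proof (induction d rule: less_induct)
  case (less d)
  show ?case
  proof (cases "d = 1")
    case True
    have "{x\<in>carrier G. x [^] d = \<one>} \<subseteq> {\<one>}" using True by auto
    then have "card {x\<in>carrier G. x [^] d = \<one>} \<le> card {\<one>}" by (intro card_mono) auto
    then show ?thesis using True by simp
  next
    case False
    then obtain q where q: "Factorial_Ring.prime q" "q dvd d" using prime_factor_nat by blast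
    then obtain e where e: "d = q * e" by auto
    have e0: "e > 0" "e < d" using e less.prems q(1) prime_gt_1_nat by auto
    let ?T = "\<lambda>d. {x\<in>carrier G. x [^] (d::nat) = \<one>}"
    have sub: "subgroup (?T n) G" for n
      by (intro subgroupI) (auto simp: nat_pow_distrib nat_pow_inv)
    interpret T: group "G\<lparr>carrier := ?T d\<rparr>" using subgroup_imp_group[OF sub] .
    have "(\<lambda>x. x [^] q) \<in> hom (G\<lparr>carrier := ?T d\<rparr>) G"
      by (auto simp: hom_def nat_pow_distrib)
    then have "card (?T d) = card {x\<in>?T d. x [^] q = \<one>} * card ((\<lambda>x. x [^] q) ` ?T d)"
      using card_hom_kernel_image[OF T.group_axioms group_axioms, of "\<lambda>x. x [^] q"] assms(1) by simp
    also have "\<dots> \<le> q * e"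
    proof (rule mult_le_mono)
      show "card {x\<in>?T d. x [^] q = \<one>} \<le> q"
        using assms(1) by (intro order.trans[OF _ bound[OF q(1)]] card_mono) auto
      have "(\<lambda>x. x [^] q) ` ?T d \<subseteq> ?T e" by (auto simp: nat_pow_pow e)
      then have "card ((\<lambda>x. x [^] q) ` ?T d) \<le> card (?T e)"
        using assms(1) by (intro card_mono) auto
      also have "\<dots> \<le> e" using less.IH e0 by auto
      finally show "card ((\<lambda>x. x [^] q) ` ?T d) \<le> e" .
    qed
    finally show ?thesis using e by simp
  qed
qed

text \<open>The criterion that makes finite subgroups of a field cyclic, with the bound only at primes. For every
prime \<open>q\<close> dividing the order \<open>n\<close> some \<open>x q\<close> has \<open>x q [^] (n div q) \<noteq> \<one>\<close>, because there are at most
\<open>n div q\<close> solutions of the equation; the prime-to-\<open>q\<close> part of \<open>n\<close> as an exponent turns it into an element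
of order the full power of \<open>q\<close> in \<open>n\<close>, and the product of these elements has order \<open>n\<close>.\<close>

lemma (in comm_group) cyclic_if_few_prime_roots:
  assumes fin: "finite (carrier G)"
    and bound: "\<And>q. Factorial_Ring.prime q \<Longrightarrow> card {x\<in>carrier G. x [^] q = \<one>} \<le> q"
  obtains g where "g \<in> carrier G" "ord g = Coset.order G"
    "\<And>x. x \<in> carrier G \<Longrightarrow> \<exists>i::nat. x = g [^] i"
proof -
  define n where "n = Coset.order G"
  have n0: "n > 0" using fin by (simp add: n_def order_gt_0_iff_finite)
  have n1: "x [^] n = \<one>" if "x \<in> carrier G" for x using that pow_order_eq_1 n_def by auto
  define Q where "Q = prime_factors n"
  have Q: "Factorial_Ring.prime q" "q dvd n" if "q \<in> Q" for q using that by (auto simp: Q_def)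
  have "\<exists>x\<in>carrier G. x [^] (n div q) \<noteq> \<one>" if q: "q \<in> Q" for q
  proof (rule ccontr)
    assume "\<not> ?thesis"
    then have eq: "{x\<in>carrier G. x [^] (n div q) = \<one>} = carrier G" by auto
    have "q > 1" using Q[OF q] prime_gt_1_nat by auto
    moreover have "n div q > 0" using Q[OF q] n0 by (metis dvd_div_eq_0_iff gr0I)
    ultimately have "n \<le> n div q"
      using card_roots_of_unity_le[OF fin bound, of "n div q"] eq by (simp add: n_def Coset.order_def)
    then show False using \<open>q > 1\<close> n0 div_less_dividend[of q n] by linarith
  qed
  then obtain x where x: "\<And>q. q \<in> Q \<Longrightarrow> x q \<in> carrier G" "\<And>q. q \<in> Q \<Longrightarrow> x q [^] (n div q) \<noteq> \<one>"
    by metis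
  define a where "a q = q ^ multiplicity q n" for q :: nat
  have a: "a q dvd n" "Suc 0 \<le> multiplicity q n" if "q \<in> Q" for q
    using Q[OF that] n0 by (auto simp: a_def multiplicity_dvd Suc_le_eq prime_multiplicity_gt_zero_iff)
  define y where "y q = x q [^] (n div a q)" for q
  have yc: "q \<in> Q \<Longrightarrow> y q \<in> carrier G" for q using x by (auto simp: y_def)
  define g where "g = finprod G y Q"
  have g: "g \<in> carrier G" using yc by (auto simp: g_def)
  have gq: "g [^] (n div q) \<noteq> \<one>" if q: "q \<in> Q" for q
  proof -
    have "y r [^] (n div q) = \<one>" if r: "r \<in> Q" "r \<noteq> q" for r
    proof -
      have "coprime (a r) q" using Q r q
        by (auto simp: a_def intro!: primes_coprime)
      then have "a r dvd n div q" using a[OF r(1)] Q[OF q]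
        by (metis coprime_dvd_mult_left_iff dvd_div_mult_self)
      then obtain k where "n div q = a r * k" by auto
      then have "y r [^] (n div q) = (x r [^] (n div a r)) [^] (a r * k)" by (simp add: y_def)
      also have "\<dots> = x r [^] (n * k)" using x(1) r(1) a[OF r(1)]
        by (simp add: nat_pow_pow mult.assoc[symmetric])
      also have "\<dots> = \<one>" using x(1) r(1) n1 by (simp flip: nat_pow_pow)
      finally show ?thesis .
    qed
    then have "finprod G (\<lambda>r. y r [^] (n div q)) (Q - {q}) = \<one>" by (intro finprod_one_eqI) auto
    moreover have "finprod G (\<lambda>r. y r [^] (n div q)) (insert q (Q - {q}))
        = y q [^] (n div q) \<otimes> finprod G (\<lambda>r. y r [^] (n div q)) (Q - {q})"
      using yc q by (intro finprod_insert) (auto simp: Q_def)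
    ultimately have "g [^] (n div q) = y q [^] (n div q)"
      using yc q by (simp add: g_def finprod_pow insert_absorb)
    moreover have "y q [^] (n div q) \<noteq> \<one>"
    proof
      assume *: "y q [^] (n div q) = \<one>"
      obtain b where b: "multiplicity q n = Suc b" using a(2)[OF q] by (cases "multiplicity q n") auto
      have qb: "a q = q * q ^ b" by (simp add: a_def b)
      obtain c where c: "n = a q * c" using a(1)[OF q] by auto
      have q0: "q > 0" using Q[OF q] prime_gt_0_nat by auto
      have nc: "n div a q = c" "n div q = q ^ b * c" using c qb q0 by auto
      have "\<not> q dvd n div q ^ multiplicity q n"
        by (rule multiplicity_decompose) (use n0 Q[OF q] in \<open>auto simp: not_prime_unit\<close>)
      then have "\<not> q dvd c" using nc(1) by (simp add: a_def)
      then have "coprime c q" using Q[OF q] by (metis coprime_commute prime_imp_coprime_nat)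
      moreover have "x q [^] (c * (q ^ b * c)) = \<one>" using * x(1)[OF q] by (simp add: y_def nc nat_pow_pow)
      then have "ord (x q) dvd c * (q ^ b * c)" using x(1)[OF q] by (simp add: pow_eq_id)
      then have "ord (x q) dvd (q ^ b * c) * c" by (simp add: ac_simps)
      moreover have "ord (x q) dvd q * (q ^ b * c)" using n1[OF x(1)[OF q]] c qb x(1)[OF q]
        by (simp add: pow_eq_id mult.assoc)
      then have "ord (x q) dvd (q ^ b * c) * q" by (simp add: ac_simps)
      ultimately have "ord (x q) dvd (q ^ b * c) * gcd c q"
        by (metis gcd_greatest gcd_mult_distrib_nat)
      then have "ord (x q) dvd q ^ b * c" using \<open>coprime c q\<close> by simp
      then show False using x(2)[OF q] x(1)[OF q] by (simp add: nc pow_eq_id)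
    qed
    ultimately show ?thesis by simp
  qed
  have "ord g dvd n" using g n_def ord_dvd_group_order by auto
  then obtain k where k: "n = ord g * k" by auto
  have "k = 1"
  proof (rule ccontr)
    assume "k \<noteq> 1"
    then obtain q where q: "Factorial_Ring.prime q" "q dvd k" using prime_factor_nat by blast
    then obtain l where l: "k = q * l" by auto
    have "q \<in> Q" using q k n0 by (auto simp: Q_def prime_factors_dvd)
    moreover have "n div q = ord g * l" using k l prime_gt_0_nat[OF q(1)] by auto
    ultimately show False using gq g by (metis dvd_triv_left pow_eq_id)
  qed
  then have o: "ord g = Coset.order G" using k n_def by simp
  have "card (generate G {g}) = card (carrier G)" using generate_pow_card[OF g] o by (simp add: Coset.order_def)
  then have gen: "generate G {g} = carrier G" using fin generate_in_carrier[of "{g}"] g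
    by (intro card_subset_eq) auto
  have "ord g \<noteq> 0" using o n0 n_def by simp
  then have "\<exists>i::nat. x = g [^] i" if "x \<in> carrier G" for x
    using generate_pow_nat[OF g] gen that by auto
  then show ?thesis using that g o by blast
qed

lemma (in group) set_mult_upper:
  assumes "subgroup H G" "subgroup C G"
  shows "H \<subseteq> H <#> C" "C \<subseteq> H <#> C"
proof -
  have "h \<in> H <#> C" if "h \<in> H" for h
  proof -
    have "h = h \<otimes> \<one>" using subgroup.mem_carrier[OF assms(1) that] by simp
    then show ?thesis unfolding set_mult_def using that subgroup.one_closed[OF assms(2)] by blast
  qed
  moreover have "c \<in> H <#> C" if "c \<in> C" for c
  proof -
    have "c = \<one> \<otimes> c" using subgroup.mem_carrier[OF assms(2) that] by simp
    then show ?thesis unfolding set_mult_def using that subgroup.one_closed[OF assms(1)] by blast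
  qed
  ultimately show "H \<subseteq> H <#> C" "C \<subseteq> H <#> C" by blast+
qed

lemma (in group) cyclic_group_iff_nat_pow:
  assumes "finite (carrier G)"
  shows "cyclic_group G \<longleftrightarrow> (\<exists>g\<in>carrier G. \<forall>x\<in>carrier G. \<exists>i::nat. x = g [^] i)"
proof -
  have "carrier G = range (\<lambda>n::int. g [^] n) \<longleftrightarrow> (\<forall>x\<in>carrier G. \<exists>i::nat. x = g [^] i)"
    if g: "g \<in> carrier G" for g
  proof -
    have "ord g \<noteq> 0" using ord_ge_1[OF assms g] by simp
    then have "range (\<lambda>n::int. g [^] n) = range (\<lambda>n::nat. g [^] n)"
      using generate_pow[OF g] generate_pow_nat[OF g] by (simp add: full_SetCompr_eq)
    moreover have "range (\<lambda>n::nat. g [^] n) \<subseteq> carrier G" using g by auto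
    ultimately show ?thesis by auto
  qed
  then show ?thesis by (auto simp: cyclic_group)
qed

section \<open>Norm-coherent systems of modules indexed by the subgroups of a finite abelian group\<close>

text \<open>What remains of an arithmetic family when the subfields of \<open>K\<close> are replaced by the subgroups of
\<open>G = Gal(K/\<rat>)\<close>. The correspondence reverses inclusions, so \<open>N H H'\<close> with \<open>H \<subseteq> H'\<close> is the norm from the
larger to the smaller field. The transfers enter only through \<open>norm_transversal\<close>: composing a norm with
the transfer gives the trace over coset representatives \<open>R\<close> of \<open>H'\<close> modulo \<open>H\<close>, so an element of trivial
norm has trivial trace.\<close>

locale norm_system = comm_group G for G :: "('g, 'b) monoid_scheme" (structure) +
  fixes M :: "'g set \<Rightarrow> 'a monoid" and act :: "'g set \<Rightarrow> 'g \<Rightarrow> 'a \<Rightarrow> 'a"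
    and N :: "'g set \<Rightarrow> 'g set \<Rightarrow> 'a \<Rightarrow> 'a"
  assumes finite_G: "finite (carrier G)"
    and comm_group_M: "subgroup H G \<Longrightarrow> comm_group (M H)"
    and finite_M: "subgroup H G \<Longrightarrow> finite (carrier (M H))"
    and act_hom: "\<lbrakk>subgroup H G; g \<in> carrier G\<rbrakk> \<Longrightarrow> act H g \<in> hom (M H) (M H)"
    and act_mult: "\<lbrakk>subgroup H G; g \<in> carrier G; h \<in> carrier G; x \<in> carrier (M H)\<rbrakk>
      \<Longrightarrow> act H (g \<otimes> h) x = act H g (act H h x)"
    and act_fix: "\<lbrakk>subgroup H G; h \<in> H; x \<in> carrier (M H)\<rbrakk> \<Longrightarrow> act H h x = x"
    and norm_hom: "\<lbrakk>subgroup H G; subgroup H' G; H \<subseteq> H'\<rbrakk> \<Longrightarrow> N H H' \<in> hom (M H) (M H')"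
    and norm_act: "\<lbrakk>subgroup H G; subgroup H' G; H \<subseteq> H'; g \<in> carrier G; x \<in> carrier (M H)\<rbrakk>
      \<Longrightarrow> N H H' (act H g x) = act H' g (N H H' x)"
    and norm_trans: "\<lbrakk>subgroup H G; subgroup H' G; subgroup H'' G; H \<subseteq> H'; H' \<subseteq> H'';
        x \<in> carrier (M H)\<rbrakk> \<Longrightarrow> N H' H'' (N H H' x) = N H H'' x"
    and norm_surj: "\<lbrakk>subgroup H G; subgroup H' G; H \<subseteq> H'\<rbrakk>
      \<Longrightarrow> N H H' ` carrier (M H) = carrier (M H')"
    and norm_transversal: "\<lbrakk>subgroup H G; subgroup H' G; H \<subseteq> H'; R \<subseteq> H';
        \<And>h. h \<in> H' \<Longrightarrow> \<exists>!r. r \<in> R \<and> h \<otimes> inv r \<in> H;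
        x \<in> carrier (M H); N H H' x = \<one>\<^bsub>M H'\<^esub>\<rbrakk>
      \<Longrightarrow> finprod (M H) (\<lambda>r. act H r x) R = \<one>\<^bsub>M H\<^esub>"
begin

definition comp :: "'g set \<Rightarrow> 'a set" where
  "comp H = {x \<in> carrier (M H). \<forall>H'. subgroup H' G \<longrightarrow> H \<subset> H' \<longrightarrow> N H H' x = \<one>\<^bsub>M H'\<^esub>}"

lemma norm_closed:
  "\<lbrakk>subgroup H G; subgroup H' G; H \<subseteq> H'; x \<in> carrier (M H)\<rbrakk> \<Longrightarrow> N H H' x \<in> carrier (M H')"
  by (rule hom_in_carrier[OF norm_hom])

lemma act_closed:
  "\<lbrakk>subgroup H G; g \<in> carrier G; x \<in> carrier (M H)\<rbrakk> \<Longrightarrow> act H g x \<in> carrier (M H)"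
  by (rule hom_in_carrier[OF act_hom])

lemma group_M: "subgroup H G \<Longrightarrow> group (M H)"
  using comm_group_M by (simp add: comm_group_def)

lemma norm_group_hom:
  "\<lbrakk>subgroup H G; subgroup H' G; H \<subseteq> H'\<rbrakk> \<Longrightarrow> group_hom (M H) (M H') (N H H')"
  by (simp add: group_hom_def group_hom_axioms_def group_M norm_hom)

lemma act_group_hom:
  "\<lbrakk>subgroup H G; g \<in> carrier G\<rbrakk> \<Longrightarrow> group_hom (M H) (M H) (act H g)"
  by (simp add: group_hom_def group_hom_axioms_def group_M act_hom)

lemma norm_one:
  "\<lbrakk>subgroup H G; subgroup H' G; H \<subseteq> H'\<rbrakk> \<Longrightarrow> N H H' \<one>\<^bsub>M H\<^esub> = \<one>\<^bsub>M H'\<^esub>"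
  by (rule group_hom.hom_one[OF norm_group_hom])

lemma finite_subgroups: "finite {H. subgroup H G}"
  by (rule finite_subset[of _ "Pow (carrier G)"]) (use finite_G in \<open>auto dest: subgroup.subset\<close>)

lemma subgroup_comp: "subgroup H G \<Longrightarrow> subgroup (comp H) (M H)"
proof -
  assume H: "subgroup H G"
  interpret MH: comm_group "M H" using comm_group_M[OF H] .
  show ?thesis
  proof (rule MH.subgroupI)
    have "\<one>\<^bsub>M H\<^esub> \<in> comp H" using H by (auto simp: comp_def intro: norm_one)
    then show "comp H \<noteq> {}" by blast
  next
    fix a assume a: "a \<in> comp H"
    have "N H H' (inv\<^bsub>M H\<^esub> a) = \<one>\<^bsub>M H'\<^esub>" if H': "subgroup H' G" "H \<subset> H'" for H'
    proof -
      interpret h: group_hom "M H" "M H'" "N H H'" by (rule norm_group_hom) (use H H' in auto)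
      show ?thesis using a H' by (simp add: comp_def)
    qed
    then show "inv\<^bsub>M H\<^esub> a \<in> comp H" using a by (auto simp: comp_def)
  next
    fix a b assume a: "a \<in> comp H" and b: "b \<in> comp H"
    have "N H H' (a \<otimes>\<^bsub>M H\<^esub> b) = \<one>\<^bsub>M H'\<^esub>" if H': "subgroup H' G" "H \<subset> H'" for H'
    proof -
      interpret h: group_hom "M H" "M H'" "N H H'" by (rule norm_group_hom) (use H H' in auto)
      show ?thesis using a b H' by (simp add: comp_def)
    qed
    then show "a \<otimes>\<^bsub>M H\<^esub> b \<in> comp H" using a b by (auto simp: comp_def)
  qed (auto simp: comp_def)
qed

text \<open>The action of the element \<open>\<Sum>c\<in>C. c\<close> of the group ring, with \<open>M H\<close> written multiplicatively.\<close>

definition trace :: "'g set \<Rightarrow> 'g set \<Rightarrow> 'a \<Rightarrow> 'a" where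
  "trace C H x = finprod (M H) (\<lambda>c. act H c x) C"

lemma trace_closed:
  "\<lbrakk>subgroup H G; C \<subseteq> carrier G; x \<in> carrier (M H)\<rbrakk> \<Longrightarrow> trace C H x \<in> carrier (M H)"
proof -
  assume *: "subgroup H G" "C \<subseteq> carrier G" "x \<in> carrier (M H)"
  interpret MH: comm_group "M H" using comm_group_M *(1) .
  show ?thesis using * by (auto simp: trace_def intro!: MH.finprod_closed act_closed)
qed

lemma norm_trace:
  assumes "subgroup H G" "subgroup H' G" "H \<subseteq> H'" "C \<subseteq> carrier G" "x \<in> carrier (M H)"
  shows "N H H' (trace C H x) = trace C H' (N H H' x)"
proof -
  interpret MH: comm_group "M H" using comm_group_M assms(1) .
  interpret MH': comm_group "M H'" using comm_group_M assms(2) .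
  have "N H H' (trace C H x) = finprod (M H') (\<lambda>c. N H H' (act H c x)) C"
    unfolding trace_def using assms
    by (intro hom_finprod MH.comm_monoid_axioms MH'.comm_monoid_axioms norm_hom norm_one act_closed) auto
  also have "\<dots> = trace C H' (N H H' x)"
    unfolding trace_def using assms
    by (intro MH'.finprod_cong') (auto intro!: norm_act act_closed norm_closed)
  finally show ?thesis .
qed

lemma trace_fixed:
  assumes "subgroup H G" "C \<subseteq> H" "x \<in> carrier (M H)"
  shows "trace C H x = x [^]\<^bsub>M H\<^esub> card C"
proof -
  interpret MH: comm_group "M H" using comm_group_M assms(1) .
  have "trace C H x = finprod (M H) (\<lambda>c. x) C"
    unfolding trace_def using assms by (intro MH.finprod_cong') (auto intro: act_fix)
  then show ?thesis using MH.finprod_const assms(3) by simp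
qed

lemma trace_one:
  assumes "subgroup H G" "C \<subseteq> carrier G"
  shows "trace C H \<one>\<^bsub>M H\<^esub> = \<one>\<^bsub>M H\<^esub>"
proof -
  interpret MH: comm_group "M H" using comm_group_M assms(1) .
  have "act H c \<one>\<^bsub>M H\<^esub> = \<one>\<^bsub>M H\<^esub>" if "c \<in> C" for c
    by (rule group_hom.hom_one[OF act_group_hom]) (use assms that in auto)
  then show ?thesis unfolding trace_def by (intro MH.finprod_one_eqI)
qed

text \<open>The action of \<open>C\<close> on \<open>M H\<close> factors through \<open>C / (C \<inter> H) = HC / H\<close>. Hence the trace of \<open>C\<close> is the trace
over representatives of \<open>HC\<close> modulo \<open>H\<close>, raised to the power \<open>|C \<inter> H|\<close>, and the former is trivial.\<close>

lemma trace_trivial: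
  assumes H: "subgroup H G" and C: "subgroup C G" and x: "x \<in> carrier (M H)"
    and N1: "N H (H <#> C) x = \<one>\<^bsub>M (H <#> C)\<^esub>"
  shows "trace C H x = \<one>\<^bsub>M H\<^esub>"
proof -
  interpret MH: comm_group "M H" using comm_group_M H .
  interpret H: subgroup H G by fact
  interpret C: subgroup C G by fact
  have finC: "finite C" using finite_G C.subset finite_subset by auto
  have HC: "subgroup (H <#> C) G" using mult_subgroups H C by auto
  note HC1 = set_mult_upper(1)[OF H C] and HC2 = set_mult_upper(2)[OF H C]
  \<comment> \<open>\<open>\<rho> c\<close> is the chosen representative in \<open>C\<close> of the coset of \<open>c\<close> modulo \<open>H\<close>; \<open>\<rho> ` C\<close> is then a
    transversal of \<open>HC\<close> modulo \<open>H\<close>.\<close>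
  define \<rho> where "\<rho> c = (SOME c'. c' \<in> C \<and> c \<otimes> inv c' \<in> H)" for c
  have \<rho>: "\<rho> c \<in> C \<and> c \<otimes> inv (\<rho> c) \<in> H" if "c \<in> C" for c
    unfolding \<rho>_def by (rule someI[where x = c]) (use that C.mem_carrier[OF that] H.one_closed in auto)
  have \<rho>C: "\<rho> ` C \<subseteq> C" using \<rho> by blast
  have cong: "(\<lambda>c'. c' \<in> C \<and> c \<otimes> inv c' \<in> H) = (\<lambda>c'. c' \<in> C \<and> d \<otimes> inv c' \<in> H)"
    if cd: "c \<in> C" "d \<in> C" "c \<otimes> inv d \<in> H" for c d
  proof (rule ext, rule conj_cong[OF refl])
    fix e assume e: "e \<in> C"
    have m: "c \<in> carrier G" "d \<in> carrier G" "e \<in> carrier G" using cd e C.mem_carrier by auto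
    have "c \<otimes> inv e = (c \<otimes> inv d) \<otimes> (d \<otimes> inv e)" using m by (metis inv_closed inv_solve_right m_assoc m_closed)
    moreover have "d \<otimes> inv e = inv (c \<otimes> inv d) \<otimes> (c \<otimes> inv e)" using m calculation
      by (metis inv_closed inv_solve_left m_closed)
    ultimately show "(c \<otimes> inv e \<in> H) = (d \<otimes> inv e \<in> H)"
      using cd(3) H.m_closed H.m_inv_closed by metis
  qed
  have \<rho>_eq: "\<rho> c = \<rho> d" if "c \<in> C" "d \<in> C" "c \<otimes> inv d \<in> H" for c d
    unfolding \<rho>_def cong[OF that] ..
  have \<rho>_iff: "\<rho> c = r \<longleftrightarrow> c \<otimes> inv r \<in> H" if cC: "c \<in> C" and rC: "r \<in> \<rho> ` C" for c r
  proof -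
    obtain d where d: "d \<in> C" "r = \<rho> d" using rC by auto
    have "\<rho> r = r" using \<rho>_eq[of d r] \<rho>[OF d(1)] d by auto
    then show ?thesis using \<rho>[OF cC] \<rho>_eq[OF cC, of r] \<rho>[OF d(1)] d by auto
  qed
  have R: "\<rho> ` C \<subseteq> H <#> C" using \<rho>C HC2 by auto
  have act_eq: "act H c x = act H (\<rho> c) x" if c: "c \<in> C" for c
  proof -
    have m: "c \<in> carrier G" "\<rho> c \<in> carrier G" using c \<rho> C.mem_carrier by auto
    have "c = \<rho> c \<otimes> (c \<otimes> inv (\<rho> c))" using m by (simp add: m_lcomm)
    then show ?thesis using act_mult[OF H m(2), of "c \<otimes> inv (\<rho> c)" x] act_fix[OF H _ x] \<rho>[OF c] x m
      by auto
  qed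
  have transv: "\<exists>!r. r \<in> \<rho> ` C \<and> h \<otimes> inv r \<in> H" if h: "h \<in> H <#> C" for h
  proof -
    obtain a c where ac: "a \<in> H" "c \<in> C" "h = a \<otimes> c" using h by (auto simp: set_mult_def)
    have "h \<otimes> inv r \<in> H \<longleftrightarrow> \<rho> c = r" if r: "r \<in> \<rho> ` C" for r
    proof -
      have m: "a \<in> carrier G" "c \<in> carrier G" "r \<in> carrier G"
        using H.mem_carrier[OF ac(1)] C.mem_carrier[OF ac(2)] r \<rho>C C.subset by auto
      have "h \<otimes> inv r = a \<otimes> (c \<otimes> inv r)" using m ac by (simp add: m_assoc)
      moreover have "c \<otimes> inv r = inv a \<otimes> (h \<otimes> inv r)"
        using m calculation by (metis inv_closed inv_solve_left m_closed)
      ultimately have "h \<otimes> inv r \<in> H \<longleftrightarrow> c \<otimes> inv r \<in> H" using ac(1) H.m_closed H.m_inv_closed by metis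
      then show ?thesis using \<rho>_iff[OF ac(2) r] by simp
    qed
    then show ?thesis using ac(2) by auto
  qed
  have card: "card {c\<in>C. \<rho> c = r} = card (C \<inter> H)" if r: "r \<in> \<rho> ` C" for r
  proof -
    have rC: "r \<in> C" using r \<rho>C by auto
    then have m: "r \<in> carrier G" by auto
    have "bij_betw (\<lambda>d. d \<otimes> r) (C \<inter> H) {c\<in>C. \<rho> c = r}"
    proof (rule bij_betw_byWitness[where f' = "\<lambda>c. c \<otimes> inv r"])
      show "\<forall>d\<in>C \<inter> H. d \<otimes> r \<otimes> inv r = d" using m by (simp add: m_assoc)
      show "\<forall>c\<in>{c \<in> C. \<rho> c = r}. c \<otimes> inv r \<otimes> r = c" using m by (simp add: m_assoc)
      show "(\<lambda>d. d \<otimes> r) ` (C \<inter> H) \<subseteq> {c \<in> C. \<rho> c = r}"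
        using m rC by (auto simp: \<rho>_iff[OF _ r] m_assoc)
      show "(\<lambda>c. c \<otimes> inv r) ` {c \<in> C. \<rho> c = r} \<subseteq> C \<inter> H"
      proof clarify
        fix c assume "c \<in> C" "r = \<rho> c"
        then show "c \<otimes> inv \<rho> c \<in> C \<inter> H" using \<rho>[of c] rC by simp
      qed
    qed
    from bij_betw_same_card[OF this] show ?thesis by (rule sym)
  qed
  have "trace C H x = finprod (M H) (\<lambda>c. act H (\<rho> c) x) C"
    unfolding trace_def
  proof (intro MH.finprod_cong' refl)
    show "(\<lambda>c. act H (\<rho> c) x) \<in> C \<rightarrow> carrier (M H)"
      using \<rho>C C.subset by (intro funcsetI act_closed[OF H _ x]) blast
  qed (simp add: act_eq simp_implies_def)
  also have "\<dots> = finprod (M H) (\<lambda>r. act H r x) (\<rho> ` C) [^]\<^bsub>M H\<^esub> card (C \<inter> H)"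
  proof (rule MH.finprod_fibers[OF finC _ card])
    fix r assume "r \<in> \<rho> ` C"
    then show "act H r x \<in> carrier (M H)" using \<rho>C C.subset by (intro act_closed[OF H _ x]) blast
  qed
  also have "finprod (M H) (\<lambda>r. act H r x) (\<rho> ` C) = \<one>\<^bsub>M H\<^esub>"
    by (rule norm_transversal[OF H HC HC1 R transv x N1])
  finally show ?thesis by simp
qed

end

section \<open>Lifting elements with trivial norms\<close>

lemma (in group) rcos_eq_iff:
  assumes "subgroup H G" "x \<in> carrier G" "y \<in> carrier G"
  shows "H #> x = H #> y \<longleftrightarrow> x \<otimes> inv y \<in> H"
proof
  interpret H: subgroup H G by fact
  assume "H #> x = H #> y"
  then have "x \<in> H #> y" using rcos_self[OF assms(2,1)] by simp
  then obtain h where "h \<in> H" "x = h \<otimes> y" by (auto simp: r_coset_def)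
  then show "x \<otimes> inv y \<in> H" using assms(3) by (simp add: m_assoc)
next
  interpret H: subgroup H G by fact
  assume *: "x \<otimes> inv y \<in> H"
  have "x = (x \<otimes> inv y) \<otimes> y" using assms(2,3) by (simp add: m_assoc)
  then have "x \<in> H #> y" using * unfolding r_coset_def by blast
  from repr_independence[OF this assms(3,1)] show "H #> x = H #> y" by (rule sym)
qed

text \<open>By \<open>prime_not_dvd_order\<close> the quotient has order prime to \<open>p\<close>.\<close>

lemma (in comm_group) multiplicity_subgroup:
  assumes "Factorial_Ring.prime p" "finite (carrier G)" "subgroup I G"
    and pow: "\<And>a. a \<in> carrier G \<Longrightarrow> \<exists>m::nat. \<not> p dvd m \<and> a [^] m \<in> I"
  shows "multiplicity p (card I) = multiplicity p (card (carrier G))"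
proof -
  interpret n: normal I G using subgroup_imp_normal assms(3) .
  interpret Q: group "G Mod I" by (rule n.factorgroup_is_group)
  have fin: "finite (carrier (G Mod I))"
    using assms(2) by (simp add: carrier_FactGroup)
  have "\<not> p dvd Coset.order (G Mod I)"
  proof (rule Q.prime_not_dvd_order[OF assms(1) fin])
    fix Y assume "Y \<in> carrier (G Mod I)"
    then obtain a where a: "a \<in> carrier G" "Y = I #> a" by (auto simp: carrier_FactGroup)
    obtain m :: nat where m: "\<not> p dvd m" "a [^] m \<in> I" using pow[OF a(1)] by blast
    have "Y [^]\<^bsub>G Mod I\<^esub> m = I #> (a [^] m)" using a n.FactGroup_pow by simp
    also have "\<dots> = I" using coset_join2[OF _ assms(3) m(2)] a(1) by simp
    finally show "\<exists>m::nat. \<not> p dvd m \<and> Y [^]\<^bsub>G Mod I\<^esub> m = \<one>\<^bsub>G Mod I\<^esub>" using m(1) by auto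
  qed
  moreover have "card (rcosets I) * card I = card (carrier G)"
    using lagrange_finite[OF assms(2,3)] by (simp add: Coset.order_def)
  moreover have "card (rcosets I) = Coset.order (G Mod I)"
    by (simp add: Coset.order_def FactGroup_def)
  ultimately have "multiplicity p (card (carrier G)) = multiplicity p (Coset.order (G Mod I) * card I)"
    "\<not> p dvd Coset.order (G Mod I)"
    by auto
  moreover have "multiplicity p (Coset.order (G Mod I) * card I) = multiplicity p (card I)"
    using calculation(2) assms(1) by (rule multiplicity_prime_elem_times_other[OF prime_imp_prime_elem, rotated])
  ultimately show ?thesis by simp
qed

locale norm_system_sylow = norm_system +
  fixes p :: nat and P :: "'a set"
  assumes prime_p: "Factorial_Ring.prime p"
    and subgroup_P: "subgroup P G"
    and card_P: "card P = p ^ multiplicity p (Coset.order G)"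
    and cyclic_P: "cyclic_group (G\<lparr>carrier := P\<rparr>)"
begin

definition p_part :: nat where "p_part = p ^ multiplicity p (Coset.order G)"
definition cofactor :: nat where "cofactor = Coset.order G div p_part"

lemma order_pos: "Coset.order G > 0" using finite_G by (simp add: order_gt_0_iff_finite)

lemma order_eq: "Coset.order G = p_part * cofactor"
  by (simp add: p_part_def cofactor_def multiplicity_dvd)

lemma not_dvd_cofactor: "\<not> p dvd cofactor"
  unfolding cofactor_def p_part_def
  by (rule multiplicity_decompose) (use order_pos prime_p in \<open>auto simp: not_prime_unit\<close>)

lemma coprime_p_part_cofactor: "coprime p_part cofactor"
  using not_dvd_cofactor prime_p by (auto simp: p_part_def prime_imp_coprime_nat)

definition prime_to_p_part :: "'a set \<Rightarrow> 'a set" where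
  "prime_to_p_part H = {x \<in> H. x [^] cofactor = \<one>}"

lemma subgroup_prime_to_p_part:
  assumes "subgroup H G" shows "subgroup (prime_to_p_part H) G"
proof -
  interpret H: subgroup H G by fact
  show ?thesis
    by (rule subgroupI)
      (auto simp: prime_to_p_part_def nat_pow_distrib nat_pow_inv intro!: exI[of _ \<one>])
qed

lemma card_prime_to_p_part:
  assumes "subgroup H G" shows "\<not> p dvd card (prime_to_p_part H)"
proof -
  interpret H: subgroup H G by fact
  interpret C: group "G\<lparr>carrier := prime_to_p_part H\<rparr>"
    using subgroup_imp_group[OF subgroup_prime_to_p_part[OF assms]] .
  have fin: "finite (prime_to_p_part H)"
    using finite_G H.subset by (auto simp: prime_to_p_part_def intro: finite_subset)
  have "\<not> p dvd Coset.order (G\<lparr>carrier := prime_to_p_part H\<rparr>)"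
  proof (rule C.prime_not_dvd_order[OF prime_p])
    fix x assume "x \<in> carrier (G\<lparr>carrier := prime_to_p_part H\<rparr>)"
    then have "x [^] cofactor = \<one>" by (simp add: prime_to_p_part_def)
    then have "x [^]\<^bsub>G\<lparr>carrier := prime_to_p_part H\<rparr>\<^esub> cofactor = \<one>" by (metis nat_pow_consistent)
    then show "\<exists>m::nat. \<not> p dvd m \<and> x [^]\<^bsub>G\<lparr>carrier := prime_to_p_part H\<rparr>\<^esub> m
        = \<one>\<^bsub>G\<lparr>carrier := prime_to_p_part H\<rparr>\<^esub>"
      using not_dvd_cofactor by auto
  qed (use fin in simp)
  then show ?thesis by (simp add: Coset.order_def)
qed

text \<open>With \<open>p_part * s = cofactor * t + 1\<close>, the factors are \<open>g [^] (- cofactor * t)\<close> and \<open>g [^] (p_part * s)\<close>.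
Being powers of \<open>g\<close> they stay in every subgroup that contains \<open>g\<close>.\<close>

lemma decompose:
  assumes g: "g \<in> carrier G"
  obtains u v where "u \<in> carrier G" "v \<in> carrier G" "g = u \<otimes> v" "u [^] p_part = \<one>" "v [^] cofactor = \<one>"
    "\<And>H. subgroup H G \<Longrightarrow> g \<in> H \<Longrightarrow> u \<in> H \<and> v \<in> H" "\<exists>s::nat. v = g [^] (s::nat)"
proof -
  have "p_part \<noteq> 0" using prime_p by (auto simp: p_part_def)
  then obtain s t where st: "p_part * s = cofactor * t + gcd p_part cofactor" using bezout_nat by blast
  then have st: "p_part * s = cofactor * t + 1" using coprime_p_part_cofactor by simp
  define v where "v = g [^] (p_part * s)"
  define u where "u = inv (g [^] (cofactor * t))"
  have c: "u \<in> carrier G" "v \<in> carrier G" using g by (auto simp: u_def v_def)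
  have gn: "g [^] (p_part * cofactor) = \<one>" using pow_order_eq_1[OF g] order_eq by simp
  have "v = g [^] (cofactor * t) \<otimes> g" using g by (simp add: v_def st)
  then have "g = u \<otimes> v" using g by (simp add: u_def m_assoc[symmetric])
  moreover have "v [^] cofactor = (g [^] (p_part * cofactor)) [^] s" using g
    by (simp add: v_def nat_pow_pow ac_simps)
  then have "v [^] cofactor = \<one>" using gn by simp
  moreover have "u [^] p_part = inv ((g [^] (p_part * cofactor)) [^] t)" using g
    by (simp add: u_def nat_pow_inv nat_pow_pow ac_simps)
  then have "u [^] p_part = \<one>" using gn by simp
  moreover have "u \<in> H \<and> v \<in> H" if "subgroup H G" "g \<in> H" for H
  proof -
    interpret H: subgroup H G by fact
    have "g [^] (n::nat) \<in> H" for n using \<open>g \<in> H\<close> by (induction n) auto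
    then show ?thesis by (simp add: u_def v_def)
  qed
  ultimately show ?thesis using that[of u v] c v_def by blast
qed

lemma in_sylow:
  assumes g: "g \<in> carrier G" "g [^] p_part = \<one>" shows "g \<in> P"
proof -
  interpret P: normal P G using subgroup_imp_normal subgroup_P .
  interpret Q: group "G Mod P" by (rule P.factorgroup_is_group)
  have fin: "finite (carrier (G Mod P))" using finite_G by (simp add: carrier_FactGroup)
  have "card (rcosets P) * card P = Coset.order G" by (rule lagrange_finite[OF finite_G subgroup_P])
  moreover have "card P = p_part" "p_part > 0" using card_P prime_p by (auto simp: p_part_def prime_gt_0_nat)
  ultimately have o: "Coset.order (G Mod P) = cofactor"
    using order_eq by (simp add: Coset.order_def FactGroup_def)
  have Y: "P #> g \<in> carrier (G Mod P)" using g by (auto simp: carrier_FactGroup)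
  have "Q.ord (P #> g) dvd cofactor" using Q.ord_dvd_group_order[OF Y] o by simp
  moreover have "(P #> g) [^]\<^bsub>G Mod P\<^esub> p_part = P #> (g [^] p_part)" using g P.FactGroup_pow by simp
  then have "(P #> g) [^]\<^bsub>G Mod P\<^esub> p_part = \<one>\<^bsub>G Mod P\<^esub>" using g P.subset by (simp add: coset_mult_one)
  then have "Q.ord (P #> g) dvd p_part" using Q.pow_eq_id[OF Y] by simp
  ultimately have "Q.ord (P #> g) = 1" using coprime_p_part_cofactor by (metis coprime_common_divisor_nat)
  then have "P #> g = P" using Q.ord_eq_1[OF Y] by simp
  then show ?thesis using rcos_self[OF g(1) subgroup_P] by simp
qed

lemma sylow_generator:
  obtains c where "c \<in> P" "\<And>x. x \<in> P \<Longrightarrow> \<exists>i::nat. x = c [^] i"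
proof -
  interpret GP: group "G\<lparr>carrier := P\<rparr>" by (rule subgroup_imp_group[OF subgroup_P])
  have fin: "finite (carrier (G\<lparr>carrier := P\<rparr>))"
    using finite_subset[OF subgroup.subset[OF subgroup_P] finite_G] by simp
  obtain c where c: "c \<in> P" "\<forall>x\<in>P. \<exists>i::nat. x = c [^]\<^bsub>G\<lparr>carrier := P\<rparr>\<^esub> i"
    using cyclic_P unfolding GP.cyclic_group_iff_nat_pow[OF fin] by auto
  have "\<exists>i::nat. x = c [^] i" if "x \<in> P" for x
    using c(2) that by (simp add: nat_pow_consistent[symmetric])
  with c(1) show ?thesis by (rule that)
qed

text \<open>The subgroups of a cyclic \<open>p\<close>-group form a chain, so the \<open>p\<close>-parts of \<open>H\<close> and \<open>H'\<close> are comparable. The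
lemma says this for one element of each.\<close>

lemma sylow_comparable:
  assumes "subgroup H G" "subgroup H' G" "g \<in> H" "g \<in> P" "h \<in> H'" "h \<in> P"
  shows "g \<in> H' \<or> h \<in> H"
proof -
  interpret P: subgroup P G by (rule subgroup_P)
  obtain c where c: "c \<in> P" "\<And>x. x \<in> P \<Longrightarrow> \<exists>i::nat. x = c [^] i" by (rule sylow_generator) (rule that)
  have cG: "c \<in> carrier G" using c(1) by simp
  have cpow: "c [^] (n::nat) \<in> P" for n using c(1) by (induction n) auto
  have "generate G {c} = {c [^] k |k::nat. True}" using generate_pow_nat[OF cG] ord_ge_1[OF finite_G cG] by simp
  also have "\<dots> = P" using c(2) cpow by blast
  finally have "ord c = p_part" using generate_pow_card[OF cG] card_P p_part_def by simp
  have pow: "x [^] (n::nat) \<in> S" if "subgroup S G" "x \<in> S" for x n S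
  proof -
    interpret S: subgroup S G by fact
    show ?thesis using \<open>x \<in> S\<close> by (induction n) auto
  qed
  \<comment> \<open>A subgroup that contains \<open>c [^] i\<close> contains \<open>c [^] gcd i p_part\<close>, since \<open>c\<close> has order \<open>p_part\<close>.\<close>
  have key: "c [^] j \<in> S" if S: "subgroup S G" "c [^] i \<in> S" and ij: "gcd i p_part dvd gcd j p_part" for i j :: nat and S
  proof (cases "i = 0")
    case True
    then have "p_part dvd j" using ij by auto
    then have "c [^] j = \<one>" using \<open>ord c = p_part\<close> pow_eq_id cG by simp
    then show ?thesis using subgroup.one_closed[OF S(1)] by simp
  next
    case False
    then obtain x y where xy: "i * x = p_part * y + gcd i p_part" using bezout_nat by blast
    have "c [^] (i * x) \<in> S" using pow[OF S, of x] cG by (simp add: nat_pow_pow)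
    moreover have "c [^] (p_part * y) = \<one>" using \<open>ord c = p_part\<close> pow_eq_id cG by simp
    then have "c [^] (i * x) = c [^] (gcd i p_part)" using cG by (simp add: xy nat_pow_mult[symmetric])
    ultimately have d: "c [^] (gcd i p_part) \<in> S" by simp
    obtain k where "j = gcd i p_part * k" using ij by (metis dvdE dvd_trans gcd_dvd1)
    then show ?thesis using pow[OF S(1) d, of k] cG by (simp add: nat_pow_pow)
  qed
  obtain i j :: nat where ij: "g = c [^] i" "h = c [^] j" using assms(4,6) c(2) by metis
  obtain a b where "gcd i p_part = p ^ a" "gcd j p_part = p ^ b"
    using divides_primepow_nat[OF prime_p] by (metis gcd_dvd2 p_part_def)
  then have "gcd i p_part dvd gcd j p_part \<or> gcd j p_part dvd gcd i p_part" by (metis le_imp_power_dvd nat_le_linear)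
  then show ?thesis using key assms ij by blast
qed

text \<open>Start from a preimage \<open>x\<close> of \<open>a\<close> and apply the operators \<open>T = |C| - trace C\<close> for \<open>C \<in> D\<close> one after the
other. They commute with norms. On \<open>M H\<close> the operator raises \<open>a\<close> to the power \<open>|C|\<close>, since the norm of \<open>a\<close> to
\<open>M (HC)\<close> and hence its trace over \<open>C\<close> are trivial; on \<open>M H'\<close> with \<open>C \<subseteq> H'\<close> it vanishes, since \<open>C\<close> acts
trivially there.\<close>

lemma annihilate_prime_to_p:
  assumes H: "subgroup H G" and a: "a \<in> comp H"
    and "finite D" "\<And>C. C \<in> D \<Longrightarrow> subgroup C G \<and> \<not> p dvd card C \<and> \<not> C \<subseteq> H"
  shows "\<exists>x m. x \<in> carrier (M {\<one>}) \<and> \<not> p dvd m \<and> N {\<one>} H x = a [^]\<^bsub>M H\<^esub> (m::nat) \<and>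
    (\<forall>C\<in>D. \<forall>H'. subgroup H' G \<longrightarrow> C \<subseteq> H' \<longrightarrow> N {\<one>} H' x = \<one>\<^bsub>M H'\<^esub>)"
  using assms(3,4)
proof (induction D)
  case empty
  interpret H: subgroup H G by fact
  interpret MH: comm_group "M H" using comm_group_M[OF H] .
  have "a \<in> carrier (M H)" using a by (simp add: comp_def)
  then have "a \<in> N {\<one>} H ` carrier (M {\<one>})" using norm_surj[OF triv_subgroup H] by simp
  then obtain x where "x \<in> carrier (M {\<one>})" "N {\<one>} H x = a" by blast
  then show ?case using prime_p \<open>a \<in> carrier (M H)\<close> by (intro exI[of _ x] exI[of _ 1]) (auto simp: not_prime_1)
next
  case (insert C D)
  have "subgroup C G \<and> \<not> p dvd card C \<and> \<not> C \<subseteq> H" if "C \<in> D" for C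
    using insert.prems that by simp
  then have "\<exists>x m. x \<in> carrier (M {\<one>}) \<and> \<not> p dvd m \<and> N {\<one>} H x = a [^]\<^bsub>M H\<^esub> (m::nat) \<and>
    (\<forall>C\<in>D. \<forall>H'. subgroup H' G \<longrightarrow> C \<subseteq> H' \<longrightarrow> N {\<one>} H' x = \<one>\<^bsub>M H'\<^esub>)"
    by (rule insert.IH)
  then obtain x m where x: "x \<in> carrier (M {\<one>})" "\<not> p dvd m" "N {\<one>} H x = a [^]\<^bsub>M H\<^esub> (m::nat)"
    and x': "\<forall>C\<in>D. \<forall>H'. subgroup H' G \<longrightarrow> C \<subseteq> H' \<longrightarrow> N {\<one>} H' x = \<one>\<^bsub>M H'\<^esub>"
    by (elim exE conjE)
  have C: "subgroup C G" "\<not> p dvd card C" "\<not> C \<subseteq> H" using insert.prems by auto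
  interpret C: subgroup C G by fact
  define T where "T H y = y [^]\<^bsub>M H\<^esub> card C \<otimes>\<^bsub>M H\<^esub> inv\<^bsub>M H\<^esub> trace C H y" for H y
  have aH: "a \<in> carrier (M H)" using a by (simp add: comp_def)
  have T: "N {\<one>} H' (T {\<one>} x) = T H' (N {\<one>} H' x)" if H': "subgroup H' G" for H'
  proof -
    interpret H': subgroup H' G by fact
    interpret h: group_hom "M {\<one>}" "M H'" "N {\<one>} H'"
      by (rule norm_group_hom[OF triv_subgroup H']) simp
    show ?thesis using x(1) trace_closed[OF triv_subgroup C.subset x(1)] norm_trace[OF triv_subgroup H' _ C.subset x(1)]
      by (simp add: T_def h.hom_nat_pow)
  qed
  have T1: "T H' \<one>\<^bsub>M H'\<^esub> = \<one>\<^bsub>M H'\<^esub>" if H': "subgroup H' G" for H'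
  proof -
    interpret MH: comm_group "M H'" using comm_group_M[OF H'] .
    show ?thesis by (simp add: T_def trace_one[OF H' C.subset])
  qed
  interpret M1: comm_group "M {\<one>}" using comm_group_M[OF triv_subgroup] .
  interpret MH: comm_group "M H" using comm_group_M[OF H] .
  have "T {\<one>} x \<in> carrier (M {\<one>})"
    using x(1) trace_closed[OF triv_subgroup C.subset x(1)] by (simp add: T_def)
  moreover have "\<not> p dvd m * card C" using x(2) C(2) prime_p by (simp add: prime_dvd_mult_iff)
  moreover have "N {\<one>} H (T {\<one>} x) = a [^]\<^bsub>M H\<^esub> (m * card C)"
  proof -
    have HC: "H \<subset> H <#> C" using set_mult_upper[OF H C(1)] C(3) by auto
    have sHC: "subgroup (H <#> C) G" using mult_subgroups H C(1) by auto
    interpret h: group_hom "M H" "M (H <#> C)" "N H (H <#> C)"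
      by (rule norm_group_hom[OF H sHC]) (use HC in auto)
    have "N H (H <#> C) a = \<one>\<^bsub>M (H <#> C)\<^esub>" using a HC sHC by (simp add: comp_def)
    then have "N H (H <#> C) (a [^]\<^bsub>M H\<^esub> m) = \<one>\<^bsub>M (H <#> C)\<^esub>" using aH by (simp add: h.hom_nat_pow)
    then have "trace C H (a [^]\<^bsub>M H\<^esub> m) = \<one>\<^bsub>M H\<^esub>"
      by (intro trace_trivial[OF H C(1)]) (use aH in auto)
    then have "T H (a [^]\<^bsub>M H\<^esub> m) = a [^]\<^bsub>M H\<^esub> (m * card C)"
      using aH by (simp add: T_def MH.nat_pow_pow)
    then show ?thesis using T[OF H] x(3) by simp
  qed
  moreover have "N {\<one>} H' (T {\<one>} x) = \<one>\<^bsub>M H'\<^esub>" if "B \<in> insert C D" "subgroup H' G" "B \<subseteq> H'" for B H'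
  proof (cases "B = C")
    case True
    interpret H': subgroup H' G by fact
    interpret MH': comm_group "M H'" using comm_group_M[OF \<open>subgroup H' G\<close>] .
    have "N {\<one>} H' x \<in> carrier (M H')" using norm_closed[OF triv_subgroup \<open>subgroup H' G\<close> _ x(1)] by simp
    then show ?thesis using that True T[OF that(2)] trace_fixed[OF that(2), of C] by (simp add: T_def)
  next
    case False
    then have "N {\<one>} H' x = \<one>\<^bsub>M H'\<^esub>" using that x' by blast
    then show ?thesis using T[OF that(2)] T1[OF that(2)] by simp
  qed
  then have "\<forall>B\<in>insert C D. \<forall>H'. subgroup H' G \<longrightarrow> B \<subseteq> H' \<longrightarrow> N {\<one>} H' (T {\<one>} x) = \<one>\<^bsub>M H'\<^esub>"
    by (intro ballI allI impI)
  ultimately show ?case by (intro exI conjI)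
qed

text \<open>After \<open>annihilate_prime_to_p\<close> for the prime-to-\<open>p\<close> parts not contained in \<open>H\<close>, take the trace over the
prime-to-\<open>p\<close> part \<open>Z\<close> of \<open>H\<close>. It remains to treat those \<open>H'\<close> not contained in \<open>H\<close> whose prime-to-\<open>p\<close> part
lies in \<open>H\<close>. The \<open>p\<close>-part of such an \<open>H'\<close> is not contained in that of \<open>H\<close>, so it contains it, \<open>P\<close> being cyclic;
thus \<open>H \<subset> H' Z\<close>. The norm of \<open>x\<close> to \<open>M (H' Z)\<close> factors through that of \<open>a\<close> and is trivial, and therefore
so is the trace over \<open>Z\<close> of the norm of \<open>x\<close> to \<open>M H'\<close>.\<close>

lemma lift_component:
  assumes H: "subgroup H G" and a: "a \<in> comp H"
  shows "\<exists>x m. x \<in> carrier (M {\<one>}) \<and> \<not> p dvd m \<and> N {\<one>} H x = a [^]\<^bsub>M H\<^esub> (m::nat) \<and>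
    (\<forall>H'. subgroup H' G \<longrightarrow> \<not> H' \<subseteq> H \<longrightarrow> N {\<one>} H' x = \<one>\<^bsub>M H'\<^esub>)"
proof -
  interpret MH: comm_group "M H" using comm_group_M[OF H] .
  define D where "D = {prime_to_p_part H' |H'. subgroup H' G \<and> \<not> prime_to_p_part H' \<subseteq> H}"
  have "finite D"
    by (rule finite_subset[of _ "prime_to_p_part ` {H. subgroup H G}"]) (auto simp: D_def finite_subgroups)
  moreover have "subgroup C G \<and> \<not> p dvd card C \<and> \<not> C \<subseteq> H" if "C \<in> D" for C
    using that subgroup_prime_to_p_part card_prime_to_p_part by (auto simp: D_def)
  ultimately have "\<exists>x m. x \<in> carrier (M {\<one>}) \<and> \<not> p dvd m \<and> N {\<one>} H x = a [^]\<^bsub>M H\<^esub> (m::nat) \<and>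
    (\<forall>C\<in>D. \<forall>H'. subgroup H' G \<longrightarrow> C \<subseteq> H' \<longrightarrow> N {\<one>} H' x = \<one>\<^bsub>M H'\<^esub>)"
    by (rule annihilate_prime_to_p[OF H a])
  then obtain x m where x: "x \<in> carrier (M {\<one>})" "\<not> p dvd m" "N {\<one>} H x = a [^]\<^bsub>M H\<^esub> (m::nat)"
    and x': "\<forall>C\<in>D. \<forall>H'. subgroup H' G \<longrightarrow> C \<subseteq> H' \<longrightarrow> N {\<one>} H' x = \<one>\<^bsub>M H'\<^esub>"
    by (elim exE conjE)
  define Z where "Z = prime_to_p_part H"
  have Z: "subgroup Z G" "\<not> p dvd card Z" "Z \<subseteq> H"
    using subgroup_prime_to_p_part[OF H] card_prime_to_p_part[OF H] by (auto simp: Z_def prime_to_p_part_def)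
  have aH: "a \<in> carrier (M H)" using a by (simp add: comp_def)
  have tr: "N {\<one>} H' (trace Z {\<one>} x) = trace Z H' (N {\<one>} H' x)" if "subgroup H' G" for H'
    using subgroup.one_closed[OF that] by (intro norm_trace[OF triv_subgroup that _ subgroup.subset[OF Z(1)] x(1)]) simp
  show ?thesis
  proof (intro exI[of _ "trace Z {\<one>} x"] exI[of _ "m * card Z"] conjI allI impI)
    show "trace Z {\<one>} x \<in> carrier (M {\<one>})"
      by (rule trace_closed[OF triv_subgroup subgroup.subset[OF Z(1)] x(1)])
    show "\<not> p dvd m * card Z" using x(2) Z(2) prime_p by (simp add: prime_dvd_mult_iff)
    show "N {\<one>} H (trace Z {\<one>} x) = a [^]\<^bsub>M H\<^esub> (m * card Z)"
      using tr[OF H] x(3) aH trace_fixed[OF H Z(3), of "a [^]\<^bsub>M H\<^esub> m"] by (simp add: MH.nat_pow_pow)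
  next
    fix H' assume H': "subgroup H' G" and n: "\<not> H' \<subseteq> H"
    interpret MH': comm_group "M H'" using comm_group_M[OF H'] .
    have one: "{\<one>} \<subseteq> H'" using subgroup.one_closed[OF H'] by simp
    show "N {\<one>} H' (trace Z {\<one>} x) = \<one>\<^bsub>M H'\<^esub>"
    proof (cases "prime_to_p_part H' \<subseteq> H")
      case False
      then have "prime_to_p_part H' \<in> D" using H' by (auto simp: D_def)
      moreover have "prime_to_p_part H' \<subseteq> H'" by (auto simp: prime_to_p_part_def)
      ultimately have "N {\<one>} H' x = \<one>\<^bsub>M H'\<^esub>" using x' H' by blast
      then show ?thesis using tr[OF H'] trace_one[OF H' subgroup.subset[OF Z(1)]] by simp
    next
      case True
      obtain h where h: "h \<in> H'" "h \<notin> H" using n by auto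
      have hG: "h \<in> carrier G" using h subgroup.mem_carrier[OF H'] by auto
      obtain u v where uv: "u \<in> carrier G" "v \<in> carrier G" "h = u \<otimes> v" "u [^] p_part = \<one>" "v [^] cofactor = \<one>"
          "u \<in> H'" "v \<in> H'"
        using decompose[OF hG] H' h(1) by metis
      have "v \<in> H" using True uv by (auto simp: prime_to_p_part_def)
      then have u: "u \<notin> H" "u \<in> P" using h uv subgroup.m_closed[OF H] in_sylow by auto
      have sub: "H \<subseteq> H' <#> Z"
      proof
        fix g assume g: "g \<in> H"
        have gG: "g \<in> carrier G" using g subgroup.mem_carrier[OF H] by auto
        obtain s t where st: "s \<in> carrier G" "t \<in> carrier G" "g = s \<otimes> t" "s [^] p_part = \<one>" "t [^] cofactor = \<one>"
          "s \<in> H" "t \<in> H"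
        using decompose[OF gG] H g by metis
        have "s \<in> P" using in_sylow st by auto
        then have "s \<in> H'" using sylow_comparable[OF H H' st(6) _ uv(6) u(2)] u(1) by auto
        moreover have "t \<in> Z" using st by (auto simp: Z_def prime_to_p_part_def)
        ultimately show "g \<in> H' <#> Z" using st(3) unfolding set_mult_def by blast
      qed
      note sub' = set_mult_upper(1)[OF H' Z(1)]
      have sHZ: "subgroup (H' <#> Z) G" using mult_subgroups H' Z(1) by auto
      have strict: "H \<subset> H' <#> Z" using sub sub' h by auto
      interpret h: group_hom "M H" "M (H' <#> Z)" "N H (H' <#> Z)"
        by (rule norm_group_hom[OF H sHZ sub])
      have "N {\<one>} (H' <#> Z) x = N H (H' <#> Z) (N {\<one>} H x)"
        using subgroup.one_closed[OF H] by (intro norm_trans[symmetric] triv_subgroup H sHZ sub x(1)) auto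
      also have "\<dots> = (N H (H' <#> Z) a) [^]\<^bsub>M (H' <#> Z)\<^esub> m" using aH x(3) by (simp add: h.hom_nat_pow)
      also have "\<dots> = \<one>\<^bsub>M (H' <#> Z)\<^esub>" using a strict sHZ by (simp add: comp_def)
      finally have "N H' (H' <#> Z) (N {\<one>} H' x) = \<one>\<^bsub>M (H' <#> Z)\<^esub>"
        using norm_trans[OF triv_subgroup H' sHZ one sub' x(1)] by simp
      then have "trace Z H' (N {\<one>} H' x) = \<one>\<^bsub>M H'\<^esub>"
        by (intro trace_trivial[OF H' Z(1)] norm_closed[OF triv_subgroup H' one x(1)])
      then show ?thesis using tr[OF H'] by simp
    qed
  qed
qed

end

section \<open>Counting along a filtration by kernels of norms\<close>

lemma (in comm_monoid) finprod_swap: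
  assumes "finite A" "finite B" "\<And>a b. a \<in> A \<Longrightarrow> b \<in> B \<Longrightarrow> f a b \<in> carrier G"
  shows "finprod G (\<lambda>a. finprod G (f a) B) A = finprod G (\<lambda>b. finprod G (\<lambda>a. f a b) A) B"
  using assms(1,3)
proof (induction A)
  case (insert a A)
  have "finprod G (\<lambda>a. finprod G (f a) B) (insert a A)
      = finprod G (f a) B \<otimes> finprod G (\<lambda>b. finprod G (\<lambda>a. f a b) A) B"
    using insert by (subst finprod_insert) auto
  also have "\<dots> = finprod G (\<lambda>b. f a b \<otimes> finprod G (\<lambda>a. f a b) A) B"
    using insert.prems by (intro finprod_multf[symmetric]) auto
  also have "\<dots> = finprod G (\<lambda>b. finprod G (\<lambda>a. f a b) (insert a A)) B"
    using insert by (intro finprod_cong' refl) auto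
  finally show ?case .
qed simp

lemma (in group) pow_mod:
  assumes "x \<in> carrier G" "x [^] (q::nat) = \<one>"
  shows "x [^] (i mod q) = x [^] i"
proof -
  have "x [^] i = x [^] (q * (i div q)) \<otimes> x [^] (i mod q)" using assms(1) by (simp add: nat_pow_mult)
  also have "x [^] (q * (i div q)) = \<one>" using assms by (simp flip: nat_pow_pow)
  finally show ?thesis using assms(1) by simp
qed

text \<open>In a cyclic group of order \<open>n\<close> the solutions of \<open>x [^] q = \<one>\<close> are powers of \<open>C [^] (n div gcd n q)\<close>, an element
whose order divides \<open>q\<close>.\<close>

lemma (in group) card_roots_in_cyclic:
  assumes C: "C \<in> carrier G" and fin: "finite (carrier G)" and q: "q > 0"
    and S: "S \<subseteq> {C [^] (i::nat) |i. True}" "\<And>x. x \<in> S \<Longrightarrow> x [^] (q::nat) = \<one>"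
  shows "card S \<le> q"
proof -
  define n where "n = ord C"
  have n: "n > 0" using ord_ge_1[OF fin C] by (simp add: n_def)
  have "gcd n q \<noteq> 0" using n by simp
  then obtain d e where de: "n = d * gcd n q" "q = e * gcd n q" "coprime d e"
    using gcd_coprime_exists by blast
  then have nd: "n dvd d * q" by (metis dvd_triv_left mult.assoc mult.commute)
  have "S \<subseteq> (\<lambda>k. (C [^] d) [^] k) ` {..<q}"
  proof
    fix x assume x: "x \<in> S"
    then obtain i :: nat where i: "x = C [^] i" using S(1) by auto
    have "C [^] (i * q) = \<one>" using S(2)[OF x] C by (simp add: i nat_pow_pow)
    then have "n dvd i * q" using C by (simp add: n_def pow_eq_id)
    then have "d * gcd n q dvd (i * e) * gcd n q" using de(1,2) by (metis mult.assoc)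
    then have "d dvd i" using n de(3) by (simp add: coprime_dvd_mult_left_iff)
    then obtain j where j: "i = d * j" by auto
    have "(C [^] d) [^] q = \<one>" using nd C by (simp add: nat_pow_pow n_def pow_eq_id)
    then have "(C [^] d) [^] j = (C [^] d) [^] (j mod q)" using C by (simp add: pow_mod)
    then have "x = (C [^] d) [^] (j mod q)" using C by (simp add: i j nat_pow_pow)
    then show "x \<in> (\<lambda>k. (C [^] d) [^] k) ` {..<q}" using q by auto
  qed
  then have "card S \<le> card {..<q}" by (rule surj_card_le[OF finite_lessThan])
  then show ?thesis by simp
qed

context norm_system_sylow
begin

text \<open>The relation between norm and trace for the trivial extension forces \<open>N {\<one>} {\<one>}\<close> to be injective.\<close>

lemma norm_trivial_imp_one:
  assumes x: "x \<in> carrier (M {\<one>})" and N1: "N {\<one>} {\<one>} x = \<one>\<^bsub>M {\<one>}\<^esub>"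
  shows "x = \<one>\<^bsub>M {\<one>}\<^esub>"
proof -
  interpret M1: comm_group "M {\<one>}" using comm_group_M[OF triv_subgroup] .
  have "finprod (M {\<one>}) (\<lambda>r. act {\<one>} r x) {\<one>} = \<one>\<^bsub>M {\<one>}\<^esub>"
    by (rule norm_transversal[OF triv_subgroup triv_subgroup _ _ _ x N1]) auto
  moreover have "act {\<one>} \<one> x = x" using act_fix[OF triv_subgroup _ x] by simp
  ultimately show ?thesis using x by (simp add: M1.finprod_insert)
qed

definition joint_kernel :: "'a set set \<Rightarrow> 'c set" where
  "joint_kernel D = {x \<in> carrier (M {\<one>}). \<forall>H\<in>D. N {\<one>} H x = \<one>\<^bsub>M H\<^esub>}"

lemma one_sub: "subgroup H G \<Longrightarrow> {\<one>} \<subseteq> H"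
  using subgroup.one_closed by auto

lemma subgroup_joint_kernel:
  assumes "\<And>H. H \<in> D \<Longrightarrow> subgroup H G"
  shows "subgroup (joint_kernel D) (M {\<one>})"
proof -
  interpret M1: comm_group "M {\<one>}" using comm_group_M[OF triv_subgroup] .
  have h: "group_hom (M {\<one>}) (M H) (N {\<one>} H)" if "H \<in> D" for H
    by (rule norm_group_hom[OF triv_subgroup]) (use assms[OF that] one_sub in auto)
  show ?thesis
  proof (rule M1.subgroupI)
    have "\<one>\<^bsub>M {\<one>}\<^esub> \<in> joint_kernel D" using group_hom.hom_one[OF h] by (auto simp: joint_kernel_def)
    then show "joint_kernel D \<noteq> {}" by blast
  next
    fix a assume a: "a \<in> joint_kernel D"
    have "N {\<one>} H (inv\<^bsub>M {\<one>}\<^esub> a) = \<one>\<^bsub>M H\<^esub>" if "H \<in> D" for H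
    proof -
      interpret h: group_hom "M {\<one>}" "M H" "N {\<one>} H" by (rule h[OF that])
      show ?thesis using a that by (simp add: joint_kernel_def)
    qed
    then show "inv\<^bsub>M {\<one>}\<^esub> a \<in> joint_kernel D" using a by (simp add: joint_kernel_def)
  next
    fix a b assume a: "a \<in> joint_kernel D" "b \<in> joint_kernel D"
    have "N {\<one>} H (a \<otimes>\<^bsub>M {\<one>}\<^esub> b) = \<one>\<^bsub>M H\<^esub>" if "H \<in> D" for H
    proof -
      interpret h: group_hom "M {\<one>}" "M H" "N {\<one>} H" by (rule h[OF that])
      show ?thesis using a that by (simp add: joint_kernel_def)
    qed
    then show "a \<otimes>\<^bsub>M {\<one>}\<^esub> b \<in> joint_kernel D" using a by (simp add: joint_kernel_def)
  qed (auto simp: joint_kernel_def)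
qed

text \<open>Induction on \<open>D\<close>, removing a minimal member \<open>H\<close>, which keeps \<open>D\<close> upward closed. The norm to \<open>M H\<close> maps the
joint kernel \<open>F\<close> for the remaining set \<open>D'\<close> to \<open>comp H\<close>, because all proper overgroups of \<open>H\<close> are in \<open>D'\<close>; its
kernel is the joint kernel for \<open>D\<close>. The lift of a power of \<open>a \<in> comp H\<close> from \<open>lift_component\<close> lies in \<open>F\<close>,
because no member of \<open>D'\<close> is contained in \<open>H\<close>; so the image has the same \<open>p\<close>-multiplicity as \<open>comp H\<close>.\<close>

lemma filtration:
  assumes "finite D" "\<And>H. H \<in> D \<Longrightarrow> subgroup H G"
    "\<And>H H'. H \<in> D \<Longrightarrow> subgroup H' G \<Longrightarrow> H \<subseteq> H' \<Longrightarrow> H' \<in> D"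
  shows "multiplicity p (card (carrier (M {\<one>})))
    = multiplicity p (card (joint_kernel D)) + (\<Sum>H\<in>D. multiplicity p (card (comp H)))"
  using assms
proof (induction D rule: finite_psubset_induct)
  case (psubset D)
  show ?case
  proof (cases "D = {}")
    case True then show ?thesis by (simp add: joint_kernel_def)
  next
    case False
    obtain H where H: "H \<in> D" "\<And>B. B \<in> D \<Longrightarrow> B \<subseteq> H \<Longrightarrow> H = B"
      using finite_has_minimal[OF psubset.hyps False] by metis
    have sH: "subgroup H G" using H(1) psubset.prems by auto
    define D' where "D' = D - {H}"
    have D: "D' \<subset> D" "D = insert H D'" "H \<notin> D'" "finite D'" using H(1) psubset.hyps by (auto simp: D'_def)
    have up: "H'' \<in> D'" if "H' \<in> D'" "subgroup H'' G" "H' \<subseteq> H''" for H' H''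
    proof -
      have "H'' \<in> D" using that D(1) psubset.prems(2) by blast
      moreover have "H'' \<noteq> H" using that H(2)[of H'] D by auto
      ultimately show ?thesis by (simp add: D'_def)
    qed
    have IH: "multiplicity p (card (carrier (M {\<one>})))
      = multiplicity p (card (joint_kernel D')) + (\<Sum>H\<in>D'. multiplicity p (card (comp H)))"
      by (rule psubset.IH[OF D(1) _ up]) (use D(1) psubset.prems(1) in auto)
    have sD': "subgroup B G" if "B \<in> D'" for B using that D(1) psubset.prems by auto
    define F where "F = joint_kernel D'"
    have F: "subgroup F (M {\<one>})" unfolding F_def by (rule subgroup_joint_kernel[OF sD'])
    interpret M1: comm_group "M {\<one>}" using comm_group_M[OF triv_subgroup] .
    interpret MH: comm_group "M H" using comm_group_M[OF sH] .
    interpret FG: group "(M {\<one>})\<lparr>carrier := F\<rparr>" by (rule M1.subgroup_imp_group[OF F])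
    have sub1: "{\<one>} \<subseteq> H" by (rule one_sub[OF sH])
    have Fc: "F \<subseteq> carrier (M {\<one>})" using subgroup.subset[OF F] .
    have finF: "finite F" using finite_subset[OF Fc finite_M[OF triv_subgroup]] .
    have homF: "N {\<one>} H \<in> hom ((M {\<one>})\<lparr>carrier := F\<rparr>) (M H)"
      using norm_hom[OF triv_subgroup sH sub1] Fc by (auto simp: hom_def Pi_iff)
    interpret hF: group_hom "(M {\<one>})\<lparr>carrier := F\<rparr>" "M H" "N {\<one>} H"
      using homF FG.group_axioms MH.group_axioms by (simp add: group_hom_def group_hom_axioms_def)
    have ker: "{x \<in> F. N {\<one>} H x = \<one>\<^bsub>M H\<^esub>} = joint_kernel D" using D(2) by (auto simp: F_def joint_kernel_def)
    have cardF: "card F = card (joint_kernel D) * card (N {\<one>} H ` F)"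
      using card_hom_kernel_image[OF FG.group_axioms MH.group_axioms homF] finF by (simp add: ker)
    define I where "I = N {\<one>} H ` F"
    have IA: "I \<subseteq> comp H"
    proof
      fix y assume "y \<in> I"
      then obtain x where x: "x \<in> F" "y = N {\<one>} H x" by (auto simp: I_def)
      have xc: "x \<in> carrier (M {\<one>})" using x(1) Fc by auto
      have "N H H' y = \<one>\<^bsub>M H'\<^esub>" if H': "subgroup H' G" "H \<subset> H'" for H'
      proof -
        have "H' \<in> D" using psubset.prems(2)[OF H(1) H'(1)] H'(2) by auto
        then have "H' \<in> D'" using H'(2) by (auto simp: D'_def)
        then have "N {\<one>} H' x = \<one>\<^bsub>M H'\<^esub>" using x(1) by (simp add: F_def joint_kernel_def)
        then show ?thesis using norm_trans[OF triv_subgroup sH H'(1) sub1 _ xc] H'(2) x(2) by auto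
      qed
      then show "y \<in> comp H" using norm_closed[OF triv_subgroup sH sub1 xc] x(2) by (simp add: comp_def)
    qed
    have sI: "subgroup I (M H)"
      using hF.img_is_subgroup by (simp add: I_def)
    interpret A: group "(M H)\<lparr>carrier := comp H\<rparr>"
      by (rule MH.subgroup_imp_group[OF subgroup_comp[OF sH]])
    interpret A: comm_group "(M H)\<lparr>carrier := comp H\<rparr>"
      by (rule A.group_comm_groupI) (use subgroup.subset[OF subgroup_comp[OF sH]] in \<open>auto intro: MH.m_comm\<close>)
    have sIA: "subgroup I ((M H)\<lparr>carrier := comp H\<rparr>)"
      by (rule MH.subgroup_incl[OF sI subgroup_comp[OF sH] IA])
    have "finite (comp H)" using finite_M[OF sH] by (auto simp: comp_def)
    then have mI: "multiplicity p (card I) = multiplicity p (card (carrier ((M H)\<lparr>carrier := comp H\<rparr>)))"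
    proof (intro A.multiplicity_subgroup[OF prime_p _ sIA])
      fix a assume "a \<in> carrier ((M H)\<lparr>carrier := comp H\<rparr>)"
      then have a: "a \<in> comp H" by simp
      obtain x m where x: "x \<in> carrier (M {\<one>})" "\<not> p dvd m" "N {\<one>} H x = a [^]\<^bsub>M H\<^esub> (m::nat)"
        and x': "\<forall>H'. subgroup H' G \<longrightarrow> \<not> H' \<subseteq> H \<longrightarrow> N {\<one>} H' x = \<one>\<^bsub>M H'\<^esub>"
        using lift_component[OF sH a] by (elim exE conjE)
      have "N {\<one>} H' x = \<one>\<^bsub>M H'\<^esub>" if "H' \<in> D'" for H'
      proof -
        have "\<not> H' \<subseteq> H" using up[OF that sH] D(3) by auto
        then show ?thesis using x' sD'[OF that] by auto
      qed
      then have "x \<in> F" using x(1) by (simp add: F_def joint_kernel_def)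
      then have "N {\<one>} H x \<in> I" unfolding I_def by (rule imageI)
      then have "a [^]\<^bsub>M H\<^esub> m \<in> I" using x(3) by simp
      then show "\<exists>m::nat. \<not> p dvd m \<and> a [^]\<^bsub>(M H)\<lparr>carrier := comp H\<rparr>\<^esub> m \<in> I"
        using x(2) by (metis MH.nat_pow_consistent)
    qed simp
    have "F \<noteq> {}" using FG.one_closed by auto
    then have "card F \<noteq> 0" using finF by simp
    then have "card (joint_kernel D) \<noteq> 0" "card I \<noteq> 0" using cardF by (simp_all add: I_def)
    then have "multiplicity p (card F) = multiplicity p (card (joint_kernel D)) + multiplicity p (card I)"
      using prime_p by (simp add: cardF I_def prime_elem_multiplicity_mult_distrib)
    then show ?thesis using IH mI D by (simp add: F_def)
  qed
qed

lemma multiplicity_card_all: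
  "multiplicity p (card (carrier (M {\<one>}))) = (\<Sum>H | subgroup H G. multiplicity p (card (comp H)))"
proof -
  have "joint_kernel {H. subgroup H G} = {\<one>\<^bsub>M {\<one>}\<^esub>}"
  proof -
    interpret M1: comm_group "M {\<one>}" using comm_group_M[OF triv_subgroup] .
    have "\<one>\<^bsub>M {\<one>}\<^esub> \<in> joint_kernel {H. subgroup H G}"
      using subgroup.one_closed[OF subgroup_joint_kernel[of "{H. subgroup H G}"]] by simp
    moreover have "x = \<one>\<^bsub>M {\<one>}\<^esub>" if "x \<in> joint_kernel {H. subgroup H G}" for x
    proof (rule norm_trivial_imp_one)
      show "x \<in> carrier (M {\<one>})" using that by (simp add: joint_kernel_def)
      show "N {\<one>} {\<one>} x = \<one>\<^bsub>M {\<one>}\<^esub>" using that triv_subgroup unfolding joint_kernel_def by blast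
    qed
    ultimately show ?thesis by blast
  qed
  then show ?thesis using filtration[OF finite_subgroups] by simp
qed

text \<open>The powers \<open>g [^] j\<close> with \<open>j < q\<close> represent the subgroup generated by \<open>H\<close> and \<open>g\<close> modulo \<open>H\<close>, and \<open>x\<close> has trivial
norm to the module of that subgroup.\<close>

lemma prime_trace_trivial:
  assumes H: "subgroup H G" and x: "x \<in> comp H" and q: "Factorial_Ring.prime q"
    and g: "g \<in> carrier G" "g \<notin> H" "g [^] q \<in> H"
  shows "finprod (M H) (\<lambda>j::nat. act H (g [^] j) x) {..<q} = \<one>\<^bsub>M H\<^esub>"
proof -
  interpret H: subgroup H G by (rule H)
  interpret MH: comm_group "M H" using comm_group_M[OF H] .
  interpret n: normal H G using subgroup_imp_normal H .
  interpret Q: group "G Mod H" by (rule n.factorgroup_is_group)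
  have xc: "x \<in> carrier (M H)" using x by (simp add: comp_def)
  define Y where "Y = H #> g"
  have Yc: "Y \<in> carrier (G Mod H)" using g by (auto simp: carrier_FactGroup Y_def)
  have Ypow: "Y [^]\<^bsub>G Mod H\<^esub> (j::nat) = H #> (g [^] j)" for j using g(1) n.FactGroup_pow by (simp add: Y_def)
  have "Y [^]\<^bsub>G Mod H\<^esub> q = \<one>\<^bsub>G Mod H\<^esub>" using coset_join2[OF _ H g(3)] g(1) by (simp add: Ypow)
  then have "Q.ord Y dvd q" using Q.pow_eq_id[OF Yc] by simp
  moreover have "Y \<noteq> H" using rcos_self[OF g(1) H] g(2) by (auto simp: Y_def)
  then have "Q.ord Y \<noteq> 1" using Q.ord_eq_1[OF Yc] by simp
  ultimately have oY: "Q.ord Y = q" using q by (metis prime_nat_iff)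
  have q0: "q > 0" using q prime_gt_0_nat by auto
  have inH: "g [^] i \<otimes> inv (g [^] j) \<in> H \<longleftrightarrow> i mod q = j mod q" for i j :: nat
  proof -
    have "{0..Q.ord Y - 1} = {..<q}" using oY q0 by auto
    then have inj: "inj_on (\<lambda>j::nat. Y [^]\<^bsub>G Mod H\<^esub> j) {..<q}" using Q.ord_inj[OF Yc] by simp
    have m: "Y [^]\<^bsub>G Mod H\<^esub> i = Y [^]\<^bsub>G Mod H\<^esub> (i mod q)" for i :: nat
      using Q.pow_mod[OF Yc, of q i] Q.pow_ord_eq_1[OF Yc] oY by simp
    have "g [^] i \<otimes> inv (g [^] j) \<in> H \<longleftrightarrow> Y [^]\<^bsub>G Mod H\<^esub> i = Y [^]\<^bsub>G Mod H\<^esub> j"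
      using rcos_eq_iff[OF H, of "g [^] i" "g [^] j"] g(1) by (simp add: Ypow)
    also have "\<dots> \<longleftrightarrow> i mod q = j mod q"
      using inj_on_eq_iff[OF inj, of "i mod q" "j mod q"] q0 m[of i] m[of j] by simp
    finally show ?thesis .
  qed
  define H' where "H' = H <#> generate G {g}"
  have sg: "subgroup (generate G {g}) G" using generate_is_subgroup g(1) by simp
  have H': "subgroup H' G" using mult_subgroups H sg by (simp add: H'_def)
  have og: "ord g \<noteq> 0" using ord_ge_1[OF finite_G g(1)] by simp
  have gen: "generate G {g} = {g [^] k |k::nat. True}" using generate_pow_nat[OF g(1) og] by simp
  have sub: "H \<subseteq> H'" "generate G {g} \<subseteq> H'"
    using set_mult_upper[OF H sg] by (simp_all add: H'_def)
  have gH': "g [^] (j::nat) \<in> H'" for j using sub(2) gen by blast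
  have strict: "H \<subset> H'" using sub(1) gH'[of 1] g by auto
  define R where "R = (\<lambda>j::nat. g [^] j) ` {..<q}"
  have inj: "inj_on (\<lambda>j::nat. g [^] j) {..<q}"
  proof (rule inj_onI)
    fix i j :: nat assume ij: "i \<in> {..<q}" "j \<in> {..<q}" "g [^] i = g [^] j"
    then have "g [^] i \<otimes> inv (g [^] j) \<in> H" using g(1) by simp
    then have "i mod q = j mod q" using inH[of i j] by blast
    then show "i = j" using ij by simp
  qed
  have "finprod (M H) (\<lambda>r. act H r x) R = \<one>\<^bsub>M H\<^esub>"
  proof (rule norm_transversal[OF H H' sub(1) _ _ xc])
    show "R \<subseteq> H'" using gH' by (auto simp: R_def)
    show "N H H' x = \<one>\<^bsub>M H'\<^esub>" using x strict H' by (simp add: comp_def)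
    fix h assume "h \<in> H'"
    then obtain a k where ak: "a \<in> H" "h = a \<otimes> g [^] (k::nat)" by (auto simp: H'_def set_mult_def gen)
    have iff: "h \<otimes> inv (g [^] j) \<in> H \<longleftrightarrow> k mod q = j mod q" for j :: nat
    proof -
      have ac: "a \<in> carrier G" using ak(1) by simp
      have e: "h \<otimes> inv (g [^] j) = a \<otimes> (g [^] k \<otimes> inv (g [^] j))" using ac g(1) by (simp add: ak(2) m_assoc)
      moreover have "g [^] k \<otimes> inv (g [^] j) = inv a \<otimes> (h \<otimes> inv (g [^] j))"
        using ac g(1) e by (simp add: m_assoc[symmetric])
      ultimately have "h \<otimes> inv (g [^] j) \<in> H \<longleftrightarrow> g [^] k \<otimes> inv (g [^] j) \<in> H"
        using ak(1) H.m_closed H.m_inv_closed by metis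
      then show ?thesis using inH by simp
    qed
    show "\<exists>!r. r \<in> R \<and> h \<otimes> inv r \<in> H"
    proof (rule ex1I[of _ "g [^] (k mod q)"])
      show "g [^] (k mod q) \<in> R \<and> h \<otimes> inv (g [^] (k mod q)) \<in> H" using iff q0 by (auto simp: R_def)
      fix r assume r: "r \<in> R \<and> h \<otimes> inv r \<in> H"
      then obtain j where "j < q" "r = g [^] j" by (auto simp: R_def)
      then show "r = g [^] (k mod q)" using r iff by simp
    qed
  qed
  moreover have "finprod (M H) (\<lambda>r. act H r x) R = finprod (M H) (\<lambda>j::nat. act H (g [^] j) x) {..<q}"
    unfolding R_def using g(1) xc
    by (intro MH.finprod_reindex inj) (auto intro!: act_closed[OF H])
  ultimately show ?thesis by simp
qed

text \<open>\<open>G/H\<close> is cyclic, expressed by representatives in \<open>G\<close>.\<close>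

definition cyclic_quotient :: "'a set \<Rightarrow> bool" where
  "cyclic_quotient H \<longleftrightarrow> (\<exists>g\<in>carrier G. \<forall>x\<in>carrier G. \<exists>i::nat. x \<otimes> inv (g [^] i) \<in> H)"

text \<open>If \<open>a\<close> and \<open>b\<close> have independent images of order \<open>q\<close> in \<open>G/H\<close>, then, additively,
\<open>(\<Sum>i<q. \<Sum>j<q. (a b^i)^j x) = q x + (\<Sum>0<j<q. a^j (\<Sum>i<q. (b^j)^i x))\<close>.
On the left the inner sums vanish by \<open>prime_trace_trivial\<close> for \<open>a b^i\<close>, and on the right they vanish for \<open>b^j\<close>.\<close>

lemma comp_torsion:
  assumes H: "subgroup H G" and q: "Factorial_Ring.prime (q::nat)"
    and b: "b \<in> carrier G" "b \<notin> H" "b [^] q \<in> H"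
    and a: "a \<in> carrier G" "a [^] q \<in> H" "\<And>i::nat. a \<otimes> b [^] i \<notin> H"
    and x: "x \<in> comp H"
  shows "x [^]\<^bsub>M H\<^esub> q = \<one>\<^bsub>M H\<^esub>"
proof -
  interpret H: subgroup H G by (rule H)
  interpret MH: comm_group "M H" using comm_group_M[OF H] .
  have q0: "q > 0" using q prime_gt_0_nat by auto
  have xc: "x \<in> carrier (M H)" using x by (simp add: comp_def)
  have powH: "h [^] (n::nat) \<in> H" if "h \<in> H" for h n using that by (induction n) auto
  define f where "f i j = act H ((a \<otimes> b [^] i) [^] j) x" for i j :: nat
  have fc: "f i j \<in> carrier (M H)" for i j
    unfolding f_def by (rule act_closed[OF H _ xc]) (use a b in auto)
  \<comment> \<open>Rows and columns of the array \<open>f i j = (a b^i)^j x\<close>; the column \<open>j = 0\<close> consists of \<open>q\<close> copies of \<open>x\<close>.\<close>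
  have row: "finprod (M H) (f i) {..<q} = \<one>\<^bsub>M H\<^esub>" for i
  proof -
    have "(a \<otimes> b [^] i) [^] q = a [^] q \<otimes> (b [^] q) [^] i"
      using a(1) b(1) by (simp add: nat_pow_distrib nat_pow_pow mult.commute)
    then have "(a \<otimes> b [^] i) [^] q \<in> H" using a(2) b(3) powH by simp
    then show ?thesis unfolding f_def
      by (intro prime_trace_trivial[OF H x q]) (use a b in auto)
  qed
  have col: "finprod (M H) (\<lambda>i. f i j) {..<q} = \<one>\<^bsub>M H\<^esub>" if j: "j < q" "j \<noteq> 0" for j
  proof -
    have "b [^] j \<notin> H"
    proof
      assume bj: "b [^] j \<in> H"
      have "coprime j q" using j q by (metis coprime_commute dvd_imp_le linorder_not_less neq0_conv prime_imp_coprime_nat)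
      moreover obtain s t where "j * s = q * t + gcd j q" using bezout_nat[OF j(2)] by blast
      ultimately have "j * s = q * t + 1" by simp
      then have "(b [^] j) [^] s = (b [^] q) [^] t \<otimes> b" using b(1) by (simp add: nat_pow_pow)
      then have "b = inv ((b [^] q) [^] t) \<otimes> (b [^] j) [^] s" using b(1) by (simp add: m_assoc[symmetric])
      then show False using powH[OF bj, of s] powH[OF b(3), of t] b(2) H.m_closed H.m_inv_closed by metis
    qed
    moreover have "(b [^] j) [^] q = (b [^] q) [^] j" using b(1) by (simp add: nat_pow_pow mult.commute)
    then have "(b [^] j) [^] q \<in> H" using powH[OF b(3)] by simp
    ultimately have 1: "finprod (M H) (\<lambda>i::nat. act H ((b [^] j) [^] i) x) {..<q} = \<one>\<^bsub>M H\<^esub>"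
      using b(1) by (intro prime_trace_trivial[OF H x q]) auto
    interpret h: group_hom "M H" "M H" "act H (a [^] j)" by (rule act_group_hom[OF H]) (use a in simp)
    have "f i j = act H (a [^] j) (act H ((b [^] j) [^] i) x)" for i
      using act_mult[OF H, of "a [^] j" "(b [^] j) [^] i" x] a(1) b(1) xc
      by (simp add: f_def nat_pow_distrib nat_pow_pow mult.commute)
    then have "finprod (M H) (\<lambda>i. f i j) {..<q}
        = finprod (M H) (\<lambda>i. act H (a [^] j) (act H ((b [^] j) [^] i) x)) {..<q}" by simp
    also have "\<dots> = act H (a [^] j) (finprod (M H) (\<lambda>i::nat. act H ((b [^] j) [^] i) x) {..<q})"
      by (rule hom_finprod[symmetric, OF MH.comm_monoid_axioms MH.comm_monoid_axioms h.homh h.hom_one])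
        (rule act_closed[OF H _ xc], use b in simp)
    finally show ?thesis using 1 by simp
  qed
  have "\<one>\<^bsub>M H\<^esub> = finprod (M H) (\<lambda>i. finprod (M H) (f i) {..<q}) {..<q}"
    by (simp add: row)
  also have "\<dots> = finprod (M H) (\<lambda>j. finprod (M H) (\<lambda>i. f i j) {..<q}) {..<q}"
    by (rule MH.finprod_swap) (auto intro: fc)
  also have "{..<q} = insert 0 {1..<q}" using q0 by auto
  also have "finprod (M H) (\<lambda>j. finprod (M H) (\<lambda>i. f i j) (insert 0 {1..<q})) (insert 0 {1..<q})
     = finprod (M H) (\<lambda>i. f i 0) {..<q} \<otimes>\<^bsub>M H\<^esub> finprod (M H) (\<lambda>j. finprod (M H) (\<lambda>i. f i j) {..<q}) {1..<q}"
    unfolding \<open>{..<q} = insert 0 {1..<q}\<close>[symmetric]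
    using fc by (subst (2) \<open>{..<q} = insert 0 {1..<q}\<close>, subst MH.finprod_insert) auto
  also have "finprod (M H) (\<lambda>j. finprod (M H) (\<lambda>i. f i j) {..<q}) {1..<q} = \<one>\<^bsub>M H\<^esub>"
    by (intro MH.finprod_one_eqI col) auto
  also have "finprod (M H) (\<lambda>i. f i 0) {..<q} = x [^]\<^bsub>M H\<^esub> q"
    using act_fix[OF H H.one_closed xc] MH.finprod_const[OF xc, of "{..<q}"] by (simp add: f_def)
  finally show ?thesis using xc by simp
qed

text \<open>Suppose that \<open>G/H\<close> is not cyclic. By \<open>cyclic_if_few_prime_roots\<close> it has more than \<open>q\<close> solutions of \<open>x [^] q = \<one>\<close>
for some prime \<open>q\<close>. This \<open>q\<close> is not \<open>p\<close>, because the \<open>p\<close>-torsion of \<open>G/H\<close> consists of images of elements of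
the cyclic group \<open>P\<close>. So there are independent elements of order \<open>q\<close>, \<open>comp H\<close> is killed by \<open>q\<close>, and its order is
prime to \<open>p\<close>.\<close>

lemma cyclic_quotient_if_dvd:
  assumes H: "subgroup H G" and dvd: "p dvd card (comp H)"
  shows "cyclic_quotient H"
proof -
  interpret H: subgroup H G by (rule H)
  interpret MH: comm_group "M H" using comm_group_M[OF H] .
  interpret n: normal H G using subgroup_imp_normal H .
  interpret Q: comm_group "G Mod H" by (rule abelian_FactGroup[OF H])
  have fin: "finite (carrier (G Mod H))" using finite_G by (simp add: carrier_FactGroup)
  have one: "H #> g = \<one>\<^bsub>G Mod H\<^esub> \<longleftrightarrow> g \<in> H" if "g \<in> carrier G" for g
    using rcos_eq_iff[OF H that one_closed] that H.subset by (simp add: coset_mult_one)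
  have pw: "(H #> g) [^]\<^bsub>G Mod H\<^esub> (k::nat) = H #> (g [^] k)" if "g \<in> carrier G" for g k
    using that n.FactGroup_pow by simp
  \<comment> \<open>For \<open>q = p\<close> cyclicity of \<open>P\<close> gives the bound; for \<open>q \<noteq> p\<close> its failure contradicts \<open>dvd\<close>.\<close>
  have few: "card {Y\<in>carrier (G Mod H). Y [^]\<^bsub>G Mod H\<^esub> q = \<one>\<^bsub>G Mod H\<^esub>} \<le> q" (is "card ?S \<le> q")
    if q: "Factorial_Ring.prime q" for q
  proof (cases "q = p")
    case True
    interpret P: subgroup P G by (rule subgroup_P)
    obtain c where c: "c \<in> P" "\<And>x. x \<in> P \<Longrightarrow> \<exists>i::nat. x = c [^] i" by (rule sylow_generator) (rule that)
    have cG: "c \<in> carrier G" using c(1) by simp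
    have sub: "?S \<subseteq> {(H #> c) [^]\<^bsub>G Mod H\<^esub> (i::nat) |i. True}"
    proof
      fix Y assume Y: "Y \<in> ?S"
      then obtain g where g: "g \<in> carrier G" "Y = H #> g" by (auto simp: carrier_FactGroup)
      have gp: "g [^] p \<in> H" using Y g pw[OF g(1)] one[of "g [^] p"] True by simp
      obtain u v where uv: "u \<in> carrier G" "v \<in> carrier G" "g = u \<otimes> v" "u [^] p_part = \<one>" "v [^] cofactor = \<one>"
          "\<exists>s::nat. v = g [^] s"
        using decompose[OF g(1)] by metis
      obtain s :: nat where s: "v = g [^] s" using uv(6) by auto
      have "v [^] p = (g [^] p) [^] s" using g(1) by (simp add: s nat_pow_pow mult.commute)
      moreover have "(g [^] p) [^] s \<in> H" using gp by (induction s) auto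
      ultimately have vp: "v [^] p \<in> H" by simp
      define V where "V = H #> v"
      have Vc: "V \<in> carrier (G Mod H)" using uv(2) by (auto simp: V_def carrier_FactGroup)
      have "V [^]\<^bsub>G Mod H\<^esub> p = \<one>\<^bsub>G Mod H\<^esub>" "V [^]\<^bsub>G Mod H\<^esub> cofactor = \<one>\<^bsub>G Mod H\<^esub>"
        using pw[OF uv(2)] one[of "v [^] p"] one[of \<one>] vp uv(2,5) by (simp_all add: V_def)
      then have "Q.ord V dvd p" "Q.ord V dvd cofactor" using Q.pow_eq_id[OF Vc] by auto
      then have "Q.ord V = 1" using not_dvd_cofactor prime_p by (metis prime_nat_iff)
      then have vH: "v \<in> H" using Q.ord_eq_1[OF Vc] one[OF uv(2)] by (simp add: V_def)
      have "g \<otimes> inv u = v" using uv(1,2,3) by (metis inv_solve_right m_comm m_closed)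
      then have "Y = H #> u" using rcos_eq_iff[OF H g(1) uv(1)] vH g(2) by simp
      moreover obtain k :: nat where "u = c [^] k" using c(2)[OF in_sylow[OF uv(1,4)]] by blast
      ultimately have "Y = (H #> c) [^]\<^bsub>G Mod H\<^esub> k" using pw[OF cG] by simp
      then show "Y \<in> {(H #> c) [^]\<^bsub>G Mod H\<^esub> (i::nat) |i. True}" by blast
    qed
    have cc: "H #> c \<in> carrier (G Mod H)" using cG by (auto simp: carrier_FactGroup)
    show ?thesis
      by (rule Q.card_roots_in_cyclic[OF cc fin _ sub]) (use q prime_gt_0_nat in auto)
  next
    case False
    show ?thesis
    proof (rule ccontr)
      assume "\<not> card ?S \<le> q"
      then have big: "card ?S > q" by simp
      have q1: "q > 1" using q prime_gt_1_nat by auto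
      have "\<not> ?S \<subseteq> {\<one>\<^bsub>G Mod H\<^esub>}" using card_mono[of "{\<one>\<^bsub>G Mod H\<^esub>}" ?S] big q1 by auto
      then obtain B where B: "B \<in> ?S" "B \<noteq> \<one>\<^bsub>G Mod H\<^esub>" by auto
      then obtain b where b: "b \<in> carrier G" "B = H #> b" by (auto simp: carrier_FactGroup)
      have "card ((\<lambda>i::nat. B [^]\<^bsub>G Mod H\<^esub> i) ` {..<q}) \<le> q"
        using card_image_le[of "{..<q}"] by simp
      then have "\<not> ?S \<subseteq> (\<lambda>i::nat. B [^]\<^bsub>G Mod H\<^esub> i) ` {..<q}"
        using big card_mono[of "(\<lambda>i::nat. B [^]\<^bsub>G Mod H\<^esub> i) ` {..<q}" ?S] by auto
      then obtain A where A: "A \<in> ?S" "A \<notin> (\<lambda>i::nat. B [^]\<^bsub>G Mod H\<^esub> i) ` {..<q}" by auto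
      then obtain a where a: "a \<in> carrier G" "A = H #> a" by (auto simp: carrier_FactGroup)
      have bH: "b \<notin> H" "b [^] q \<in> H" "a [^] q \<in> H"
        using B A b a one pw[OF b(1)] pw[OF a(1)] by auto
      have powH: "h [^] (n::nat) \<in> H" if "h \<in> H" for h n using that by (induction n) auto
      have ab: "a \<otimes> b [^] i \<notin> H" for i :: nat
      proof
        assume *: "a \<otimes> b [^] i \<in> H"
        \<comment> \<open>The exponent \<open>q * i - i\<close> represents \<open>- i\<close> modulo \<open>q\<close>.\<close>
        define j where "j = (q * i - i) mod q"
        have jq: "j < q" using q1 by (simp add: j_def)
        have e: "i + (q * i - i) = q * i" using q1 by auto
        have "b [^] (q * i - i) = inv (b [^] i) \<otimes> b [^] (q * i)"
          using b(1) e by (metis inv_solve_left nat_pow_closed nat_pow_mult)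
        then have "a \<otimes> inv (b [^] (q * i - i)) = (a \<otimes> b [^] i) \<otimes> inv ((b [^] q) [^] i)"
          using a(1) b(1) by (simp add: nat_pow_pow inv_mult_group m_ac)
        then have "a \<otimes> inv (b [^] (q * i - i)) \<in> H"
          using * powH[OF bH(2), of i] H.m_closed H.m_inv_closed by metis
        then have "A = B [^]\<^bsub>G Mod H\<^esub> (q * i - i)"
          using rcos_eq_iff[OF H a(1)] b(1) pw[OF b(1)] by (simp add: a(2) b(2))
        also have "\<dots> = B [^]\<^bsub>G Mod H\<^esub> j"
          using B by (simp add: j_def Q.pow_mod)
        finally show False using A(2) jq by auto
      qed
      interpret C: group "(M H)\<lparr>carrier := comp H\<rparr>"
        by (rule MH.subgroup_imp_group[OF subgroup_comp[OF H]])
      have "\<not> p dvd Coset.order ((M H)\<lparr>carrier := comp H\<rparr>)"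
      proof (rule C.prime_not_dvd_order[OF prime_p])
        show "finite (carrier ((M H)\<lparr>carrier := comp H\<rparr>))" using finite_M[OF H] by (simp add: comp_def)
        fix x assume "x \<in> carrier ((M H)\<lparr>carrier := comp H\<rparr>)"
        then have "x [^]\<^bsub>M H\<^esub> q = \<one>\<^bsub>M H\<^esub>"
          by (intro comp_torsion[OF H q b(1) bH(1,2) a(1) bH(3) ab]) simp
        moreover have "\<not> p dvd q" using False q prime_p primes_dvd_imp_eq by blast
        ultimately show "\<exists>m::nat. \<not> p dvd m \<and> x [^]\<^bsub>(M H)\<lparr>carrier := comp H\<rparr>\<^esub> m
            = \<one>\<^bsub>(M H)\<lparr>carrier := comp H\<rparr>\<^esub>"
          by (intro exI[of _ q]) (simp add: MH.nat_pow_consistent[symmetric])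
      qed
      then show False using dvd by (simp add: Coset.order_def)
    qed
  qed
  obtain Y where Y: "Y \<in> carrier (G Mod H)" "Q.ord Y = Coset.order (G Mod H)"
      "\<And>y. y \<in> carrier (G Mod H) \<Longrightarrow> \<exists>i::nat. y = Y [^]\<^bsub>G Mod H\<^esub> i"
    by (rule Q.cyclic_if_few_prime_roots[OF fin few]) (assumption, rule that)
  obtain g where g: "g \<in> carrier G" "Y = H #> g" using Y(1) by (auto simp: carrier_FactGroup)
  have "\<exists>i::nat. x \<otimes> inv (g [^] i) \<in> H" if x: "x \<in> carrier G" for x
  proof -
    have "H #> x \<in> carrier (G Mod H)" using x by (auto simp: carrier_FactGroup)
    then obtain i :: nat where "H #> x = H #> (g [^] i)" using Y(3)[of "H #> x"] pw[OF g(1)] g(2) by auto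
    then show ?thesis using rcos_eq_iff[OF H x] g(1) by auto
  qed
  then show ?thesis using g(1) by (auto simp: cyclic_quotient_def)
qed

theorem multiplicity_card_cyclic:
  "multiplicity p (card (carrier (M {\<one>})))
    = (\<Sum>H | subgroup H G \<and> cyclic_quotient H. multiplicity p (card (comp H)))"
proof -
  have "(\<Sum>H | subgroup H G. multiplicity p (card (comp H)))
     = (\<Sum>H | subgroup H G \<and> cyclic_quotient H. multiplicity p (card (comp H)))"
  proof (intro sum.mono_neutral_right finite_subgroups ballI)
    fix H assume H: "H \<in> {H. subgroup H G} - {H. subgroup H G \<and> cyclic_quotient H}"
    then have "\<not> p dvd card (comp H)" using cyclic_quotient_if_dvd[of H] by blast
    then show "multiplicity p (card (comp H)) = 0" by (rule not_dvd_imp_multiplicity_0)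
  qed auto
  then show ?thesis using multiplicity_card_all by simp
qed

end

section \<open>Subfields of the complex numbers and their embeddings\<close>

lemma field_complex_field: "field complex_field" by (rule field_from_type_algebra)

interpretation CF: ring complex_field by (rule ring_from_type_algebra)

lemma complex_field_simps [simp]:
  "carrier complex_field = UNIV"
  "x \<otimes>\<^bsub>complex_field\<^esub> y = x * y" "x \<oplus>\<^bsub>complex_field\<^esub> y = x + y"
  "\<one>\<^bsub>complex_field\<^esub> = 1" "\<zero>\<^bsub>complex_field\<^esub> = 0"
  by (simp_all add: ring_of_type_algebra_def)

lemma complex_field_uminus [simp]: "\<ominus>\<^bsub>complex_field\<^esub> x = - x"
proof -
  have "\<ominus>\<^bsub>complex_field\<^esub> x = - x \<oplus>\<^bsub>complex_field\<^esub> x \<oplus>\<^bsub>complex_field\<^esub> \<ominus>\<^bsub>complex_field\<^esub> x"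
    using CF.l_zero[of "\<ominus>\<^bsub>complex_field\<^esub> x"] by simp
  also have "\<dots> = - x" using CF.r_neg[of x] CF.a_assoc[of "- x" x "\<ominus>\<^bsub>complex_field\<^esub> x"] by simp
  finally show ?thesis .
qed

lemma complex_field_inv: "x \<noteq> 0 \<Longrightarrow> inv\<^bsub>complex_field\<^esub> x = inverse x"
  by (rule CF.inv_char) auto

lemma subfield_complexI:
  assumes "1 \<in> K" "\<And>x y. x \<in> K \<Longrightarrow> y \<in> K \<Longrightarrow> x + y \<in> K" "\<And>x y. x \<in> K \<Longrightarrow> y \<in> K \<Longrightarrow> x * y \<in> K"
    "\<And>x. x \<in> K \<Longrightarrow> - x \<in> K" "\<And>x. x \<in> K \<Longrightarrow> inverse x \<in> K"
  shows "subfield K complex_field"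
proof (rule field.subfieldI'[OF field_complex_field])
  show "subring K complex_field" by (rule CF.subringI) (use assms in auto)
  fix k assume "k \<in> K - {\<zero>\<^bsub>complex_field\<^esub>}"
  then show "inv\<^bsub>complex_field\<^esub> k \<in> K" using assms(5) by (simp add: complex_field_inv)
qed

context
  fixes K assumes K: "subfield K complex_field"
begin

lemma subfield_one: "1 \<in> K" and subfield_zero: "0 \<in> K"
  using subringE(2,3)[OF subfieldE(1)[OF K]] by auto

lemma subfield_add: "x \<in> K \<Longrightarrow> y \<in> K \<Longrightarrow> x + y \<in> K"
  and subfield_mult: "x \<in> K \<Longrightarrow> y \<in> K \<Longrightarrow> x * y \<in> K"
  and subfield_uminus: "x \<in> K \<Longrightarrow> - x \<in> K"
  using subringE(5,6,7)[OF subfieldE(1)[OF K]] by auto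

lemma subfield_diff: "x \<in> K \<Longrightarrow> y \<in> K \<Longrightarrow> x - y \<in> K"
  using subfield_add[of x "- y"] subfield_uminus by simp

lemma subfield_inverse: "x \<in> K \<Longrightarrow> inverse x \<in> K"
  using CF.subfield_m_inv(1)[OF K, of x] subfield_zero by (cases "x = 0") (auto simp: complex_field_inv)

lemma subfield_divide: "x \<in> K \<Longrightarrow> y \<in> K \<Longrightarrow> x / y \<in> K"
  by (simp add: divide_inverse subfield_mult subfield_inverse)

lemma subfield_power: "x \<in> K \<Longrightarrow> x ^ n \<in> K"
  by (induction n) (auto intro: subfield_one subfield_mult)

lemma subfield_of_nat: "of_nat n \<in> K"
  by (induction n) (auto intro: subfield_one subfield_zero subfield_add)

lemma subfield_of_int: "of_int n \<in> K"
  by (cases n) (use subfield_of_nat in \<open>auto intro!: subfield_uminus subfield_diff simp del: of_nat_Suc\<close>)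

lemma subfield_Rats: "\<rat> \<subseteq> K"
proof
  fix x :: complex assume "x \<in> \<rat>"
  then obtain a b :: int where "x = of_int a / of_int b" by (auto elim!: Rats_cases')
  then show "x \<in> K" by (simp add: subfield_divide subfield_of_int)
qed

lemma subfield_sum: "(\<And>i. i \<in> A \<Longrightarrow> f i \<in> K) \<Longrightarrow> sum f A \<in> K"
  by (induction A rule: infinite_finite_induct) (auto intro: subfield_zero subfield_add)

lemma subfield_poly: "(\<And>i. coeff p i \<in> K) \<Longrightarrow> x \<in> K \<Longrightarrow> poly p x \<in> K"
  by (auto simp: poly_altdef intro!: subfield_sum subfield_mult subfield_power)

end

lemma subfield_Rats_complex: "subfield (\<rat> :: complex set) complex_field"
  by (rule subfield_complexI) auto

section \<open>Extension of field embeddings\<close>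

text \<open>The graphs of field embeddings from a subfield of \<open>\<complex>\<close> into \<open>\<complex>\<close>. Graphs rather than functions make an
extension of embeddings an inclusion of sets, to which Zorn's lemma applies. Only the fibre over \<open>0\<close> is
prescribed: additivity then makes the relation single-valued. Closure under inverses has no exception at
\<open>0\<close>, because \<open>inverse 0 = 0\<close>.\<close>

definition hom_graph :: "(complex \<times> complex) set \<Rightarrow> bool" where
  "hom_graph R \<longleftrightarrow> (1, 1) \<in> R \<and> (\<forall>y. (0, y) \<in> R \<longrightarrow> y = 0) \<and>
    (\<forall>a b c d. (a, b) \<in> R \<longrightarrow> (c, d) \<in> R \<longrightarrow> (a + c, b + d) \<in> R \<and> (a * c, b * d) \<in> R) \<and>
    (\<forall>a b. (a, b) \<in> R \<longrightarrow> (- a, - b) \<in> R \<and> (inverse a, inverse b) \<in> R)"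

text \<open>Corresponding coefficients are related: \<open>q\<close> is the image of \<open>p\<close> under the embedding with graph \<open>R\<close>.\<close>

definition rel_poly :: "(complex \<times> complex) set \<Rightarrow> complex poly \<Rightarrow> complex poly \<Rightarrow> bool" where
  "rel_poly R p q \<longleftrightarrow> (\<forall>i. (coeff p i, coeff q i) \<in> R)"

context
  fixes R assumes R: "hom_graph R"
begin

lemma hom_graph_one: "(1, 1) \<in> R" using R by (simp add: hom_graph_def)
lemma hom_graph_add: "(a, b) \<in> R \<Longrightarrow> (c, d) \<in> R \<Longrightarrow> (a + c, b + d) \<in> R" using R by (simp add: hom_graph_def)
lemma hom_graph_mult: "(a, b) \<in> R \<Longrightarrow> (c, d) \<in> R \<Longrightarrow> (a * c, b * d) \<in> R" using R by (simp add: hom_graph_def)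
lemma hom_graph_uminus: "(a, b) \<in> R \<Longrightarrow> (- a, - b) \<in> R" using R by (simp add: hom_graph_def)
lemma hom_graph_inverse: "(a, b) \<in> R \<Longrightarrow> (inverse a, inverse b) \<in> R" using R by (simp add: hom_graph_def)
lemma hom_graph_diff: "(a, b) \<in> R \<Longrightarrow> (c, d) \<in> R \<Longrightarrow> (a - c, b - d) \<in> R"
  using hom_graph_add[of a b "- c" "- d"] hom_graph_uminus[of c d] by simp
lemma hom_graph_zero: "(0, 0) \<in> R" using hom_graph_diff[OF hom_graph_one hom_graph_one] by simp

lemma hom_graph_unique: "(a, b) \<in> R \<Longrightarrow> (a, c) \<in> R \<Longrightarrow> b = c"
proof -
  assume "(a, b) \<in> R" "(a, c) \<in> R"
  then have "(0, b - c) \<in> R" using hom_graph_diff[of a b a c] by simp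
  then have "b - c = 0" using R unfolding hom_graph_def by blast
  then show ?thesis by simp
qed

lemma hom_graph_zero_iff: "(a, b) \<in> R \<Longrightarrow> a = 0 \<longleftrightarrow> b = 0"
proof
  assume ab: "(a, b) \<in> R"
  then show "a = 0 \<Longrightarrow> b = 0" using hom_graph_unique[OF hom_graph_zero] by auto
  assume "b = 0"
  show "a = 0"
  proof (rule ccontr)
    assume "a \<noteq> 0"
    then have "(1, 0) \<in> R"
      using hom_graph_mult[OF ab hom_graph_inverse[OF ab]] \<open>b = 0\<close> by simp
    then show False using hom_graph_unique[OF hom_graph_one, of 0] by simp
  qed
qed

lemma hom_graph_sum: "(\<And>i. i \<in> A \<Longrightarrow> (f i, g i) \<in> R) \<Longrightarrow> (sum f A, sum g A) \<in> R"
  by (induction A rule: infinite_finite_induct) (auto intro: hom_graph_zero hom_graph_add)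

lemma hom_graph_of_nat: "(of_nat n, of_nat n) \<in> R"
  by (induction n) (auto intro: hom_graph_one hom_graph_zero hom_graph_add)

lemma hom_graph_of_int: "(of_int n, of_int n) \<in> R"
proof (cases n)
  case (nonneg m) then show ?thesis using hom_graph_of_nat[of m] by simp
next
  case (neg m) then show ?thesis using hom_graph_uminus[OF hom_graph_of_nat[of "Suc m"]] by simp
qed

lemma rel_poly_add: "rel_poly R p q \<Longrightarrow> rel_poly R r s \<Longrightarrow> rel_poly R (p + r) (q + s)"
  by (auto simp: rel_poly_def intro: hom_graph_add)
lemma rel_poly_uminus: "rel_poly R p q \<Longrightarrow> rel_poly R (- p) (- q)"
  by (auto simp: rel_poly_def intro: hom_graph_uminus)
lemma rel_poly_diff: "rel_poly R p q \<Longrightarrow> rel_poly R r s \<Longrightarrow> rel_poly R (p - r) (q - s)"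
  by (auto simp: rel_poly_def intro: hom_graph_diff)
lemma rel_poly_mult: "rel_poly R p q \<Longrightarrow> rel_poly R r s \<Longrightarrow> rel_poly R (p * r) (q * s)"
  by (auto simp: rel_poly_def coeff_mult intro!: hom_graph_sum hom_graph_mult)
lemma rel_poly_const: "(a, b) \<in> R \<Longrightarrow> rel_poly R [:a:] [:b:]"
  by (auto simp: rel_poly_def coeff_pCons hom_graph_zero split: nat.splits)
lemma rel_poly_monom: "(a, b) \<in> R \<Longrightarrow> rel_poly R (monom a n) (monom b n)"
  by (auto simp: rel_poly_def hom_graph_zero)
lemma rel_poly_smult: "(a, b) \<in> R \<Longrightarrow> rel_poly R p q \<Longrightarrow> rel_poly R (smult a p) (smult b q)"
  by (auto simp: rel_poly_def intro: hom_graph_mult)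
lemma rel_poly_X: "rel_poly R [:0, 1:] [:0, 1:]"
  by (auto simp: rel_poly_def coeff_pCons hom_graph_zero hom_graph_one split: nat.splits)

lemma rel_poly_int: "rel_poly R (map_poly of_int c) (map_poly of_int c)"
  by (auto simp: rel_poly_def coeff_map_poly hom_graph_of_int)

lemma rel_poly_pcompose:
  assumes "rel_poly R c d" "rel_poly R p q" shows "rel_poly R (pcompose c p) (pcompose d q)"
  using assms(1)
proof (induction c arbitrary: d)
  case 0
  then have "d = 0" using hom_graph_unique[OF hom_graph_zero]
    by (intro poly_eqI) (force simp: rel_poly_def)
  then show ?case using rel_poly_const[OF hom_graph_zero] by simp
next
  case (pCons a c)
  obtain b e where d: "d = pCons b e" by (rule pCons_cases)
  have "(a, b) \<in> R" using pCons.prems[unfolded rel_poly_def, rule_format, of 0] by (simp add: d)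
  moreover have "rel_poly R c e" unfolding rel_poly_def
  proof
    fix i show "(coeff c i, coeff e i) \<in> R"
      using pCons.prems[unfolded rel_poly_def, rule_format, of "Suc i"] by (simp add: d)
  qed
  ultimately show ?case using pCons.IH assms(2)
    by (auto simp: d pcompose_pCons intro!: rel_poly_add rel_poly_mult rel_poly_const)
qed

lemma rel_poly_degree: "rel_poly R p q \<Longrightarrow> degree p = degree q"
proof -
  assume pq: "rel_poly R p q"
  then have "coeff p i = 0 \<longleftrightarrow> coeff q i = 0" for i by (auto simp: rel_poly_def hom_graph_zero_iff)
  then show ?thesis by (simp add: degree_def)
qed

lemma rel_poly_zero_iff: "rel_poly R p q \<Longrightarrow> p = 0 \<longleftrightarrow> q = 0"
proof -
  assume pq: "rel_poly R p q"
  then have "coeff p i = 0 \<longleftrightarrow> coeff q i = 0" for i by (auto simp: rel_poly_def hom_graph_zero_iff)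
  then show ?thesis by (simp add: poly_eq_iff)
qed

text \<open>Division with remainder, carried out simultaneously for a polynomial over the domain of the embedding and
for its image.\<close>

lemma rel_poly_division:
  assumes mn: "rel_poly R m n" "m \<noteq> 0" and pq: "rel_poly R p q"
  shows "\<exists>a b r s. rel_poly R a b \<and> rel_poly R r s \<and> p = m * a + r \<and> q = n * b + s \<and> (r = 0 \<or> degree r < degree m)"
  using pq
proof (induction "degree p" arbitrary: p q rule: less_induct)
  case less
  show ?case
  proof (cases "p = 0 \<or> degree p < degree m")
    case True
    have "rel_poly R 0 0" using rel_poly_const[OF hom_graph_zero] by simp
    then show ?thesis using True less.prems by (intro exI[of _ 0] exI[of _ p] exI[of _ q]) auto
  next
    case False
    define a where "a = monom (lead_coeff p / lead_coeff m) (degree p - degree m)"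
    define b where "b = monom (lead_coeff q / lead_coeff n) (degree q - degree n)"
    have dq: "degree q = degree p" "degree n = degree m" using rel_poly_degree less.prems mn by metis+
    have "(lead_coeff p / lead_coeff m, lead_coeff q / lead_coeff n) \<in> R"
      unfolding divide_inverse dq using less.prems mn
      by (intro hom_graph_mult hom_graph_inverse) (auto simp: rel_poly_def)
    then have ab: "rel_poly R a b" unfolding a_def b_def dq by (rule rel_poly_monom)
    define p' q' where "p' = p - m * a" and "q' = q - n * b"
    have r': "rel_poly R p' q'" unfolding p'_def q'_def by (intro rel_poly_diff rel_poly_mult less.prems mn(1) ab)
    have p0: "p \<noteq> 0" "degree m \<le> degree p" using False by auto
    have la: "lead_coeff p / lead_coeff m \<noteq> 0" using p0 mn(2) by simp
    have "degree a = degree p - degree m" unfolding a_def by (rule degree_monom_eq[OF la])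
    moreover have "a \<noteq> 0" using la by (simp add: a_def)
    ultimately have dma: "degree (m * a) = degree p" using mn(2) p0 by (simp add: degree_mult_eq)
    have lma: "coeff (m * a) (degree p) = lead_coeff p"
    proof -
      have "lead_coeff (m * a) = lead_coeff m * lead_coeff a" by (rule lead_coeff_mult)
      also have "lead_coeff a = lead_coeff p / lead_coeff m" unfolding a_def by (rule lead_coeff_monom)
      also have "lead_coeff m * (lead_coeff p / lead_coeff m) = lead_coeff p" using mn(2) by simp
      finally show ?thesis by (simp add: dma)
    qed
    have "p' = 0 \<or> degree p' < degree p"
    proof (cases "degree p = 0")
      case True
      then have "degree p' = 0" using degree_diff_le[of p 0 "m * a"] dma by (simp add: p'_def)
      moreover have "coeff p' 0 = 0" using lma True by (simp add: p'_def)
      ultimately have "p' = 0" by (metis degree_0_id coeff_pCons_0 pCons_0_0 degree_eq_zeroE)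
      then show ?thesis by simp
    next
      case F: False
      have "degree p' \<le> degree p - 1"
      proof (rule degree_le, intro allI impI)
        fix i assume "degree p - 1 < i"
        then consider "i = degree p" | "i > degree p" by linarith
        then show "coeff p' i = 0"
        proof cases
          case 1 then show ?thesis using lma by (simp add: p'_def)
        next
          case 2 then show ?thesis using dma by (simp add: p'_def coeff_eq_0)
        qed
      qed
      then have "degree p' < degree p" using F by linarith
      then show ?thesis ..
    qed
    then have "\<exists>a b r s. rel_poly R a b \<and> rel_poly R r s \<and> p' = m * a + r \<and> q' = n * b + s \<and> (r = 0 \<or> degree r < degree m)"
    proof
      assume "p' = 0"
      then have "q' = 0" using rel_poly_zero_iff[OF r'] by simp
      have "rel_poly R 0 0" using rel_poly_const[OF hom_graph_zero] by simp
      then show ?thesis using \<open>p' = 0\<close> \<open>q' = 0\<close> by (intro exI[of _ 0]) auto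
    next
      assume "degree p' < degree p"
      then show ?thesis by (rule less.hyps[OF _ r'])
    qed
    then obtain c d r s where *: "rel_poly R c d" "rel_poly R r s" "p' = m * c + r" "q' = n * d + s" "r = 0 \<or> degree r < degree m"
      by blast
    have "p = m * (a + c) + r" "q = n * (b + d) + s"
      using *(3,4) by (simp_all add: p'_def q'_def algebra_simps)
    then show ?thesis using *(1,2,5) rel_poly_add[OF ab *(1)] by blast
  qed
qed

end

text \<open>Extension of an embedding to the field generated by one more algebraic element \<open>x\<close>, sent to \<open>y\<close>. Polynomial
expressions in \<open>x\<close> suffice: if \<open>c0 + a * C a = 0\<close> with \<open>c0 \<noteq> 0\<close>, then the inverse of \<open>a\<close> is
\<open>- C a / c0\<close>.\<close>

lemma hom_graph_adjoin:
  assumes R: "hom_graph R" and alg: "\<forall>p q. rel_poly R p q \<longrightarrow> algebraic (poly p x)"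
    and root: "\<forall>p q. rel_poly R p q \<longrightarrow> poly p x = 0 \<longrightarrow> poly q y = 0"
  defines "R' \<equiv> {(poly p x, poly q y) |p q. rel_poly R p q}"
  shows "hom_graph R'" "R \<subseteq> R'" "(x, y) \<in> R'"
proof -
  note u = alg[rule_format] and xy = root[rule_format]
  show "R \<subseteq> R'"
  proof clarify
    fix a b assume "(a, b) \<in> R"
    then have "rel_poly R [:a:] [:b:]" by (rule rel_poly_const[OF R])
    then show "(a, b) \<in> R'" unfolding R'_def by force
  qed
  show "(x, y) \<in> R'" unfolding R'_def using rel_poly_X[OF R] by force
  show "hom_graph R'" unfolding hom_graph_def
  proof (intro conjI allI impI)
    show "(1, 1) \<in> R'" using \<open>R \<subseteq> R'\<close> hom_graph_one[OF R] by auto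
  next
    fix b assume "(0, b) \<in> R'"
    then obtain p q where "rel_poly R p q" "0 = poly p x" "b = poly q y" by (auto simp: R'_def)
    then show "b = 0" using xy[of p q] by simp
  next
    fix a b c d assume "(a, b) \<in> R'" "(c, d) \<in> R'"
    then obtain p q r s where *: "rel_poly R p q" "a = poly p x" "b = poly q y"
      "rel_poly R r s" "c = poly r x" "d = poly s y" by (auto simp: R'_def)
    have "a + c = poly (p + r) x" "b + d = poly (q + s) y" "a * c = poly (p * r) x" "b * d = poly (q * s) y"
      using * by simp_all
    then show "(a + c, b + d) \<in> R'" "(a * c, b * d) \<in> R'"
      using rel_poly_add[OF R *(1,4)] rel_poly_mult[OF R *(1,4)] unfolding R'_def by blast+
  next
    fix a b assume "(a, b) \<in> R'"
    then obtain p q where pq: "rel_poly R p q" "a = poly p x" "b = poly q y" by (auto simp: R'_def)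
    have "- a = poly (- p) x" "- b = poly (- q) y" using pq by simp_all
    then show "(- a, - b) \<in> R'" using rel_poly_uminus[OF R pq(1)] unfolding R'_def by blast
    show "(inverse a, inverse b) \<in> R'"
    proof (cases "a = 0")
      case True
      then have "b = 0" using xy[OF pq(1)] pq by simp
      then show ?thesis using True \<open>R \<subseteq> R'\<close> hom_graph_zero[OF R] by auto
    next
      case False
      \<comment> \<open>An integer polynomial with root \<open>a \<noteq> 0\<close> and nonzero constant coefficient expresses \<open>inverse a\<close> in \<open>a\<close>.\<close>
      obtain c where c: "c \<noteq> 0" "coeff c 0 \<noteq> 0" "poly (map_poly of_int c) a = 0"
        using algebraicE'_nonzero[OF u[OF pq(1)]] False pq(2) by metis
      obtain c0 c' where cc: "c = pCons c0 c'" by (rule pCons_cases)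
      have c0: "c0 \<noteq> 0" using c cc by simp
      define C where "C = (map_poly of_int c' :: complex poly)"
      have ca: "of_int c0 + a * poly C a = 0" using c(3) by (simp add: cc map_poly_pCons C_def)
      define e :: complex where "e = inverse (- of_int c0)"
      have eR: "(e, e) \<in> R" unfolding e_def
        by (intro hom_graph_inverse[OF R] hom_graph_uminus[OF R] hom_graph_of_int[OF R])
      define p' q' where "p' = smult e (pcompose C p)" and "q' = smult e (pcompose C q)"
      have r': "rel_poly R p' q'" unfolding p'_def q'_def C_def
        by (intro rel_poly_smult[OF R] eR rel_poly_pcompose[OF R] rel_poly_int[OF R] pq(1))
      have "a * poly C a = - of_int c0" using ca by (simp add: eq_neg_iff_add_eq_0 add.commute)
      then have "poly (p * p') x = 1" using c0 by (simp add: p'_def pq(2)[symmetric] poly_pcompose e_def field_simps)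
      then have "poly (p * p' - 1) x = 0" by simp
      moreover have "rel_poly R (p * p' - 1) (q * q' - 1)"
        using rel_poly_diff[OF R rel_poly_mult[OF R pq(1) r'] rel_poly_const[OF R hom_graph_one[OF R]]]
        by (simp add: one_pCons)
      ultimately have "poly (q * q' - 1) y = 0" using xy by blast
      then have "b * poly q' y = 1" "a * poly p' x = 1" using \<open>poly (p * p') x = 1\<close> pq by simp_all
      then have "inverse a = poly p' x" "inverse b = poly q' y" by (simp_all add: inverse_unique)
      then show ?thesis using r' unfolding R'_def by blast
    qed
  qed
qed

text \<open>The minimal polynomial \<open>m\<close> of \<open>x\<close> over the domain of the embedding, and its image \<open>n\<close>. By division every
polynomial that vanishes at \<open>x\<close> is a multiple of \<open>m\<close>, so its image vanishes at the roots of \<open>n\<close>; that is the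
condition under which \<open>hom_graph_adjoin\<close> extends the embedding.\<close>

lemma minimal_rel_poly:
  assumes R: "hom_graph R" and x: "algebraic x"
  obtains m n where "rel_poly R m n" "degree m > 0" "poly m x = 0"
    "\<And>p q. rel_poly R p q \<Longrightarrow> poly p x = 0 \<Longrightarrow> p \<noteq> 0 \<Longrightarrow> degree m \<le> degree p"
    "\<And>p q y. rel_poly R p q \<Longrightarrow> poly p x = 0 \<Longrightarrow> poly n y = 0 \<Longrightarrow> poly q y = 0"
proof -
  define S where "S = {p. p \<noteq> 0 \<and> poly p x = 0 \<and> (\<exists>q. rel_poly R p q)}"
  obtain c where "c \<noteq> 0" "poly (map_poly of_int c) x = 0" using algebraicE'[OF x] by blast
  moreover have "map_poly complex_of_int c \<noteq> 0"
  proof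
    assume *: "map_poly complex_of_int c = 0"
    have "coeff c i = 0" for i
      using arg_cong[OF *, of "\<lambda>p. coeff p i"] by (simp add: coeff_map_poly)
    then show False using \<open>c \<noteq> 0\<close> by (simp add: poly_eq_iff)
  qed
  ultimately have "map_poly of_int c \<in> S" using rel_poly_int[OF R, of c] by (auto simp: S_def)
  then obtain m where m: "m \<in> S" "\<And>p. p \<in> S \<Longrightarrow> degree m \<le> degree p"
    using ex_has_least_nat[of "\<lambda>p. p \<in> S" _ degree] by blast
  then obtain n where mn: "rel_poly R m n" "m \<noteq> 0" "poly m x = 0" by (auto simp: S_def)
  have "degree m > 0"
  proof (rule ccontr)
    assume "\<not> degree m > 0"
    then obtain a where "m = [:a:]" by (metis degree_eq_zeroE neq0_conv)
    then show False using mn by simp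
  qed
  moreover have "degree m \<le> degree p" if "rel_poly R p q" "poly p x = 0" "p \<noteq> 0" for p q
    using m(2)[of p] that by (auto simp: S_def)
  moreover have "poly q y = 0" if pq: "rel_poly R p q" "poly p x = 0" "poly n y = 0" for p q y
  proof -
    obtain a b r s where *: "rel_poly R r s" "p = m * a + r" "q = n * b + s" "r = 0 \<or> degree r < degree m"
      using rel_poly_division[OF R mn(1,2) pq(1)] by blast
    have "poly r x = 0" using *(2) mn(3) pq(2) by simp
    then have "r = 0" using m(2)[of r] * by (force simp: S_def)
    then have "s = 0" using rel_poly_zero_iff[OF R *(1)] by simp
    then show ?thesis using *(3) pq(3) by simp
  qed
  ultimately show ?thesis using that mn by blast
qed

lemma eval_eq_poly: "CF.eval p x = poly (Poly (rev p)) x"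
proof (induction p)
  case (Cons a p)
  have pw: "x [^]\<^bsub>complex_field\<^esub> (n::nat) = x ^ n" for n by (induction n) simp_all
  show ?case using Cons by (simp add: Poly_append poly_monom pw)
qed simp

text \<open>Translates between the two notions of algebraicity: over a subfield of an abstract ring, with polynomials as
lists starting with the leading coefficient, and over the integers, with the type of polynomials.\<close>

lemma algebraic_over_Rats_iff:
  fixes x :: complex
  shows "((\<lambda>K x. \<not> ring.transcendental complex_field K x) over \<rat>) x \<longleftrightarrow> algebraic x"
proof
  assume "((\<lambda>K x. \<not> ring.transcendental complex_field K x) over \<rat>) x"
  then obtain p where p: "p \<in> carrier (univ_poly complex_field \<rat>)" "p \<noteq> []" "CF.eval p x = 0"
    using domain.algebraicE[OF field.axioms(1)[OF field_complex_field] subfieldE(1)[OF subfield_Rats_complex]]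
    by (metis UNIV_I complex_field_simps(1,5))
  have "set p \<subseteq> \<rat>" "hd p \<noteq> 0"
    using p(1,2) by (auto simp: univ_poly_def polynomial_def)
  define P where "P = Poly (rev p)"
  have "poly P x = CF.eval p x" unfolding P_def by (rule eval_eq_poly[symmetric])
  moreover have "P \<noteq> 0"
  proof -
    have "coeff P (length p - 1) = hd p" using p(2) by (cases p) (simp_all add: P_def nth_default_def nth_append)
    then show ?thesis using \<open>hd p \<noteq> 0\<close> by auto
  qed
  moreover have "coeff P i \<in> \<rat>" for i
  proof (cases "i < length p")
    case True
    then have "rev p ! i \<in> set (rev p)" by (intro nth_mem) simp
    then show ?thesis using True \<open>set p \<subseteq> \<rat>\<close> by (auto simp: P_def nth_default_def)
  qed (simp add: P_def nth_default_def)
  ultimately show "algebraic x" using p(3) by (intro algebraicI'[of P]) auto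
next
  assume "algebraic x"
  then obtain P where P: "\<And>i. coeff P i \<in> \<rat>" "P \<noteq> 0" "poly P x = 0"
    using algebraic_altdef by blast
  define p where "p = rev (coeffs P)"
  have "CF.eval p x = 0" using P(3) by (simp add: p_def eval_eq_poly)
  moreover have "p \<noteq> []" using P(2) by (simp add: p_def)
  moreover have "p \<in> carrier (univ_poly complex_field \<rat>)"
    using P(1,2) by (auto simp: univ_poly_def polynomial_def p_def coeffs_def hd_rev last_coeffs_eq_coeff_degree)
  ultimately show "((\<lambda>K x. \<not> ring.transcendental complex_field K x) over \<rat>) x"
    using CF.algebraicI by simp
qed

lemma Qbar_subfield: "subfield Qbar complex_field"
  using algebraic_over_Rats_iff field.subfield_of_algebraics[OF field_complex_field subfield_Rats_complex]
  by (simp add: Qbar_def)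

definition field_emb :: "complex set \<Rightarrow> (complex \<Rightarrow> complex) \<Rightarrow> bool" where
  "field_emb F \<sigma> \<longleftrightarrow> \<sigma> 1 = 1 \<and> (\<forall>x\<in>F. \<forall>y\<in>F. \<sigma> (x + y) = \<sigma> x + \<sigma> y \<and> \<sigma> (x * y) = \<sigma> x * \<sigma> y)"

context
  fixes F \<sigma> assumes F: "subfield F complex_field" and \<sigma>: "field_emb F \<sigma>"
begin

lemma emb_one: "\<sigma> 1 = 1" using \<sigma> by (simp add: field_emb_def)
lemma emb_add: "x \<in> F \<Longrightarrow> y \<in> F \<Longrightarrow> \<sigma> (x + y) = \<sigma> x + \<sigma> y" using \<sigma> by (simp add: field_emb_def)
lemma emb_mult: "x \<in> F \<Longrightarrow> y \<in> F \<Longrightarrow> \<sigma> (x * y) = \<sigma> x * \<sigma> y" using \<sigma> by (simp add: field_emb_def)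
lemma emb_zero: "\<sigma> 0 = 0" using emb_add[OF subfield_zero[OF F] subfield_zero[OF F]] by simp
lemma emb_uminus: "x \<in> F \<Longrightarrow> \<sigma> (- x) = - \<sigma> x"
  using emb_add[of x "- x"] emb_zero subfield_uminus[OF F] by (simp add: eq_neg_iff_add_eq_0 add.commute)
lemma emb_diff: "x \<in> F \<Longrightarrow> y \<in> F \<Longrightarrow> \<sigma> (x - y) = \<sigma> x - \<sigma> y"
  using emb_add[of x "- y"] emb_uminus[of y] subfield_uminus[OF F] by simp
lemma emb_inverse: "x \<in> F \<Longrightarrow> \<sigma> (inverse x) = inverse (\<sigma> x)"
proof (cases "x = 0")
  case False
  assume x: "x \<in> F"
  have "\<sigma> x * \<sigma> (inverse x) = 1"
    using emb_mult[OF x subfield_inverse[OF F x]] False emb_one by simp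
  then show ?thesis by (metis inverse_unique)
qed (simp add: emb_zero)

lemma hom_graph_emb: "hom_graph {(x, \<sigma> x) |x. x \<in> F}"
  unfolding hom_graph_def
  using emb_one emb_zero subfield_one[OF F] subfield_add[OF F] subfield_mult[OF F] subfield_uminus[OF F]
    subfield_inverse[OF F] emb_add emb_mult emb_uminus emb_inverse
  by force

lemma emb_inj: "inj_on \<sigma> F"
proof (rule inj_onI)
  fix x y assume xy: "x \<in> F" "y \<in> F" "\<sigma> x = \<sigma> y"
  then have "(x - y, 0) \<in> {(x, \<sigma> x) |x. x \<in> F}" using emb_diff subfield_diff[OF F] by force
  then show "x = y" using hom_graph_zero_iff[OF hom_graph_emb] by fastforce
qed

lemma emb_of_nat: "\<sigma> (of_nat n) = of_nat n"
  by (induction n) (simp_all add: emb_zero emb_one emb_add subfield_one[OF F] subfield_of_nat[OF F])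

lemma emb_of_int: "\<sigma> (of_int n) = of_int n"
proof (cases n)
  case (nonneg m) then show ?thesis by (simp add: emb_of_nat)
next
  case (neg m)
  have "\<sigma> (- of_nat (Suc m)) = - of_nat (Suc m)"
    using emb_uminus[OF subfield_of_nat[OF F, of "Suc m"]] emb_of_nat[of "Suc m"] by simp
  then show ?thesis using neg by simp
qed

lemma emb_Rats: "x \<in> \<rat> \<Longrightarrow> \<sigma> x = x"
proof -
  assume "x \<in> \<rat>"
  then obtain a b :: int where x: "x = of_int a / of_int b" by (auto elim!: Rats_cases')
  have "\<sigma> x = \<sigma> (of_int a) * \<sigma> (inverse (of_int b))"
    unfolding x divide_inverse by (intro emb_mult subfield_inverse[OF F] subfield_of_int[OF F])
  then show ?thesis by (simp add: x emb_inverse emb_of_int subfield_of_int[OF F] divide_inverse)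
qed

lemma emb_poly_fixed:
  assumes x: "x \<in> F" and p: "\<And>i. coeff p i \<in> F" "\<And>i. \<sigma> (coeff p i) = coeff p i"
  shows "\<sigma> (poly p x) = poly p (\<sigma> x)"
  using p
proof (induction p)
  case (pCons a p)
  have "a \<in> F" "\<sigma> a = a" using pCons.prems[of 0] by simp_all
  moreover have "coeff p i \<in> F" "\<sigma> (coeff p i) = coeff p i" for i using pCons.prems[of "Suc i"] by simp_all
  moreover have "poly p x \<in> F" using subfield_poly[OF F _ x] calculation(3) by blast
  ultimately show ?case using pCons.IH x by (simp add: emb_add emb_mult subfield_mult[OF F])
qed (simp add: emb_zero)

lemma emb_algebraic: "x \<in> F \<Longrightarrow> algebraic x \<Longrightarrow> algebraic (\<sigma> x)"
proof -
  assume x: "x \<in> F" "algebraic x"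
  then obtain p where p: "\<And>i. coeff p i \<in> \<rat>" "p \<noteq> 0" "poly p x = 0" using algebraic_altdef by blast
  have "poly p (\<sigma> x) = \<sigma> (poly p x)"
    using subfield_Rats[OF F] p(1) emb_Rats by (intro emb_poly_fixed[symmetric] x(1)) auto
  then show ?thesis using p emb_zero by (intro algebraicI'[of p]) auto
qed

text \<open>An embedding permutes the finitely many roots of a rational polynomial in \<open>F\<close>.\<close>

lemma emb_bij:
  assumes alg: "F \<subseteq> Qbar" and into: "\<sigma> ` F \<subseteq> F"
  shows "bij_betw \<sigma> F F"
proof -
  have "F \<subseteq> \<sigma> ` F"
  proof
    fix y assume y: "y \<in> F"
    then have "algebraic y" using alg by (auto simp: Qbar_def)
    then obtain p where p: "\<And>i. coeff p i \<in> \<rat>" "p \<noteq> 0" "poly p y = 0" using algebraic_altdef by blast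
    define S where "S = {z \<in> F. poly p z = 0}"
    have "finite S" using poly_roots_finite[OF p(2)] by (rule finite_subset[rotated]) (auto simp: S_def)
    moreover have "\<sigma> ` S \<subseteq> S"
    proof clarify
      fix z assume z: "z \<in> S"
      then have zF: "z \<in> F" by (simp add: S_def)
      have "poly p (\<sigma> z) = \<sigma> (poly p z)"
        using subfield_Rats[OF F] p(1) emb_Rats by (intro emb_poly_fixed[symmetric] zF) auto
      then show "\<sigma> z \<in> S" using z into emb_zero by (auto simp: S_def)
    qed
    moreover have "inj_on \<sigma> S" using emb_inj by (rule inj_on_subset) (auto simp: S_def)
    ultimately have "\<sigma> ` S = S" by (rule endo_inj_surj)
    moreover have "y \<in> S" using y p by (simp add: S_def)
    ultimately show "y \<in> \<sigma> ` F" by (auto simp: S_def)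
  qed
  then show ?thesis using emb_inj into by (auto simp: bij_betw_def)
qed

end

text \<open>A maximal extension inside the algebraic numbers is defined on all of them: otherwise adjoin some \<open>x\<close>, sent
to a complex root of the image of its minimal polynomial.\<close>

theorem extend_hom_graph:
  assumes R0: "hom_graph R0" and D: "Domain R0 \<subseteq> Qbar"
  obtains R where "hom_graph R" "R0 \<subseteq> R" "Domain R = Qbar"
proof -
  define A where "A = {R. hom_graph R \<and> R0 \<subseteq> R \<and> Domain R \<subseteq> Qbar}"
  have "\<exists>M\<in>A. \<forall>B\<in>A. M \<subseteq> B \<longrightarrow> B = M"
  proof (rule subset_Zorn_nonempty)
    show "A \<noteq> {}" using R0 D by (auto simp: A_def)
    fix C assume C: "C \<noteq> {}" "subset.chain A C"
    have CA: "C \<subseteq> A" using C(2) by (simp add: subset_chain_def)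
    have two: "\<exists>S\<in>C. u \<in> S \<and> v \<in> S" if uv: "u \<in> \<Union>C" "v \<in> \<Union>C" for u v
    proof -
      obtain S T where "S \<in> C" "T \<in> C" "u \<in> S" "v \<in> T" using uv by auto
      moreover have "S \<subseteq> T \<or> T \<subseteq> S" using C(2) calculation by (auto simp: subset_chain_def)
      ultimately show ?thesis by blast
    qed
    have hg: "hom_graph S" if "S \<in> C" for S using that CA by (auto simp: A_def)
    have "hom_graph (\<Union>C)" unfolding hom_graph_def
    proof (intro conjI allI impI)
      show "(1, 1) \<in> \<Union>C" using C(1) hom_graph_one[OF hg] by blast
    next
      fix y assume "(0, y) \<in> \<Union>C"
      then obtain S where "S \<in> C" "(0, y) \<in> S" by blast
      then show "y = 0" using hom_graph_zero_iff[OF hg] by blast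
    next
      fix a b c d assume "(a, b) \<in> \<Union>C" "(c, d) \<in> \<Union>C"
      from two[OF this] obtain S where S: "S \<in> C" "(a, b) \<in> S" "(c, d) \<in> S" by blast
      show "(a + c, b + d) \<in> \<Union>C" using hom_graph_add[OF hg[OF S(1)] S(2,3)] S(1) by blast
      show "(a * c, b * d) \<in> \<Union>C" using hom_graph_mult[OF hg[OF S(1)] S(2,3)] S(1) by blast
    next
      fix a b assume "(a, b) \<in> \<Union>C"
      then obtain S where S: "S \<in> C" "(a, b) \<in> S" by blast
      show "(- a, - b) \<in> \<Union>C" using hom_graph_uminus[OF hg[OF S(1)] S(2)] S(1) by blast
      show "(inverse a, inverse b) \<in> \<Union>C" using hom_graph_inverse[OF hg[OF S(1)] S(2)] S(1) by blast
    qed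
    moreover have "R0 \<subseteq> \<Union>C" using C(1) CA by (auto simp: A_def)
    moreover have "Domain (\<Union>C) \<subseteq> Qbar" using CA by (auto simp: A_def)
    ultimately show "\<Union>C \<in> A" by (simp add: A_def)
  qed
  then obtain R where R: "R \<in> A" "\<And>S. S \<in> A \<Longrightarrow> R \<subseteq> S \<Longrightarrow> S = R" by blast
  have hR: "hom_graph R" "R0 \<subseteq> R" "Domain R \<subseteq> Qbar" using R(1) by (auto simp: A_def)
  have "Qbar \<subseteq> Domain R"
  proof
    fix x assume x: "x \<in> Qbar"
    then have ax: "algebraic x" by (simp add: Qbar_def)
    obtain m n where mn: "rel_poly R m n" "degree m > 0" "poly m x = 0"
      "\<And>p q. rel_poly R p q \<Longrightarrow> poly p x = 0 \<Longrightarrow> p \<noteq> 0 \<Longrightarrow> degree m \<le> degree p"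
      "\<And>p q y. rel_poly R p q \<Longrightarrow> poly p x = 0 \<Longrightarrow> poly n y = 0 \<Longrightarrow> poly q y = 0"
      by (rule minimal_rel_poly[OF hR(1) ax]) (rule that)
    have "degree n > 0" using mn(2) rel_poly_degree[OF hR(1) mn(1)] by simp
    then obtain y where y: "poly n y = 0"
      using fundamental_theorem_of_algebra[of n] constant_degree[of n] by auto
    define R' where "R' = {(poly p x, poly q y) |p q. rel_poly R p q}"
    have q: "poly p x \<in> Qbar" if "rel_poly R p q" for p q
      using that hR(3) by (intro subfield_poly[OF Qbar_subfield _ x]) (auto simp: rel_poly_def)
    have alg: "\<forall>p q. rel_poly R p q \<longrightarrow> algebraic (poly p x)" using q by (auto simp: Qbar_def)
    have xy: "\<forall>p q. rel_poly R p q \<longrightarrow> poly p x = 0 \<longrightarrow> poly q y = 0" using mn(5)[OF _ _ y] by blast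
    note adj = hom_graph_adjoin[OF hR(1), OF alg xy, folded R'_def]
    have "R' \<in> A" using adj(1,2) hR(2) q by (auto simp: A_def R'_def)
    then have "R' = R" using R(2) adj(2) by simp
    then show "x \<in> Domain R" using adj(3) by auto
  qed
  then show ?thesis using that hR by blast
qed

lemma galois_group_iff:
  assumes "subfield L complex_field"
  shows "\<sigma> \<in> carrier (galois_group L k) \<longleftrightarrow>
    \<sigma> \<in> extensional L \<and> bij_betw \<sigma> L L \<and> field_emb L \<sigma> \<and> (\<forall>x\<in>k. \<sigma> x = x)"
  using bij_betwE[of \<sigma> L L] by (auto simp: galois_group_def Bij_def ring_hom_def field_emb_def)

theorem extend_emb:
  assumes R0: "hom_graph R0" "Domain R0 \<subseteq> Qbar"
  obtains \<tau> where "\<tau> \<in> carrier (galois_group Qbar \<rat>)" "\<And>x y. (x, y) \<in> R0 \<Longrightarrow> \<tau> x = y"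
proof -
  obtain R where R: "hom_graph R" "R0 \<subseteq> R" "Domain R = Qbar" by (rule extend_hom_graph[OF R0]) (rule that)
  define \<tau> where "\<tau> = (\<lambda>x\<in>Qbar. THE y. (x, y) \<in> R)"
  have \<tau>R: "\<tau> x = y" if "(x, y) \<in> R" for x y
  proof -
    have "x \<in> Qbar" using that R(3) by auto
    then show ?thesis unfolding \<tau>_def using that hom_graph_unique[OF R(1)] by (auto intro!: the_equality)
  qed
  have inR: "(x, \<tau> x) \<in> R" if xQ: "x \<in> Qbar" for x
  proof -
    obtain y where "(x, y) \<in> R" using xQ R(3) by blast
    then show ?thesis using \<tau>R[of x y] by simp
  qed
  have \<tau>_ext: "\<tau> \<in> extensional Qbar" by (simp add: \<tau>_def)
  have emb: "field_emb Qbar \<tau>" unfolding field_emb_def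
  proof (intro conjI ballI)
    show "\<tau> 1 = 1" by (rule \<tau>R[OF hom_graph_one[OF R(1)]])
    fix x y assume "x \<in> Qbar" "y \<in> Qbar"
    note xy = inR[OF this(1)] inR[OF this(2)]
    show "\<tau> (x + y) = \<tau> x + \<tau> y" by (rule \<tau>R[OF hom_graph_add[OF R(1) xy]])
    show "\<tau> (x * y) = \<tau> x * \<tau> y" by (rule \<tau>R[OF hom_graph_mult[OF R(1) xy]])
  qed
  have "\<tau> ` Qbar \<subseteq> Qbar" using emb_algebraic[OF Qbar_subfield emb] by (auto simp: Qbar_def)
  then have bij: "bij_betw \<tau> Qbar Qbar" by (rule emb_bij[OF Qbar_subfield emb order.refl])
  have rats: "\<forall>x\<in>\<rat>. \<tau> x = x" by (intro ballI emb_Rats[OF Qbar_subfield emb])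
  have "\<tau> \<in> carrier (galois_group Qbar \<rat>)"
    unfolding galois_group_iff[OF Qbar_subfield] by (intro conjI \<tau>_ext bij emb rats)
  then show ?thesis
  proof (rule that)
    fix x y assume "(x, y) \<in> R0"
    then show "\<tau> x = y" using R(2) by (intro \<tau>R) blast
  qed
qed

lemma rel_poly_Id: "rel_poly (Id_on F) p q \<longleftrightarrow> p = q \<and> (\<forall>i. coeff p i \<in> F)"
  by (simp add: rel_poly_def poly_eq_iff Id_on_iff all_conj_distrib)

lemma hom_graph_Id: "subfield F complex_field \<Longrightarrow> hom_graph (Id_on F)"
  by (auto simp: hom_graph_def intro: subfield_one subfield_add subfield_mult subfield_uminus subfield_inverse)

text \<open>Apply \<open>extend_emb\<close> to the \<open>F\<close>-embedding of \<open>F(x)\<close> that takes \<open>x\<close> to \<open>y\<close>.\<close>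

lemma extend_to_conjugate:
  assumes F: "subfield F complex_field" "F \<subseteq> Qbar" and x: "x \<in> Qbar"
    and xy: "\<forall>p. (\<forall>i. coeff p i \<in> F) \<longrightarrow> poly p x = 0 \<longrightarrow> poly p y = 0"
  obtains \<tau> where "\<tau> \<in> carrier (galois_group Qbar F)" "\<tau> x = y"
proof -
  define R' where "R' = {(poly p x, poly q y) |p q. rel_poly (Id_on F) p q}"
  have q: "poly p x \<in> Qbar" if "rel_poly (Id_on F) p q" for p q
    using that F(2) by (intro subfield_poly[OF Qbar_subfield _ x]) (auto simp: rel_poly_Id)
  have alg: "\<forall>p q. rel_poly (Id_on F) p q \<longrightarrow> algebraic (poly p x)" using q by (auto simp: Qbar_def)
  have xy': "\<forall>p q. rel_poly (Id_on F) p q \<longrightarrow> poly p x = 0 \<longrightarrow> poly q y = 0"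
  proof (intro allI impI)
    fix p q assume "rel_poly (Id_on F) p q" and p: "poly p x = 0"
    then have pq: "q = p" "\<forall>i. coeff p i \<in> F" by (auto simp: rel_poly_Id)
    show "poly q y = 0" unfolding pq(1) using xy pq(2) p by blast
  qed
  note adj = hom_graph_adjoin[OF hom_graph_Id[OF F(1)], OF alg xy', folded R'_def]
  have D: "Domain R' \<subseteq> Qbar" using q by (auto simp: R'_def)
  obtain \<tau> where \<tau>: "\<tau> \<in> carrier (galois_group Qbar \<rat>)" "\<And>x y. (x, y) \<in> R' \<Longrightarrow> \<tau> x = y"
    by (rule extend_emb[OF adj(1) D]) (rule that)
  have "\<forall>z\<in>F. \<tau> z = z"
  proof
    fix z assume "z \<in> F"
    then have "(z, z) \<in> R'" using adj(2) by blast
    then show "\<tau> z = z" by (rule \<tau>(2))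
  qed
  then have "\<tau> \<in> carrier (galois_group Qbar F)" using \<tau>(1) by (simp add: galois_group_iff[OF Qbar_subfield])
  moreover have "\<tau> x = y" by (rule \<tau>(2)[OF adj(3)])
  ultimately show ?thesis by (rule that)
qed

text \<open>The minimal polynomial of \<open>x\<close> over \<open>F\<close> has degree at least two. In characteristic zero it has no multiple
roots, since its derivative has smaller degree.\<close>

lemma other_conjugate:
  assumes F: "subfield F complex_field" and x: "x \<in> Qbar" "x \<notin> F"
  obtains y where "y \<noteq> x" "\<forall>p. (\<forall>i. coeff p i \<in> F) \<longrightarrow> poly p x = 0 \<longrightarrow> poly p y = 0"
proof -
  have ax: "algebraic x" using x by (simp add: Qbar_def)
  note R = hom_graph_Id[OF F]
  obtain m n where mn: "rel_poly (Id_on F) m n" "degree m > 0" "poly m x = 0"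
      "\<And>p q. rel_poly (Id_on F) p q \<Longrightarrow> poly p x = 0 \<Longrightarrow> p \<noteq> 0 \<Longrightarrow> degree m \<le> degree p"
      "\<And>p q y. rel_poly (Id_on F) p q \<Longrightarrow> poly p x = 0 \<Longrightarrow> poly n y = 0 \<Longrightarrow> poly q y = 0"
    by (rule minimal_rel_poly[OF R ax]) (rule that)
  have n: "n = m" and mF: "\<And>i. coeff m i \<in> F" using mn(1) by (auto simp: rel_poly_Id)
  have dm: "degree m \<noteq> 1"
  proof
    assume d1: "degree m = 1"
    then have "poly m x = coeff m 0 + coeff m 1 * x" by (simp add: poly_altdef)
    moreover have "lead_coeff m \<noteq> 0" using mn(2) by auto
    then have "coeff m 1 \<noteq> 0" using d1 by simp
    ultimately have "x = (- coeff m 0) / coeff m 1" using mn(3) by (simp add: field_simps add_eq_0_iff)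
    then have "x \<in> F" by (simp add: subfield_divide[OF F] subfield_uminus[OF F] mF del: divide_minus_left)
    then show False using x(2) by simp
  qed
  have pd: "poly (pderiv m) x \<noteq> 0"
  proof
    assume 0: "poly (pderiv m) x = 0"
    have "coeff (pderiv m) i \<in> F" for i
      unfolding coeff_pderiv by (intro subfield_mult[OF F] subfield_of_nat[OF F] mF)
    then have "rel_poly (Id_on F) (pderiv m) (pderiv m)" by (simp add: rel_poly_Id)
    moreover have "pderiv m \<noteq> 0" using mn(2) by (simp add: pderiv_eq_0_iff)
    ultimately have "degree m \<le> degree (pderiv m)" by (rule mn(4)[OF _ 0])
    then show False using mn(2) degree_pderiv[of m] by simp
  qed
  obtain g where g: "m = [:- x, 1:] * g" using mn(3) by (auto simp: poly_eq_0_iff_dvd)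
  have gx: "poly g x \<noteq> 0" using pd unfolding g pderiv_mult by (simp add: pderiv_pCons)
  have "g \<noteq> 0" using gx by auto
  then have "degree m = Suc (degree g)" unfolding g by (subst degree_mult_eq) auto
  then have "degree g > 0" using dm by simp
  then obtain y where y: "poly g y = 0"
    using fundamental_theorem_of_algebra[of g] constant_degree[of g] by auto
  have "poly m y = 0" using y by (simp add: g)
  moreover have "y \<noteq> x" using y gx by auto
  moreover have "poly p y = 0" if "\<forall>i. coeff p i \<in> F" "poly p x = 0" for p
    using mn(5)[of p p y] that \<open>poly m y = 0\<close> by (simp add: n rel_poly_Id)
  ultimately show ?thesis using that[of y] by blast
qed

section \<open>Galois theory of the maximal abelian extension\<close>

context
  fixes L k :: "complex set" assumes L: "subfield L complex_field"
begin

lemma gal_emb: "\<sigma> \<in> carrier (galois_group L k) \<Longrightarrow> field_emb L \<sigma>"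
  and gal_fix: "\<sigma> \<in> carrier (galois_group L k) \<Longrightarrow> x \<in> k \<Longrightarrow> \<sigma> x = x"
  and gal_bij: "\<sigma> \<in> carrier (galois_group L k) \<Longrightarrow> bij_betw \<sigma> L L"
  and gal_ext: "\<sigma> \<in> carrier (galois_group L k) \<Longrightarrow> \<sigma> \<in> extensional L"
  by (simp_all add: galois_group_iff[OF L])

lemma gal_closed: "\<sigma> \<in> carrier (galois_group L k) \<Longrightarrow> x \<in> L \<Longrightarrow> \<sigma> x \<in> L"
  using gal_bij bij_betwE by blast

lemma gal_Bij: "\<sigma> \<in> carrier (galois_group L k) \<Longrightarrow> \<sigma> \<in> Bij L"
  by (simp add: galois_group_def)

lemma gal_eqI:
  assumes "\<sigma> \<in> carrier (galois_group L k)" "\<tau> \<in> carrier (galois_group L k')" "\<And>x. x \<in> L \<Longrightarrow> \<sigma> x = \<tau> x"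
  shows "\<sigma> = \<tau>"
  by (rule extensionalityI[OF gal_ext[OF assms(1)] _ assms(3)])
    (use assms(2) in \<open>simp_all add: galois_group_iff[OF L]\<close>)

lemma gal_mult: "\<sigma> \<in> carrier (galois_group L k) \<Longrightarrow> \<tau> \<in> carrier (galois_group L k) \<Longrightarrow>
    \<sigma> \<otimes>\<^bsub>galois_group L k\<^esub> \<tau> = compose L \<sigma> \<tau>"
  by (simp add: galois_group_def BijGroup_def)

lemma gal_mult_apply: "\<sigma> \<in> carrier (galois_group L k) \<Longrightarrow> \<tau> \<in> carrier (galois_group L k) \<Longrightarrow> x \<in> L \<Longrightarrow>
    (\<sigma> \<otimes>\<^bsub>galois_group L k\<^esub> \<tau>) x = \<sigma> (\<tau> x)"
  by (simp add: gal_mult compose_def)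

lemma gal_one: "\<one>\<^bsub>galois_group L k\<^esub> = (\<lambda>x\<in>L. x)"
  by (simp add: galois_group_def BijGroup_def)

lemma group_galois_group:
  assumes k: "k \<subseteq> L" shows "group (galois_group L k)"
proof -
  interpret B: group "BijGroup L" by (rule group_BijGroup)
  let ?H = "carrier (galois_group L k)"
  have "subgroup ?H (BijGroup L)"
  proof (rule B.subgroupI)
    show "?H \<subseteq> carrier (BijGroup L)" by (auto simp: galois_group_def BijGroup_def)
    have "(\<lambda>x\<in>L. x) \<in> ?H" using k
      by (auto simp: galois_group_iff[OF L] field_emb_def bij_betw_def inj_on_def
        subfield_one[OF L] subfield_add[OF L] subfield_mult[OF L])
    then show "?H \<noteq> {}" by blast
  next
    fix \<sigma> assume s: "\<sigma> \<in> ?H"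
    have i: "inv\<^bsub>BijGroup L\<^esub> \<sigma> = (\<lambda>x\<in>L. inv_into L \<sigma> x)" by (rule inv_BijGroup[OF gal_Bij[OF s]])
    define \<tau> where "\<tau> = (\<lambda>x\<in>L. inv_into L \<sigma> x)"
    have b: "bij_betw \<tau> L L" unfolding \<tau>_def using bij_betw_inv_into[OF gal_bij[OF s]]
      by (rule bij_betw_cong[THEN iffD1, rotated]) simp
    have tL: "\<tau> x \<in> L" if "x \<in> L" for x using b that bij_betwE by blast
    have st: "\<sigma> (\<tau> x) = x" if "x \<in> L" for x
      using that bij_betw_inv_into_right[OF gal_bij[OF s]] by (simp add: \<tau>_def)
    have ts: "\<tau> (\<sigma> x) = x" if "x \<in> L" for x
      using that bij_betw_inv_into_left[OF gal_bij[OF s]] gal_closed[OF s] by (simp add: \<tau>_def)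
    note E = gal_emb[OF s]
    have "field_emb L \<tau>" unfolding field_emb_def
    proof (intro conjI ballI)
      show "\<tau> 1 = 1" using ts[OF subfield_one[OF L]] emb_one[OF L E] by simp
      fix x y assume xy: "x \<in> L" "y \<in> L"
      have "\<sigma> (\<tau> x + \<tau> y) = x + y" using emb_add[OF L E tL[OF xy(1)] tL[OF xy(2)]] st xy by simp
      then show "\<tau> (x + y) = \<tau> x + \<tau> y"
        using ts[OF subfield_add[OF L tL[OF xy(1)] tL[OF xy(2)]]] by simp
      have "\<sigma> (\<tau> x * \<tau> y) = x * y" using emb_mult[OF L E tL[OF xy(1)] tL[OF xy(2)]] st xy by simp
      then show "\<tau> (x * y) = \<tau> x * \<tau> y"
        using ts[OF subfield_mult[OF L tL[OF xy(1)] tL[OF xy(2)]]] by simp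
    qed
    moreover have "\<tau> x = x" if "x \<in> k" for x using ts[of x] gal_fix[OF s that] that k by auto
    ultimately show "inv\<^bsub>BijGroup L\<^esub> \<sigma> \<in> ?H" unfolding i \<tau>_def[symmetric]
      using b by (simp add: galois_group_iff[OF L]) (simp add: \<tau>_def)
  next
    fix \<sigma> \<tau> assume st: "\<sigma> \<in> ?H" "\<tau> \<in> ?H"
    have e: "\<sigma> \<otimes>\<^bsub>BijGroup L\<^esub> \<tau> = compose L \<sigma> \<tau>" using gal_Bij st by (simp add: BijGroup_def)
    have "bij_betw (compose L \<sigma> \<tau>) L L" by (rule bij_betw_compose[OF gal_bij gal_bij]) (rule st)+
    moreover have "field_emb L (compose L \<sigma> \<tau>)"
      using gal_emb[OF st(1)] gal_emb[OF st(2)] gal_closed[OF st(2)]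
      by (auto simp: field_emb_def compose_def subfield_one[OF L] subfield_add[OF L] subfield_mult[OF L])
    moreover have "compose L \<sigma> \<tau> x = x" if "x \<in> k" for x
      using that k gal_fix[OF st(1)] gal_fix[OF st(2)] by (auto simp: compose_def)
    ultimately show "\<sigma> \<otimes>\<^bsub>BijGroup L\<^esub> \<tau> \<in> ?H" by (simp add: e galois_group_iff[OF L] compose_extensional)
  qed
  then show ?thesis using B.subgroup_imp_group[of ?H] by (simp add: galois_group_def)
qed

lemma gal_inv_apply:
  assumes k: "k \<subseteq> L" and s: "\<sigma> \<in> carrier (galois_group L k)" and x: "x \<in> L"
  shows "(inv\<^bsub>galois_group L k\<^esub> \<sigma>) (\<sigma> x) = x" "\<sigma> ((inv\<^bsub>galois_group L k\<^esub> \<sigma>) x) = x"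
proof -
  interpret g: group "galois_group L k" by (rule group_galois_group[OF k])
  have "x = (inv\<^bsub>galois_group L k\<^esub> \<sigma> \<otimes>\<^bsub>galois_group L k\<^esub> \<sigma>) x" using s x by (simp add: gal_one)
  also have "\<dots> = (inv\<^bsub>galois_group L k\<^esub> \<sigma>) (\<sigma> x)" by (rule gal_mult_apply[OF g.inv_closed[OF s] s x])
  finally show "(inv\<^bsub>galois_group L k\<^esub> \<sigma>) (\<sigma> x) = x" by (rule sym)
  have "x = (\<sigma> \<otimes>\<^bsub>galois_group L k\<^esub> inv\<^bsub>galois_group L k\<^esub> \<sigma>) x" using s x by (simp add: gal_one)
  also have "\<dots> = \<sigma> ((inv\<^bsub>galois_group L k\<^esub> \<sigma>) x)" by (rule gal_mult_apply[OF s g.inv_closed[OF s] x])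
  finally show "\<sigma> ((inv\<^bsub>galois_group L k\<^esub> \<sigma>) x) = x" by (rule sym)
qed

end

lemma gal_mono:
  assumes L: "subfield L complex_field" and k: "k \<subseteq> k'"
  shows "carrier (galois_group L k') \<subseteq> carrier (galois_group L k)"
proof
  fix \<sigma> assume "\<sigma> \<in> carrier (galois_group L k')"
  then show "\<sigma> \<in> carrier (galois_group L k)" using k by (simp add: galois_group_iff[OF L]) blast
qed

lemma finite_dimension_algebraic:
  assumes "subfield K complex_field" "CF.finite_dimension \<rat> K" shows "K \<subseteq> Qbar"
proof
  fix x assume "x \<in> K"
  then have "((\<lambda>K x. \<not> ring.transcendental complex_field K x) over \<rat>) x"
    using CF.finite_dimension_imp_algebraic[OF subfield_Rats_complex subfieldE(1)[OF assms(1)] assms(2)] by simp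
  then show "x \<in> Qbar" by (simp add: algebraic_over_Rats_iff Qbar_def)
qed

lemma finite_dimension_subfield:
  assumes "subfield K complex_field" "CF.finite_dimension \<rat> K" "subfield k complex_field" "k \<subseteq> K"
  shows "CF.finite_dimension \<rat> k"
proof (rule CF.subalbegra_incl_imp_finite_dimension[OF subfield_Rats_complex assms(2) _ assms(4)])
  show "subalgebra \<rat> k complex_field"
    using subring.axioms(1)[OF subfieldE(1)[OF assms(3)]] subfield_Rats[OF assms(3)] subfield_mult[OF assms(3)]
    by (auto simp: subalgebra_def subalgebra_axioms_def)
qed

text \<open>A basis determines embeddings. This yields the finiteness of the Galois groups of finite extensions.\<close>

lemma finite_generating_set:
  assumes "CF.finite_dimension \<rat> K"
  obtains B where "finite B" "B \<subseteq> K"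
    "\<forall>F \<sigma> \<tau>. subfield F complex_field \<longrightarrow> K \<subseteq> F \<longrightarrow> field_emb F \<sigma> \<longrightarrow>
    field_emb F \<tau> \<longrightarrow> (\<forall>x\<in>B. \<sigma> x = \<tau> x) \<longrightarrow> (\<forall>x\<in>K. \<sigma> x = \<tau> x)"
proof -
  obtain n where "CF.dimension n \<rat> K" using assms by (rule CF.finite_dimensionE')
  then have "\<exists>B. finite B \<and> B \<subseteq> K \<and> (\<forall>F \<sigma> \<tau>. subfield F complex_field \<longrightarrow> K \<subseteq> F \<longrightarrow> field_emb F \<sigma> \<longrightarrow>
    field_emb F \<tau> \<longrightarrow> (\<forall>x\<in>B. \<sigma> x = \<tau> x) \<longrightarrow> (\<forall>x\<in>K. \<sigma> x = \<tau> x))"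
  proof (induction n "\<rat> :: complex set" K rule: CF.dimension.induct)
    case zero_dim
    show ?case by (rule exI[of _ "{}"]) (auto simp: emb_zero)
  next
    case (Suc_dim v E n)
    then obtain B where B: "finite B" "B \<subseteq> E" "\<And>F \<sigma> \<tau>. subfield F complex_field \<Longrightarrow> E \<subseteq> F \<Longrightarrow> field_emb F \<sigma> \<Longrightarrow>
        field_emb F \<tau> \<Longrightarrow> \<forall>x\<in>B. \<sigma> x = \<tau> x \<Longrightarrow> \<forall>x\<in>E. \<sigma> x = \<tau> x" by blast
    have mem: "u \<in> CF.line_extension \<rat> v E \<longleftrightarrow> (\<exists>c\<in>\<rat>. \<exists>w\<in>E. u = c * v + w)" for u
      using CF.line_extension_mem_iff[of u \<rat> v E] by simp
    have "0 \<in> E" using CF.space_subgroup_props(2)[OF subfield_Rats_complex Suc_dim(3)] by simp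
    have EL: "E \<subseteq> CF.line_extension \<rat> v E"
    proof
      fix w assume "w \<in> E"
      then have "w = 0 * v + w" "0 \<in> \<rat>" "w \<in> E" by auto
      then show "w \<in> CF.line_extension \<rat> v E" unfolding mem by blast
    qed
    have vL: "v \<in> CF.line_extension \<rat> v E"
    proof -
      have "v = 1 * v + 0" "1 \<in> \<rat>" by auto
      then show ?thesis unfolding mem using \<open>0 \<in> E\<close> by blast
    qed
    show ?case
    proof (intro exI[of _ "insert v B"] conjI allI impI ballI)
      show "finite (insert v B)" using B(1) by simp
      show "insert v B \<subseteq> CF.line_extension \<rat> v E" using B(2) EL vL by auto
      fix F \<sigma> \<tau> x
      assume F: "subfield F complex_field" "CF.line_extension \<rat> v E \<subseteq> F" "field_emb F \<sigma>" "field_emb F \<tau>"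
        "\<forall>x\<in>insert v B. \<sigma> x = \<tau> x" "x \<in> CF.line_extension \<rat> v E"
      obtain c w where cw: "c \<in> \<rat>" "w \<in> E" "x = c * v + w" using F(6) unfolding mem by blast
      have EF: "E \<subseteq> F" "v \<in> F" using EL vL F(2) by auto
      have "\<sigma> w = \<tau> w" using B(3)[OF F(1) EF(1) F(3,4)] F(5) cw(2) by auto
      moreover have cF: "c \<in> F" "w \<in> F" "c * v \<in> F"
        using subfield_Rats[OF F(1)] cw EF subfield_mult[OF F(1)] by auto
      ultimately show "\<sigma> x = \<tau> x"
        using F(5) cw EF by (simp add: emb_add[OF F(1,3)] emb_add[OF F(1,4)] emb_mult[OF F(1,3)] emb_mult[OF F(1,4)]
          emb_Rats[OF F(1,3)] emb_Rats[OF F(1,4)])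
    qed
  qed
  then show ?thesis by (elim exE conjE) (rule that)
qed

lemma finite_galois_group:
  assumes K: "subfield K complex_field" "CF.finite_dimension \<rat> K"
  shows "finite (carrier (galois_group K k))"
proof -
  obtain B where B: "finite B" "B \<subseteq> K"
    "\<forall>F \<sigma> \<tau>. subfield F complex_field \<longrightarrow> K \<subseteq> F \<longrightarrow> field_emb F \<sigma> \<longrightarrow>
    field_emb F \<tau> \<longrightarrow> (\<forall>x\<in>B. \<sigma> x = \<tau> x) \<longrightarrow> (\<forall>x\<in>K. \<sigma> x = \<tau> x)"
    by (rule finite_generating_set[OF K(2)]) (rule that)
  have "\<exists>S. finite S \<and> (\<forall>\<sigma>\<in>carrier (galois_group K k). \<sigma> x \<in> S)" if x: "x \<in> K" for x
  proof -
    have "algebraic x" using x finite_dimension_algebraic[OF K] by (auto simp: Qbar_def)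
    then obtain p where p: "\<And>i. coeff p i \<in> \<rat>" "p \<noteq> 0" "poly p x = 0" using algebraic_altdef by blast
    have "poly p (\<sigma> x) = 0" if s: "\<sigma> \<in> carrier (galois_group K k)" for \<sigma>
    proof -
      note E = gal_emb[OF K(1) s]
      have "poly p (\<sigma> x) = \<sigma> (poly p x)"
        using subfield_Rats[OF K(1)] p(1) by (intro emb_poly_fixed[OF K(1) E, symmetric] x emb_Rats[OF K(1) E]) auto
      then show ?thesis using p(3) emb_zero[OF K(1) E] by simp
    qed
    then show ?thesis using poly_roots_finite[OF p(2)] by (intro exI[of _ "{z. poly p z = 0}"]) auto
  qed
  then obtain S where S: "\<And>x. x \<in> K \<Longrightarrow> finite (S x)"
    "\<And>x \<sigma>. x \<in> K \<Longrightarrow> \<sigma> \<in> carrier (galois_group K k) \<Longrightarrow> \<sigma> x \<in> S x" by metis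
  have "(\<lambda>\<sigma>. restrict \<sigma> B) ` carrier (galois_group K k) \<subseteq> Pi\<^sub>E B S"
    using S(2) B(2) by (auto simp: PiE_iff)
  moreover have "finite (Pi\<^sub>E B S)" using B(1,2) S(1) by (intro finite_PiE) auto
  ultimately have "finite ((\<lambda>\<sigma>. restrict \<sigma> B) ` carrier (galois_group K k))" by (rule finite_subset)
  moreover have "inj_on (\<lambda>\<sigma>. restrict \<sigma> B) (carrier (galois_group K k))"
  proof (rule inj_onI)
    fix \<sigma> \<tau> assume st: "\<sigma> \<in> carrier (galois_group K k)" "\<tau> \<in> carrier (galois_group K k)"
      and eq: "restrict \<sigma> B = restrict \<tau> B"
    have "\<sigma> x = \<tau> x" if "x \<in> B" for x using fun_cong[OF eq, of x] that by simp
    then have "\<sigma> x = \<tau> x" if "x \<in> K" for x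
      using B(3)[rule_format, OF K(1) order.refl gal_emb[OF K(1) st(1)] gal_emb[OF K(1) st(2)] _ that] by blast
    then show "\<sigma> = \<tau>" by (rule gal_eqI[OF K(1) st])
  qed
  ultimately show ?thesis by (rule finite_imageD)
qed

lemma rel_poly_prod:
  assumes R: "hom_graph R" and fg: "\<And>a. a \<in> A \<Longrightarrow> rel_poly R (f a) (g a)"
  shows "rel_poly R (prod f A) (prod g A)"
  using fg
proof (induction A rule: infinite_finite_induct)
  case (insert a A)
  then show ?case by (simp add: rel_poly_mult[OF R])
qed (use rel_poly_const[OF R hom_graph_one[OF R]] in \<open>simp_all add: one_pCons\<close>)

text \<open>For a group \<open>H\<close> of automorphisms this is fixed by \<open>H\<close> and has the conjugates of \<open>x\<close> under \<open>H\<close> as roots.\<close>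

definition orbit_poly :: "(complex \<Rightarrow> complex) set \<Rightarrow> complex \<Rightarrow> complex poly" where
  "orbit_poly H x = (\<Prod>h\<in>H. [:- h x, 1:])"

lemma orbit_poly_root:
  assumes "finite H" shows "poly (orbit_poly H x) z = 0 \<longleftrightarrow> (\<exists>h\<in>H. z = h x)"
  using assms by (auto simp: orbit_poly_def poly_prod)

lemma orbit_poly_fixed:
  assumes L: "subfield L complex_field" and E: "field_emb L g" and HL: "\<And>h. h \<in> H \<Longrightarrow> h x \<in> L"
    and perm: "bij_betw \<pi> H H" "\<And>h. h \<in> H \<Longrightarrow> (\<pi> h) x = g (h x)"
  shows "coeff (orbit_poly H x) i \<in> L" "g (coeff (orbit_poly H x) i) = coeff (orbit_poly H x) i"
proof -
  note R = hom_graph_emb[OF L E]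
  have "rel_poly {(x, g x) |x. x \<in> L} (\<Prod>h\<in>H. [:- h x, 1:]) (\<Prod>h\<in>H. [:- g (h x), 1:])"
  proof (rule rel_poly_prod[OF R])
    fix h assume "h \<in> H"
    then have "(- h x, - g (h x)) \<in> {(x, g x) |x. x \<in> L}" using hom_graph_uminus[OF R] HL by blast
    then show "rel_poly {(x, g x) |x. x \<in> L} [:- h x, 1:] [:- g (h x), 1:]"
      using hom_graph_one[OF R] hom_graph_zero[OF R]
      by (auto simp only: rel_poly_def coeff_pCons coeff_0 split: nat.splits)
  qed
  moreover have "(\<Prod>h\<in>H. [:- g (h x), 1:]) = (\<Prod>h\<in>H. [:- (\<pi> h) x, 1:])"
    by (intro prod.cong) (simp_all add: perm(2))
  also have "\<dots> = orbit_poly H x" unfolding orbit_poly_def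
    by (rule prod.reindex_bij_betw[OF perm(1)])
  ultimately have "rel_poly {(x, g x) |x. x \<in> L} (orbit_poly H x) (orbit_poly H x)" by (simp add: orbit_poly_def)
  then have "(coeff (orbit_poly H x) i, coeff (orbit_poly H x) i) \<in> {(x, g x) |x. x \<in> L}" by (simp add: rel_poly_def)
  then show "coeff (orbit_poly H x) i \<in> L" "g (coeff (orbit_poly H x) i) = coeff (orbit_poly H x) i" by auto
qed

lemma subgroup_translation:
  assumes L: "subfield L complex_field" and k: "k \<subseteq> L" and H: "subgroup H (galois_group L k)" and g: "g \<in> H"
  shows "bij_betw (\<lambda>h. g \<otimes>\<^bsub>galois_group L k\<^esub> h) H H"
proof -
  interpret G: group "galois_group L k" by (rule group_galois_group[OF L k])
  interpret H: subgroup H "galois_group L k" by (rule H)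
  show ?thesis
    by (rule bij_betw_byWitness[where f' = "\<lambda>h. inv\<^bsub>galois_group L k\<^esub> g \<otimes>\<^bsub>galois_group L k\<^esub> h"])
      (use g in \<open>auto simp: G.m_assoc[symmetric]\<close>)
qed

lemma orbit_poly_coeff:
  assumes L: "subfield L complex_field" and k: "k \<subseteq> L" and H: "subgroup H (galois_group L k)" and x: "x \<in> L"
  shows "coeff (orbit_poly H x) i \<in> fixed_field L H"
proof -
  interpret H: subgroup H "galois_group L k" by (rule H)
  have main: "coeff (orbit_poly H x) i \<in> L \<and> g (coeff (orbit_poly H x) i) = coeff (orbit_poly H x) i" if g: "g \<in> H" for g
  proof -
    have E: "field_emb L g" by (rule gal_emb[OF L H.mem_carrier[OF g]])
    have hx: "h x \<in> L" if "h \<in> H" for h by (rule gal_closed[OF L H.mem_carrier[OF that] x])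
    have gh: "(g \<otimes>\<^bsub>galois_group L k\<^esub> h) x = g (h x)" if "h \<in> H" for h
      by (rule gal_mult_apply[OF L H.mem_carrier[OF g] H.mem_carrier[OF that] x])
    note tr = subgroup_translation[OF L k H g]
    show ?thesis
      by (rule conjI; rule orbit_poly_fixed[where \<pi> = "\<lambda>h. g \<otimes>\<^bsub>galois_group L k\<^esub> h", OF L E])
        (simp_all add: hx gh tr)
  qed
  then show ?thesis using main[OF H.one_closed] by (simp add: fixed_field_def)
qed

text \<open>The orbit polynomial of \<open>x\<close> under \<open>Gal(L/\<rat>)\<close> has rational coefficients, so \<open>\<sigma> x\<close> is one of its roots, all of
which lie in \<open>L\<close>.\<close>

lemma abelian_extension_normal:
  assumes L: "finite_abelian_extension L" and F: "subfield F complex_field" "L \<subseteq> F" and E: "field_emb F \<sigma>" and x: "x \<in> L"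
  shows "\<sigma> x \<in> L"
proof -
  have sL: "subfield L complex_field" and fd: "CF.finite_dimension \<rat> L"
    and ff: "fixed_field L (carrier (galois_group L \<rat>)) = \<rat>"
    using L by (auto simp: finite_abelian_extension_def)
  interpret G: group "galois_group L \<rat>" by (rule group_galois_group[OF sL subfield_Rats[OF sL]])
  define P where "P = orbit_poly (carrier (galois_group L \<rat>)) x"
  have coef: "coeff P i \<in> \<rat>" for i
    using orbit_poly_coeff[OF sL subfield_Rats[OF sL] G.subgroup_self x] ff by (simp add: P_def)
  note fin = finite_galois_group[OF sL fd, of \<rat>]
  have "\<one>\<^bsub>galois_group L \<rat>\<^esub> x = x" using x by (simp add: gal_one[OF sL])
  then have "poly P x = 0" using orbit_poly_root[OF fin, of x x] G.one_closed unfolding P_def by metis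
  moreover have "poly P (\<sigma> x) = \<sigma> (poly P x)"
    using coef subfield_Rats[OF F(1)] x F(2) by (intro emb_poly_fixed[OF F(1) E, symmetric] emb_Rats[OF F(1) E]) auto
  ultimately have "poly P (\<sigma> x) = 0" using emb_zero[OF F(1) E] by simp
  then obtain h where "h \<in> carrier (galois_group L \<rat>)" "\<sigma> x = h x"
    using orbit_poly_root[OF fin] unfolding P_def by blast
  then show ?thesis using gal_closed[OF sL _ x] by simp
qed

lemma Qab_subfield: "subfield Qab complex_field"
  unfolding Qab_def by (rule field.generate_field_is_subfield[OF field_complex_field]) simp

lemma abelian_extension_subset: "finite_abelian_extension L \<Longrightarrow> L \<subseteq> Qab"
  unfolding Qab_def by (auto intro: generate_field.incl)

lemma Qab_minimal:
  assumes S: "subfield S complex_field" and "\<And>L. finite_abelian_extension L \<Longrightarrow> L \<subseteq> S" shows "Qab \<subseteq> S"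
  unfolding Qab_def
  by (rule field.generate_field_min_subfield1[OF field_complex_field _ S]) (use assms(2) in auto)

lemma Qab_algebraic: "Qab \<subseteq> Qbar"
  by (rule Qab_minimal[OF Qbar_subfield])
    (auto simp: finite_abelian_extension_def dest: finite_dimension_algebraic)

text \<open>The elements that \<open>\<sigma>\<close> maps into \<^const>\<open>Qab\<close> form a subfield, which contains every finite abelian extension.\<close>

lemma Qab_normal:
  assumes F: "subfield F complex_field" "Qab \<subseteq> F" and E: "field_emb F \<sigma>" and x: "x \<in> Qab"
  shows "\<sigma> x \<in> Qab"
proof -
  have "subfield {x \<in> Qab. \<sigma> x \<in> Qab} complex_field"
    using F(2) by (intro subfield_complexI)
      (auto simp: emb_one[OF F(1) E] emb_add[OF F(1) E] emb_mult[OF F(1) E] emb_uminus[OF F(1) E] emb_inverse[OF F(1) E]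
         subsetD[OF F(2)] subfield_one[OF Qab_subfield] subfield_add[OF Qab_subfield] subfield_mult[OF Qab_subfield]
         subfield_uminus[OF Qab_subfield] subfield_inverse[OF Qab_subfield])
  moreover have "L \<subseteq> {x \<in> Qab. \<sigma> x \<in> Qab}" if L: "finite_abelian_extension L" for L
  proof
    fix y assume y: "y \<in> L"
    have LQ: "L \<subseteq> Qab" by (rule abelian_extension_subset[OF L])
    have "\<sigma> y \<in> L" by (rule abelian_extension_normal[OF L F(1) _ E y]) (use LQ F(2) in auto)
    then show "y \<in> {x \<in> Qab. \<sigma> x \<in> Qab}" using LQ y by auto
  qed
  ultimately have "Qab \<subseteq> {x \<in> Qab. \<sigma> x \<in> Qab}" by (rule Qab_minimal)
  then show ?thesis using x by auto
qed

lemma restrict_gal: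
  assumes L: "subfield L complex_field" and F: "subfield F complex_field" "F \<subseteq> Qbar" "F \<subseteq> L"
    and s: "\<sigma> \<in> carrier (galois_group L k)" and into: "\<And>x. x \<in> F \<Longrightarrow> \<sigma> x \<in> F" and k: "k \<subseteq> F"
  shows "restrict \<sigma> F \<in> carrier (galois_group F k)"
proof -
  have E: "field_emb F (restrict \<sigma> F)" using gal_emb[OF L s] F(3)
    by (auto simp: field_emb_def subfield_one[OF F(1)] subfield_add[OF F(1)] subfield_mult[OF F(1)])
  have "bij_betw (restrict \<sigma> F) F F" by (rule emb_bij[OF F(1) E F(2)]) (use into in auto)
  then show ?thesis using E gal_fix[OF L s] k by (auto simp: galois_group_iff[OF F(1)])
qed

lemma restriction_hom:
  assumes L: "subfield L complex_field" and k: "subfield k complex_field" "k \<subseteq> L" "k \<subseteq> Qbar"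
    and stable: "\<forall>g\<in>carrier (galois_group L \<rat>). \<forall>x\<in>k. g x \<in> k"
  shows "group_hom (galois_group L \<rat>) (galois_group k \<rat>) (\<lambda>g. restrict g k)"
    and "\<And>g. g \<in> carrier (galois_group L \<rat>)
      \<Longrightarrow> restrict g k = \<one>\<^bsub>galois_group k \<rat>\<^esub> \<longleftrightarrow> g \<in> carrier (galois_group L k)"
proof -
  have into: "g x \<in> k" if "g \<in> carrier (galois_group L \<rat>)" "x \<in> k" for g x
    using stable that by blast
  interpret G: group "galois_group L \<rat>" by (rule group_galois_group[OF L subfield_Rats[OF L]])
  interpret kg: group "galois_group k \<rat>" by (rule group_galois_group[OF k(1) subfield_Rats[OF k(1)]])
  have r: "restrict g k \<in> carrier (galois_group k \<rat>)" if "g \<in> carrier (galois_group L \<rat>)" for g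
    by (rule restrict_gal[OF L k(1,3,2) that into[OF that] subfield_Rats[OF k(1)]])
  show "group_hom (galois_group L \<rat>) (galois_group k \<rat>) (\<lambda>g. restrict g k)"
  proof (intro group_hom.intro group_hom_axioms.intro G.is_group kg.is_group homI r)
    fix g h assume g: "g \<in> carrier (galois_group L \<rat>)" and h: "h \<in> carrier (galois_group L \<rat>)"
    show "restrict (g \<otimes>\<^bsub>galois_group L \<rat>\<^esub> h) k = restrict g k \<otimes>\<^bsub>galois_group k \<rat>\<^esub> restrict h k"
    proof (rule gal_eqI[OF k(1) r[OF G.m_closed[OF g h]] kg.m_closed[OF r[OF g] r[OF h]]])
      fix x assume x: "x \<in> k"
      then have xL: "x \<in> L" using k(2) by auto
      show "restrict (g \<otimes>\<^bsub>galois_group L \<rat>\<^esub> h) k x = (restrict g k \<otimes>\<^bsub>galois_group k \<rat>\<^esub> restrict h k) x"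
        using gal_mult_apply[OF k(1) r[OF g] r[OF h] x] gal_mult_apply[OF L g h xL] into[OF h x] x by simp
    qed
  qed
  fix g assume g: "g \<in> carrier (galois_group L \<rat>)"
  show "restrict g k = \<one>\<^bsub>galois_group k \<rat>\<^esub> \<longleftrightarrow> g \<in> carrier (galois_group L k)"
  proof
    assume e: "restrict g k = \<one>\<^bsub>galois_group k \<rat>\<^esub>"
    have "g x = x" if "x \<in> k" for x using that fun_cong[OF e, of x] by (simp add: gal_one[OF k(1)])
    then show "g \<in> carrier (galois_group L k)" using g by (simp add: galois_group_iff[OF L])
  next
    assume "g \<in> carrier (galois_group L k)"
    then have "g x = x" if "x \<in> k" for x by (rule gal_fix[OF L _ that])
    then show "restrict g k = \<one>\<^bsub>galois_group k \<rat>\<^esub>" unfolding gal_one[OF k(1)] by (rule restrict_ext)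
  qed
qed

text \<open>The elements on which \<open>\<sigma>\<close> and \<open>\<tau>\<close> commute form a subfield, and this contains every finite abelian extension,
because \<open>\<sigma>\<close> and \<open>\<tau>\<close> restrict to its Galois group.\<close>

lemma Gab_commute:
  assumes s: "\<sigma> \<in> carrier Gab" and t: "\<tau> \<in> carrier Gab" and x: "x \<in> Qab"
  shows "\<sigma> (\<tau> x) = \<tau> (\<sigma> x)"
proof -
  note Q = Qab_subfield
  note E = gal_emb[OF Q s] gal_emb[OF Q t]
  note c = gal_closed[OF Q s] gal_closed[OF Q t]
  have "subfield {x \<in> Qab. \<sigma> (\<tau> x) = \<tau> (\<sigma> x)} complex_field"
    by (intro subfield_complexI)
      (auto simp: c emb_one[OF Q E(1)] emb_one[OF Q E(2)] emb_add[OF Q E(1)] emb_add[OF Q E(2)] emb_mult[OF Q E(1)] emb_mult[OF Q E(2)]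
        emb_uminus[OF Q E(1)] emb_uminus[OF Q E(2)] emb_inverse[OF Q E(1)] emb_inverse[OF Q E(2)]
        subfield_one[OF Q] subfield_add[OF Q] subfield_mult[OF Q] subfield_uminus[OF Q] subfield_inverse[OF Q])
  moreover have "L \<subseteq> {x \<in> Qab. \<sigma> (\<tau> x) = \<tau> (\<sigma> x)}" if L: "finite_abelian_extension L" for L
  proof
    fix y assume y: "y \<in> L"
    have LQ: "L \<subseteq> Qab" by (rule abelian_extension_subset[OF L])
    have sL: "subfield L complex_field" and cg: "comm_group (galois_group L \<rat>)"
      using L by (auto simp: finite_abelian_extension_def)
    interpret C: comm_group "galois_group L \<rat>" by (rule cg)
    have r: "restrict \<rho> L \<in> carrier (galois_group L \<rat>)" "\<rho> z \<in> L" if "\<rho> \<in> carrier Gab" "z \<in> L" for \<rho> z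
    proof -
      have i: "\<rho> z \<in> L" if "z \<in> L" for z
        by (rule abelian_extension_normal[OF L Q LQ gal_emb[OF Q \<open>\<rho> \<in> carrier Gab\<close>] that])
      show "restrict \<rho> L \<in> carrier (galois_group L \<rat>)"
        using LQ Qab_algebraic by (intro restrict_gal[OF Q sL _ LQ that(1) i subfield_Rats[OF sL]]) auto
      show "\<rho> z \<in> L" by (rule i[OF that(2)])
    qed
    have "(restrict \<sigma> L \<otimes>\<^bsub>galois_group L \<rat>\<^esub> restrict \<tau> L) y = (restrict \<tau> L \<otimes>\<^bsub>galois_group L \<rat>\<^esub> restrict \<sigma> L) y"
      using C.m_comm[OF r(1)[OF s y] r(1)[OF t y]] by simp
    then have "\<sigma> (\<tau> y) = \<tau> (\<sigma> y)"
      using gal_mult_apply[OF sL r(1)[OF s y] r(1)[OF t y] y] gal_mult_apply[OF sL r(1)[OF t y] r(1)[OF s y] y]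
        r(2)[OF s y] r(2)[OF t y] y by simp
    then show "y \<in> {x \<in> Qab. \<sigma> (\<tau> x) = \<tau> (\<sigma> x)}" using LQ y by auto
  qed
  ultimately have "Qab \<subseteq> {x \<in> Qab. \<sigma> (\<tau> x) = \<tau> (\<sigma> x)}" by (rule Qab_minimal)
  then show ?thesis using x by auto
qed

lemma restrict_to_Qab:
  assumes "\<tau> \<in> carrier (galois_group Qbar k)" "k \<subseteq> Qab" shows "restrict \<tau> Qab \<in> carrier (galois_group Qab k)"
  by (rule restrict_gal[OF Qbar_subfield Qab_subfield Qab_algebraic Qab_algebraic assms(1)
    Qab_normal[OF Qbar_subfield Qab_algebraic gal_emb[OF Qbar_subfield assms(1)]] assms(2)])

text \<open>If \<open>x\<close> is not in \<open>k\<close>, then an automorphism of the algebraic numbers over \<open>k\<close> moves \<open>x\<close> to another conjugate.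
It restricts to \<^const>\<open>Qab\<close>.\<close>

lemma Qab_fixed:
  assumes k: "subfield k complex_field" "k \<subseteq> Qab" and x: "x \<in> Qab"
    and fixed: "\<And>\<sigma>. \<sigma> \<in> carrier (galois_group Qab k) \<Longrightarrow> \<sigma> x = x"
  shows "x \<in> k"
proof (rule ccontr)
  assume nx: "x \<notin> k"
  have xb: "x \<in> Qbar" and kb: "k \<subseteq> Qbar" using x k(2) Qab_algebraic by auto
  obtain y where y: "y \<noteq> x" "\<forall>p. (\<forall>i. coeff p i \<in> k) \<longrightarrow> poly p x = 0 \<longrightarrow> poly p y = 0"
    by (rule other_conjugate[OF k(1) xb nx]) (rule that)
  obtain \<tau> where t: "\<tau> \<in> carrier (galois_group Qbar k)" "\<tau> x = y"
    by (rule extend_to_conjugate[OF k(1) kb xb y(2)]) (rule that)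
  show False using fixed[OF restrict_to_Qab[OF t(1) k(2)]] t(2) y(1) x by simp
qed

lemma gal_lift:
  assumes K: "subfield K complex_field" "K \<subseteq> Qab" and k: "k \<subseteq> K" and t: "\<tau> \<in> carrier (galois_group K k)"
  obtains \<sigma> where "\<sigma> \<in> carrier (galois_group Qab k)" "\<sigma> \<in> carrier Gab" "restrict \<sigma> K = \<tau>"
proof -
  have Kb: "K \<subseteq> Qbar" using K(2) Qab_algebraic by auto
  note E = gal_emb[OF K(1) t]
  have D: "Domain {(x, \<tau> x) |x. x \<in> K} \<subseteq> Qbar" using Kb by auto
  obtain \<rho> where r: "\<rho> \<in> carrier (galois_group Qbar \<rat>)" "\<And>x y. (x, y) \<in> {(x, \<tau> x) |x. x \<in> K} \<Longrightarrow> \<rho> x = y"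
    by (rule extend_emb[OF hom_graph_emb[OF K(1) E] D]) (rule that)
  have rK: "\<rho> x = \<tau> x" if "x \<in> K" for x by (rule r(2)) (use that in auto)
  have "\<rho> \<in> carrier (galois_group Qbar k)" using r(1) rK gal_fix[OF K(1) t] k
    by (auto simp: galois_group_iff[OF Qbar_subfield])
  then have k': "restrict \<rho> Qab \<in> carrier (galois_group Qab k)" by (rule restrict_to_Qab) (use k K in auto)
  have "restrict \<rho> Qab \<in> carrier Gab" by (rule restrict_to_Qab[OF r(1) subfield_Rats[OF Qab_subfield]])
  moreover have "restrict (restrict \<rho> Qab) K = \<tau>"
  proof (rule extensionalityI[OF restrict_extensional gal_ext[OF K(1) t]])
    fix x assume "x \<in> K"
    then show "restrict (restrict \<rho> Qab) K x = \<tau> x" using rK K(2) by auto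
  qed
  ultimately show ?thesis using that k' by blast
qed

text \<open>Every subfield of an abelian extension is normal: an automorphism that fixes \<open>K\<close> commutes with \<open>\<sigma>\<close>, so it fixes
\<open>\<sigma> x\<close> for \<open>x \<in> K\<close>.\<close>

lemma Gab_into:
  assumes K: "subfield K complex_field" "K \<subseteq> Qab" and s: "\<sigma> \<in> carrier Gab" and x: "x \<in> K"
  shows "\<sigma> x \<in> K"
proof (rule Qab_fixed[OF K])
  show "\<sigma> x \<in> Qab" using gal_closed[OF Qab_subfield s] x K(2) by auto
  fix \<rho> assume r: "\<rho> \<in> carrier (galois_group Qab K)"
  then have "\<rho> \<in> carrier Gab" using gal_mono[OF Qab_subfield subfield_Rats[OF K(1)]] by auto
  then show "\<rho> (\<sigma> x) = \<sigma> x" using Gab_commute[OF _ s, of \<rho> x] x K(2) gal_fix[OF Qab_subfield r x] by auto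
qed

lemma restrict_Gab:
  assumes K: "subfield K complex_field" "K \<subseteq> Qab" and s: "\<sigma> \<in> carrier Gab"
  shows "restrict \<sigma> K \<in> carrier (galois_group K \<rat>)"
  using K(2) Qab_algebraic
  by (intro restrict_gal[OF Qab_subfield K(1) _ K(2) s Gab_into[OF K s] subfield_Rats[OF K(1)]]) auto

lemma restrict_Gab_fix:
  assumes K: "subfield K complex_field" "K \<subseteq> Qab" and s: "\<sigma> \<in> carrier Gab" and k: "\<And>x. x \<in> k \<Longrightarrow> \<sigma> x = x" "k \<subseteq> K"
  shows "restrict \<sigma> K \<in> carrier (galois_group K k)"
  using restrict_Gab[OF K s] k by (auto simp: galois_group_iff[OF K(1)])

lemma fixed_field_gal:
  assumes K: "subfield K complex_field" "K \<subseteq> Qab" and k: "subfield k complex_field" "k \<subseteq> K"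
  shows "fixed_field K (carrier (galois_group K k)) = k"
proof
  show "k \<subseteq> fixed_field K (carrier (galois_group K k))"
    using k gal_fix[OF K(1)] by (auto simp: fixed_field_def)
  show "fixed_field K (carrier (galois_group K k)) \<subseteq> k"
  proof
    fix x assume x: "x \<in> fixed_field K (carrier (galois_group K k))"
    then have xK: "x \<in> K" by (simp add: fixed_field_def)
    have kQ: "k \<subseteq> Qab" using k K by auto
    show "x \<in> k"
    proof (rule Qab_fixed[OF k(1) kQ])
      show "x \<in> Qab" using xK K(2) by auto
      fix \<sigma> assume s: "\<sigma> \<in> carrier (galois_group Qab k)"
      have sG: "\<sigma> \<in> carrier Gab" using s gal_mono[OF Qab_subfield subfield_Rats[OF k(1)]] by auto
      have "restrict \<sigma> K \<in> carrier (galois_group K k)"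
        by (rule restrict_Gab_fix[OF K sG gal_fix[OF Qab_subfield s] k(2)])
      then show "\<sigma> x = x" using x xK by (auto simp: fixed_field_def)
    qed
  qed
qed

lemma subfield_fixed_field:
  assumes L: "subfield L complex_field" and H: "H \<subseteq> carrier (galois_group L k)"
  shows "subfield (fixed_field L H) complex_field"
proof (rule subfield_complexI)
  have E: "field_emb L h" if "h \<in> H" for h using gal_emb[OF L, of h k] that H by auto
  show "1 \<in> fixed_field L H" by (simp add: fixed_field_def emb_one[OF L E] subfield_one[OF L])
  fix x assume x: "x \<in> fixed_field L H"
  then show "- x \<in> fixed_field L H" "inverse x \<in> fixed_field L H"
    by (simp_all add: fixed_field_def emb_uminus[OF L E] emb_inverse[OF L E] subfield_uminus[OF L] subfield_inverse[OF L])
  fix y assume y: "y \<in> fixed_field L H"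
  show "x + y \<in> fixed_field L H" "x * y \<in> fixed_field L H"
    using x y by (auto simp: fixed_field_def emb_add[OF L E] emb_mult[OF L E] subfield_add[OF L] subfield_mult[OF L])
qed

text \<open>A rational vector space is not a finite union of proper subspaces. If \<open>v\<close> lies in \<open>V t\<close> and in no other
member, then for any \<open>u\<close> two of the vectors \<open>u + n v\<close> lie in the same member. It contains \<open>v\<close>, so it is \<open>V t\<close>,
and \<open>u\<close> lies in \<open>V t\<close>. Divisibility by positive integers replaces the scalar multiplication.\<close>

lemma vector_space_not_finite_union:
  assumes "finite T" and W: "(0::complex) \<in> W" "\<And>x y. x \<in> W \<Longrightarrow> y \<in> W \<Longrightarrow> x + y \<in> W"
      "\<And>x (n::nat). x \<in> W \<Longrightarrow> x / of_nat n \<in> W \<and> of_nat n * x \<in> W"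
    and V: "\<And>t. t \<in> T \<Longrightarrow> V t \<subseteq> W" "\<And>t x y. t \<in> T \<Longrightarrow> x \<in> V t \<Longrightarrow> y \<in> V t \<Longrightarrow> x - y \<in> V t"
      "\<And>t x (n::nat). t \<in> T \<Longrightarrow> x \<in> V t \<Longrightarrow> x / of_nat n \<in> V t \<and> of_nat n * x \<in> V t"
    and cover: "W \<subseteq> (\<Union>t\<in>T. V t)"
  shows "\<exists>t\<in>T. W \<subseteq> V t"
  using assms(1) V cover
proof (induction T)
  case empty
  then show ?case using W(1) by auto
next
  case (insert t T)
  show ?case
  proof (cases "W \<subseteq> (\<Union>t\<in>T. V t)")
    case True
    have "\<exists>t\<in>T. W \<subseteq> V t"
      by (rule insert.IH[OF _ _ _ True]) (use insert.prems in blast)+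
    then show ?thesis by blast
  next
    case False
    then obtain v where v: "v \<in> W" "\<And>s. s \<in> T \<Longrightarrow> v \<notin> V s" by blast
    then have vt: "v \<in> V t" using insert.prems(4) by blast
    have "W \<subseteq> V t"
    proof
      fix u assume u: "u \<in> W"
      define f where "f n = u + of_nat n * v" for n :: nat
      have "f n \<in> (\<Union>t\<in>insert t T. V t)" for n
        using insert.prems(4) W(2)[OF u] W(3)[OF v(1)] unfolding f_def by blast
      then have "\<forall>n. \<exists>r. r \<in> insert t T \<and> f n \<in> V r" by blast
      from choice[OF this] obtain s where "\<forall>n. s n \<in> insert t T \<and> f n \<in> V (s n)" by blast
      then have s: "s n \<in> insert t T" "f n \<in> V (s n)" for n by simp_all
      have "\<not> inj s"
      proof
        assume "inj s"
        moreover have "s ` UNIV \<subseteq> insert t T" using s(1) by blast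
        ultimately have "finite (UNIV :: nat set)"
          using inj_on_finite[of s UNIV "insert t T"] insert.hyps(1) by blast
        then show False by simp
      qed
      then obtain i j where ij: "i < j" "s i = s j" unfolding inj_on_def by (metis linorder_neqE_nat)
      have "f j \<in> V (s i)" using s(2)[of j] ij(2) by simp
      then have "f j - f i \<in> V (s i)" by (rule insert.prems(2)[OF s(1) _ s(2)])
      moreover have "f j - f i = of_nat (j - i) * v" using ij(1) by (simp add: f_def of_nat_diff algebra_simps)
      ultimately have "of_nat (j - i) * v / of_nat (j - i) \<in> V (s i)"
        using insert.prems(3)[OF s(1)[of i], of "of_nat (j - i) * v" "j - i"] by simp
      then have "v \<in> V (s i)" using ij(1) by simp
      then have si: "s i = t" using v(2)[of "s i"] s(1)[of i] by blast
      have "of_nat i * v \<in> V t" using insert.prems(3)[of t v i] vt by simp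
      then have "f i - of_nat i * v \<in> V t" using insert.prems(2)[of t "f i"] s(2)[of i] si by simp
      then show "u \<in> V t" by (simp add: f_def)
    qed
    then show ?thesis by blast
  qed
qed

text \<open>For \<open>\<sigma>\<close> trivial on the fixed field, \<open>\<sigma> x\<close> is a root of the orbit polynomial of \<open>x\<close>, so it is \<open>h x\<close> for some
\<open>h \<in> H\<close>. Thus \<open>L\<close> is the union over \<open>h \<in> H\<close> of the rational subspaces on which \<open>\<sigma>\<close> and \<open>h\<close> agree, and one of
them is all of \<open>L\<close>. This argument avoids primitive elements and dimensions.\<close>

theorem artin:
  assumes L: "subfield L complex_field" "CF.finite_dimension \<rat> L" and H: "subgroup H (galois_group L \<rat>)"
  shows "carrier (galois_group L (fixed_field L H)) = H"
proof
  interpret H: subgroup H "galois_group L \<rat>" by (rule H)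
  note k = subfield_Rats[OF L(1)]
  show "H \<subseteq> carrier (galois_group L (fixed_field L H))"
  proof
    fix h assume h: "h \<in> H"
    then have "h \<in> carrier (galois_group L \<rat>)" by simp
    then show "h \<in> carrier (galois_group L (fixed_field L H))" using h
      by (auto simp: galois_group_iff[OF L(1)] fixed_field_def)
  qed
  show "carrier (galois_group L (fixed_field L H)) \<subseteq> H"
  proof
    fix \<sigma> assume s: "\<sigma> \<in> carrier (galois_group L (fixed_field L H))"
    note E = gal_emb[OF L(1) s]
    have EH: "field_emb L h" if "h \<in> H" for h by (rule gal_emb[OF L(1) H.mem_carrier[OF that]])
    have finH: "finite H" by (rule finite_subset[OF H.subset finite_galois_group[OF L]])
    define V where "V h = {x \<in> L. \<sigma> x = h x}" for h
    have "L \<subseteq> (\<Union>h\<in>H. V h)"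
    proof
      fix x assume x: "x \<in> L"
      have c: "coeff (orbit_poly H x) i \<in> fixed_field L H" for i by (rule orbit_poly_coeff[OF L(1) k H x])
      have "poly (orbit_poly H x) (\<sigma> x) = \<sigma> (poly (orbit_poly H x) x)"
        using c gal_fix[OF L(1) s] by (intro emb_poly_fixed[OF L(1) E x, symmetric]) (auto simp: fixed_field_def)
      moreover have "poly (orbit_poly H x) x = 0"
        unfolding orbit_poly_root[OF finH] using H.one_closed x by (intro bexI[of _ "\<one>\<^bsub>galois_group L \<rat>\<^esub>"]) (simp_all add: gal_one[OF L(1)])
      ultimately have "poly (orbit_poly H x) (\<sigma> x) = 0" using emb_zero[OF L(1) E] by simp
      then show "x \<in> (\<Union>h\<in>H. V h)" using x unfolding orbit_poly_root[OF finH] by (auto simp: V_def)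
    qed
    moreover have "x - y \<in> V h" if "h \<in> H" "x \<in> V h" "y \<in> V h" for h x y
      using that by (simp add: V_def subfield_diff[OF L(1)] emb_diff[OF L(1) E] emb_diff[OF L(1) EH])
    moreover have nL: "x / of_nat n \<in> L \<and> of_nat n * x \<in> L" if "x \<in> L" for x and n :: nat
      using that by (simp add: subfield_divide[OF L(1)] subfield_mult[OF L(1)] subfield_of_nat[OF L(1)])
    moreover have "x / of_nat n \<in> V h \<and> of_nat n * x \<in> V h" if h: "h \<in> H" and x: "x \<in> V h" for h x and n :: nat
    proof -
      have xL: "x \<in> L" "\<sigma> x = h x" using x by (auto simp: V_def)
      note nn = subfield_of_nat[OF L(1), of n]
      have "\<sigma> (inverse (of_nat n)) = h (inverse (of_nat n))"
        by (simp add: emb_inverse[OF L(1) E nn] emb_inverse[OF L(1) EH[OF h] nn] emb_of_nat[OF L(1) E] emb_of_nat[OF L(1) EH[OF h]])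
      then have "\<sigma> (x / of_nat n) = h (x / of_nat n)" unfolding divide_inverse
        using emb_mult[OF L(1) E xL(1) subfield_inverse[OF L(1) nn]] emb_mult[OF L(1) EH[OF h] xL(1) subfield_inverse[OF L(1) nn]] xL(2)
        by simp
      moreover have "\<sigma> (of_nat n * x) = h (of_nat n * x)"
        using emb_mult[OF L(1) E nn xL(1)] emb_mult[OF L(1) EH[OF h] nn xL(1)] xL(2)
        by (simp add: emb_of_nat[OF L(1) E] emb_of_nat[OF L(1) EH[OF h]])
      ultimately show ?thesis using nL[OF xL(1), of n] by (simp add: V_def)
    qed
    ultimately have "\<exists>h\<in>H. L \<subseteq> V h"
      using finH by (intro vector_space_not_finite_union[OF finH subfield_zero[OF L(1)] subfield_add[OF L(1)]])
        (auto simp: V_def)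
    then obtain h where h: "h \<in> H" "L \<subseteq> V h" by blast
    have "\<sigma> = h" by (rule gal_eqI[OF L(1) s H.mem_carrier[OF h(1)]]) (use h(2) in \<open>auto simp: V_def\<close>)
    then show "\<sigma> \<in> H" using h(1) by simp
  qed
qed

lemma abelian_fieldsD:
  assumes "K \<in> abelian_fields"
  shows "subfield K complex_field" "K \<subseteq> Qab" "CF.finite_dimension \<rat> K"
  using assms by (auto simp: abelian_fields_def)

lemma abelian_fields_sub:
  assumes "K \<in> abelian_fields" "subfield k complex_field" "k \<subseteq> K" shows "k \<in> abelian_fields"
  using assms finite_dimension_subfield[of K k] by (auto simp: abelian_fields_def)

lemma comm_group_gal:
  assumes K: "subfield K complex_field" "K \<subseteq> Qab"
  shows "comm_group (galois_group K \<rat>)"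
proof -
  interpret G: group "galois_group K \<rat>" by (rule group_galois_group[OF K(1) subfield_Rats[OF K(1)]])
  show ?thesis
  proof (rule G.group_comm_groupI)
    fix \<sigma> \<tau> assume s: "\<sigma> \<in> carrier (galois_group K \<rat>)" and t: "\<tau> \<in> carrier (galois_group K \<rat>)"
    obtain \<sigma>' where s': "\<sigma>' \<in> carrier Gab" "restrict \<sigma>' K = \<sigma>"
      by (rule gal_lift[OF K subfield_Rats[OF K(1)] s]) (rule that)
    obtain \<tau>' where t': "\<tau>' \<in> carrier Gab" "restrict \<tau>' K = \<tau>"
      by (rule gal_lift[OF K subfield_Rats[OF K(1)] t]) (rule that)
    show "\<sigma> \<otimes>\<^bsub>galois_group K \<rat>\<^esub> \<tau> = \<tau> \<otimes>\<^bsub>galois_group K \<rat>\<^esub> \<sigma>"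
    proof (rule gal_eqI[OF K(1) G.m_closed[OF s t] G.m_closed[OF t s]])
      fix x assume x: "x \<in> K"
      have "\<sigma>' x = \<sigma> x" "\<tau>' x = \<tau> x" using fun_cong[OF s'(2), of x] fun_cong[OF t'(2), of x] x by auto
      moreover have "\<sigma>' (\<tau> x) = \<sigma> (\<tau> x)" "\<tau>' (\<sigma> x) = \<tau> (\<sigma> x)"
        using fun_cong[OF s'(2), of "\<tau> x"] fun_cong[OF t'(2), of "\<sigma> x"] gal_closed[OF K(1) t x] gal_closed[OF K(1) s x] by auto
      ultimately show "(\<sigma> \<otimes>\<^bsub>galois_group K \<rat>\<^esub> \<tau>) x = (\<tau> \<otimes>\<^bsub>galois_group K \<rat>\<^esub> \<sigma>) x"
        using Gab_commute[OF s'(1) t'(1), of x] K(2) x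
        by (simp add: gal_mult_apply[OF K(1) s t x] gal_mult_apply[OF K(1) t s x]) (metis subsetD)
    qed
  qed
qed

lemma galois_lift:
  assumes K: "subfield K complex_field" "K \<subseteq> Qab" and t: "\<tau> \<in> carrier (galois_group K k)" and k: "k \<subseteq> K"
  shows "galois_lift K \<tau> \<in> carrier Gab" "\<And>x. x \<in> K \<Longrightarrow> galois_lift K \<tau> x = \<tau> x"
proof -
  obtain \<sigma> where s: "\<sigma> \<in> carrier Gab" "restrict \<sigma> K = \<tau>"
    by (rule gal_lift[OF K k t]) (rule that)
  have *: "galois_lift K \<tau> \<in> carrier Gab \<and> restrict (galois_lift K \<tau>) K = \<tau>"
    unfolding galois_lift_def by (rule someI[of _ \<sigma>]) (use s in simp)
  then show "galois_lift K \<tau> \<in> carrier Gab" by simp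
  fix x assume "x \<in> K"
  then show "galois_lift K \<tau> x = \<tau> x" using fun_cong[OF conjunct2[OF *], of x] by simp
qed

section \<open>Subfields of an abelian number field\<close>

locale abelian_field =
  fixes K :: "complex set"
  assumes K: "K \<in> abelian_fields"
begin

lemmas Kf = abelian_fieldsD[OF K]

abbreviation G :: "(complex \<Rightarrow> complex) monoid" where "G \<equiv> galois_group K \<rat>"

lemma Qsub: "\<rat> \<subseteq> K" by (rule subfield_Rats[OF Kf(1)])

sublocale G: comm_group G by (rule comm_group_gal[OF Kf(1,2)])

lemma fin_G: "finite (carrier G)" by (rule finite_galois_group[OF Kf(1,3)])

abbreviation fld :: "(complex \<Rightarrow> complex) set \<Rightarrow> complex set" where "fld H \<equiv> fixed_field K H"

lemma fld_sub: "fld H \<subseteq> K" by (auto simp: fixed_field_def)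

lemma fld_subfield: "subgroup H G \<Longrightarrow> subfield (fld H) complex_field"
  by (rule subfield_fixed_field[OF Kf(1) subgroup.subset])

lemma fld_abelian: "subgroup H G \<Longrightarrow> fld H \<in> abelian_fields"
  by (rule abelian_fields_sub[OF K fld_subfield fld_sub])

lemma fld_antimono: "H \<subseteq> H' \<Longrightarrow> fld H' \<subseteq> fld H" by (auto simp: fixed_field_def)

lemma gal_fld: "subgroup H G \<Longrightarrow> carrier (galois_group K (fld H)) = H"
  by (rule artin[OF Kf(1,3)])

lemma subgroup_gal:
  assumes k: "subfield k complex_field" "k \<subseteq> K"
  shows "subgroup (carrier (galois_group K k)) G"
proof (rule G.subgroupI)
  interpret g: group "galois_group K k" by (rule group_galois_group[OF Kf(1) k(2)])
  show s: "carrier (galois_group K k) \<subseteq> carrier G" by (rule gal_mono[OF Kf(1) subfield_Rats[OF k(1)]])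
  show "carrier (galois_group K k) \<noteq> {}" using g.one_closed by blast
  fix a assume a: "a \<in> carrier (galois_group K k)"
  then have aG: "a \<in> carrier G" using s by auto
  have "(inv\<^bsub>G\<^esub> a) x = x" if "x \<in> k" for x
    using gal_inv_apply(1)[OF Kf(1) Qsub aG, of x] gal_fix[OF Kf(1) a that] that k(2) by auto
  then show "inv\<^bsub>G\<^esub> a \<in> carrier (galois_group K k)"
    using G.inv_closed[OF aG] by (simp add: galois_group_iff[OF Kf(1)])
  fix b assume b: "b \<in> carrier (galois_group K k)"
  then have bG: "b \<in> carrier G" using s by auto
  have "(a \<otimes>\<^bsub>G\<^esub> b) x = x" if "x \<in> k" for x
    using gal_mult_apply[OF Kf(1) aG bG, of x] gal_fix[OF Kf(1) a that] gal_fix[OF Kf(1) b that] that k(2) by auto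
  then show "a \<otimes>\<^bsub>G\<^esub> b \<in> carrier (galois_group K k)"
    using G.m_closed[OF aG bG] by (simp add: galois_group_iff[OF Kf(1)])
qed

lemma fld_gal: "subfield k complex_field \<Longrightarrow> k \<subseteq> K \<Longrightarrow> fld (carrier (galois_group K k)) = k"
  by (rule fixed_field_gal[OF Kf(1,2)])

lemma fld_trivial: "fld {\<one>\<^bsub>G\<^esub>} = K"
  by (auto simp: fixed_field_def gal_one[OF Kf(1)])

lemma fld_inj: "inj_on fld {H. subgroup H G}"
  by (rule inj_on_inverseI[of _ "\<lambda>k. carrier (galois_group K k)"]) (simp add: gal_fld)

lemma fld_image: "fld ` {H. subgroup H G} = {k. subfield k complex_field \<and> k \<subseteq> K}"
proof
  show "fld ` {H. subgroup H G} \<subseteq> {k. subfield k complex_field \<and> k \<subseteq> K}"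
    using fld_sub fld_subfield by auto
  show "{k. subfield k complex_field \<and> k \<subseteq> K} \<subseteq> fld ` {H. subgroup H G}"
  proof clarify
    fix k assume k: "subfield k complex_field" "k \<subseteq> K"
    show "k \<in> fld ` {H. subgroup H G}"
      using fld_gal[OF k] subgroup_gal[OF k] by (intro image_eqI[of _ _ "carrier (galois_group K k)"]) simp_all
  qed
qed

lemma finite_subfields: "finite {k. subfield k complex_field \<and> k \<subseteq> K}"
proof -
  have "{H. subgroup H G} \<subseteq> Pow (carrier G)"
  proof
    fix H assume "H \<in> {H. subgroup H G}"
    then have "subgroup H G" by simp
    from subgroup.subset[OF this] show "H \<in> Pow (carrier G)" by simp
  qed
  moreover have "finite (Pow (carrier G))" using fin_G by simp
  ultimately have "finite {H. subgroup H G}" by (rule finite_subset)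
  then show ?thesis unfolding fld_image[symmetric] by (rule finite_imageI)
qed

lemma gal_into_subfield:
  assumes k: "subfield k complex_field" "k \<subseteq> K" and g: "g \<in> carrier G" and x: "x \<in> k"
  shows "g x \<in> k"
proof -
  have kQ: "k \<subseteq> Qab" using k(2) Kf(2) by auto
  have "galois_lift K g x \<in> k" by (rule Gab_into[OF k(1) kQ galois_lift(1)[OF Kf(1,2) g Qsub] x])
  then show ?thesis using galois_lift(2)[OF Kf(1,2) g Qsub, of x] x k(2) by auto
qed

lemma restrict_hom:
  assumes k: "subfield k complex_field" "k \<subseteq> K"
  shows "group_hom G (galois_group k \<rat>) (\<lambda>g. restrict g k)"
    and "(\<lambda>g. restrict g k) ` carrier G = carrier (galois_group k \<rat>)"
    and "\<And>g. g \<in> carrier G \<Longrightarrow> restrict g k = \<one>\<^bsub>galois_group k \<rat>\<^esub> \<longleftrightarrow> g \<in> carrier (galois_group K k)"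
proof -
  have kQ: "k \<subseteq> Qab" using k(2) Kf(2) by auto
  have "\<forall>g\<in>carrier G. \<forall>x\<in>k. g x \<in> k" by (intro ballI) (rule gal_into_subfield[OF k])
  note hom = restriction_hom[OF Kf(1) k order.trans[OF kQ Qab_algebraic] this]
  show r: "group_hom G (galois_group k \<rat>) (\<lambda>g. restrict g k)" by (rule hom(1))
  show "\<And>g. g \<in> carrier G \<Longrightarrow> restrict g k = \<one>\<^bsub>galois_group k \<rat>\<^esub> \<longleftrightarrow> g \<in> carrier (galois_group K k)"
    by (rule hom(2))
  show "(\<lambda>g. restrict g k) ` carrier G = carrier (galois_group k \<rat>)"
  proof
    show "(\<lambda>g. restrict g k) ` carrier G \<subseteq> carrier (galois_group k \<rat>)"
      by (rule image_subsetI) (rule group_hom.hom_closed[OF r])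
    show "carrier (galois_group k \<rat>) \<subseteq> (\<lambda>g. restrict g k) ` carrier G"
    proof
      fix \<tau> assume t: "\<tau> \<in> carrier (galois_group k \<rat>)"
      obtain \<sigma> where s: "\<sigma> \<in> carrier Gab" "restrict \<sigma> k = \<tau>"
        by (rule gal_lift[OF k(1) kQ subfield_Rats[OF k(1)] t]) (rule that)
      have "restrict (restrict \<sigma> K) k = restrict \<sigma> k"
        by (rule restrict_ext) (use k(2) in \<open>simp add: subsetD\<close>)
      then have "restrict (restrict \<sigma> K) k = \<tau>" using s(2) by simp
      then show "\<tau> \<in> (\<lambda>g. restrict g k) ` carrier G"
        using restrict_Gab[OF Kf(1,2) s(1)] by (intro image_eqI[of _ _ "restrict \<sigma> K"]) simp_all
    qed
  qed
qed

end

section \<open>Arithmetic families as norm-coherent systems\<close>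

locale arithmetic_family_over = abelian_field + arithmetic_family +
  assumes fin_M: "\<And>k. k \<in> abelian_fields \<Longrightarrow> finite (carrier (M k))"
    and surj: "\<And>k k'. \<lbrakk>k \<in> abelian_fields; k' \<in> abelian_fields; k' \<subseteq> k; k \<subseteq> K\<rbrakk>
      \<Longrightarrow> N k k' ` carrier (M k) = carrier (M k')"
begin

lemma act_mult_Gab:
  assumes "k \<in> abelian_fields" "\<sigma> \<in> carrier Gab" "\<tau> \<in> carrier Gab" "x \<in> carrier (M k)"
  shows "act k (\<sigma> \<otimes>\<^bsub>Gab\<^esub> \<tau>) x = act k \<sigma> (act k \<tau> x)"
  by (rule group_action.composition_rule[OF action[OF assms(1)] assms(4,2,3)])

text \<open>The action on \<open>M k\<close> only depends on the restriction of an automorphism to \<open>k\<close>, since \<open>Gal(Qab/k)\<close> acts trivially.\<close>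

lemma act_cong:
  assumes k: "k \<in> abelian_fields" and s: "\<sigma> \<in> carrier Gab" and t: "\<tau> \<in> carrier Gab"
    and x: "x \<in> carrier (M k)" and eq: "\<And>y. y \<in> k \<Longrightarrow> \<sigma> y = \<tau> y"
  shows "act k \<sigma> x = act k \<tau> x"
proof -
  note Q = Qab_subfield and QQ = subfield_Rats[OF Qab_subfield]
  interpret g: group Gab by (rule group_galois_group[OF Q QQ])
  define \<rho> where "\<rho> = inv\<^bsub>Gab\<^esub> \<tau> \<otimes>\<^bsub>Gab\<^esub> \<sigma>"
  have r: "\<rho> \<in> carrier Gab" using s t by (simp add: \<rho>_def)
  have "\<rho> y = y" if y: "y \<in> k" for y
  proof -
    have yQ: "y \<in> Qab" using y abelian_fieldsD(2)[OF k] by auto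
    have "\<rho> y = (inv\<^bsub>Gab\<^esub> \<tau>) (\<tau> y)"
      unfolding \<rho>_def using gal_mult_apply[OF Q g.inv_closed[OF t] s yQ] eq[OF y] by simp
    then show ?thesis using gal_inv_apply(1)[OF Q QQ t yQ] by simp
  qed
  then have "\<rho> \<in> carrier (galois_group Qab k)" using r by (simp add: galois_group_iff[OF Q])
  then have "act k \<rho> x = x" using act_trivial[OF k _ x] by simp
  moreover have "\<sigma> = \<tau> \<otimes>\<^bsub>Gab\<^esub> \<rho>" using s t by (simp add: \<rho>_def g.m_assoc[symmetric])
  ultimately show ?thesis using act_mult_Gab[OF k t r x] by simp
qed

lemma lift_K:
  assumes "g \<in> carrier G"
  shows "galois_lift K g \<in> carrier Gab" "\<And>x. x \<in> K \<Longrightarrow> galois_lift K g x = g x"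
  using galois_lift[OF Kf(1,2) assms Qsub] by auto

text \<open>Restriction to the fixed field \<open>k\<close> of \<open>H\<close> maps \<open>R\<close> bijectively to \<open>Gal(k/k')\<close>, where \<open>k'\<close> is the fixed field
of \<open>H'\<close>. So the product over \<open>R\<close> is the trace of \<open>k/k'\<close>, which is the transfer of the norm.\<close>

lemma finprod_transversal:
  assumes H: "subgroup H G" and H': "subgroup H' G" and HH: "H \<subseteq> H'" and R: "R \<subseteq> H'"
    and ex1: "\<And>h. h \<in> H' \<Longrightarrow> \<exists>!r. r \<in> R \<and> h \<otimes>\<^bsub>G\<^esub> inv\<^bsub>G\<^esub> r \<in> H"
    and x: "x \<in> carrier (M (fld H))" and N1: "N (fld H) (fld H') x = \<one>\<^bsub>M (fld H')\<^esub>"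
  shows "finprod (M (fld H)) (\<lambda>r. act (fld H) (galois_lift K r) x) R = \<one>\<^bsub>M (fld H)\<^esub>"
proof -
  interpret H: subgroup H G by (rule H)
  interpret H': subgroup H' G by (rule H')
  define k k' where "k = fld H" and "k' = fld H'"
  have k: "k \<in> abelian_fields" "subfield k complex_field" "k \<subseteq> K"
    using fld_abelian[OF H] fld_subfield[OF H] fld_sub by (auto simp: k_def)
  have k': "k' \<in> abelian_fields" "subfield k' complex_field" "k' \<subseteq> K"
    using fld_abelian[OF H'] fld_subfield[OF H'] fld_sub by (auto simp: k'_def)
  have kk: "k' \<subseteq> k" using fld_antimono[OF HH] by (simp add: k_def k'_def)
  have kQ: "k \<subseteq> Qab" using k(3) Kf(2) by auto
  interpret Mk: comm_group "M k" by (rule comm_group_M[OF k(1)])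
  interpret Mk': comm_group "M k'" by (rule comm_group_M[OF k'(1)])
  have xk: "x \<in> carrier (M k)" using x by (simp add: k_def)
  have RG: "r \<in> carrier G" if "r \<in> R" for r using that R by auto
  have onk: "h y = r y" if h: "h \<in> carrier G" and r: "r \<in> carrier G" and hr: "h \<otimes>\<^bsub>G\<^esub> inv\<^bsub>G\<^esub> r \<in> H" and y: "y \<in> k" for h r y
  proof -
    have yK: "y \<in> K" using y k(3) by auto
    have ry: "r y \<in> k" by (rule gal_into_subfield[OF k(2,3) r y])
    have "h = (h \<otimes>\<^bsub>G\<^esub> inv\<^bsub>G\<^esub> r) \<otimes>\<^bsub>G\<^esub> r" using h r by (simp add: G.m_assoc)
    then have "h y = ((h \<otimes>\<^bsub>G\<^esub> inv\<^bsub>G\<^esub> r) \<otimes>\<^bsub>G\<^esub> r) y" by simp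
    also have "\<dots> = (h \<otimes>\<^bsub>G\<^esub> inv\<^bsub>G\<^esub> r) (r y)"
      by (rule gal_mult_apply[OF Kf(1) _ r yK]) (use h r in simp)
    also have "\<dots> = r y" using ry hr by (auto simp: k_def fixed_field_def)
    finally show ?thesis .
  qed
  have inj: "inj_on (\<lambda>r. restrict r k) R"
  proof (rule inj_onI)
    fix r s assume rs: "r \<in> R" "s \<in> R" "restrict r k = restrict s k"
    note g = RG[OF rs(1)] RG[OF rs(2)]
    have "(r \<otimes>\<^bsub>G\<^esub> inv\<^bsub>G\<^esub> s) y = y" if y: "y \<in> k" for y
    proof -
      have yK: "y \<in> K" using y k(3) by auto
      have z: "(inv\<^bsub>G\<^esub> s) y \<in> k" by (rule gal_into_subfield[OF k(2,3) G.inv_closed[OF g(2)] y])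
      have "(r \<otimes>\<^bsub>G\<^esub> inv\<^bsub>G\<^esub> s) y = r ((inv\<^bsub>G\<^esub> s) y)" by (rule gal_mult_apply[OF Kf(1) g(1) G.inv_closed[OF g(2)] yK])
      also have "\<dots> = s ((inv\<^bsub>G\<^esub> s) y)" using fun_cong[OF rs(3), of "(inv\<^bsub>G\<^esub> s) y"] z by simp
      also have "\<dots> = y" by (rule gal_inv_apply(2)[OF Kf(1) Qsub g(2) yK])
      finally show ?thesis .
    qed
    then have "r \<otimes>\<^bsub>G\<^esub> inv\<^bsub>G\<^esub> s \<in> carrier (galois_group K k)"
      using G.m_closed[OF g(1) G.inv_closed[OF g(2)]] by (simp add: galois_group_iff[OF Kf(1)])
    then have "r \<otimes>\<^bsub>G\<^esub> inv\<^bsub>G\<^esub> s \<in> H" using gal_fld[OF H] by (simp add: k_def)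
    moreover have "r \<otimes>\<^bsub>G\<^esub> inv\<^bsub>G\<^esub> r \<in> H" using g by simp
    moreover have "r \<in> H'" using rs(1) R by auto
    ultimately show "r = s" using ex1[of r] rs(1,2) by blast
  qed
  have img: "(\<lambda>r. restrict r k) ` R = carrier (galois_group k k')"
  proof
    show "(\<lambda>r. restrict r k) ` R \<subseteq> carrier (galois_group k k')"
    proof clarify
      fix r assume r: "r \<in> R"
      have "restrict r k \<in> carrier (galois_group k \<rat>)" using restrict_hom(2)[OF k(2,3)] RG[OF r] by blast
      moreover have "r y = y" if "y \<in> k'" for y using that r R by (auto simp: k'_def fixed_field_def)
      ultimately show "restrict r k \<in> carrier (galois_group k k')" using kk by (auto simp: galois_group_iff[OF k(2)])
    qed
    show "carrier (galois_group k k') \<subseteq> (\<lambda>r. restrict r k) ` R"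
    proof
      fix \<tau> assume t: "\<tau> \<in> carrier (galois_group k k')"
      obtain \<sigma> where s: "\<sigma> \<in> carrier (galois_group Qab k')" "\<sigma> \<in> carrier Gab" "restrict \<sigma> k = \<tau>"
        by (rule gal_lift[OF k(2) kQ kk t]) (rule that)
      define h where "h = restrict \<sigma> K"
      have "h \<in> carrier (galois_group K k')" unfolding h_def
        by (rule restrict_Gab_fix[OF Kf(1,2) s(2) gal_fix[OF Qab_subfield s(1)] k'(3)])
      then have h: "h \<in> H'" using gal_fld[OF H'] by (simp add: k'_def)
      then obtain r where r: "r \<in> R" "h \<otimes>\<^bsub>G\<^esub> inv\<^bsub>G\<^esub> r \<in> H" using ex1 by blast
      have "restrict r k = \<tau>"
      proof (rule extensionalityI[OF restrict_extensional gal_ext[OF k(2) t]])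
        fix y assume y: "y \<in> k"
        have "r y = h y" using onk[OF H'.mem_carrier[OF h] RG[OF r(1)] r(2) y] by simp
        then show "restrict r k y = \<tau> y" using fun_cong[OF s(3), of y] y k(3) by (auto simp: h_def)
      qed
      then show "\<tau> \<in> (\<lambda>r. restrict r k) ` R" using r(1) by blast
    qed
  qed
  have eq: "act k (galois_lift k (restrict r k)) x = act k (galois_lift K r) x" if r: "r \<in> R" for r
  proof -
    have rk: "restrict r k \<in> carrier (galois_group k k')" using img r by blast
    note l = galois_lift[OF k(2) kQ rk kk]
    show ?thesis
    proof (rule act_cong[OF k(1) l(1) lift_K(1)[OF RG[OF r]] xk])
      fix y assume y: "y \<in> k"
      then show "galois_lift k (restrict r k) y = galois_lift K r y"
        using l(2)[OF y] lift_K(2)[OF RG[OF r], of y] k(3) by auto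
    qed
  qed
  have cl: "act k (galois_lift K r) x \<in> carrier (M k)" if "r \<in> R" for r
    by (rule hom_in_carrier[OF act_hom[OF k(1) lift_K(1)[OF RG[OF that]]] xk])
  have "\<one>\<^bsub>M k\<^esub> = J k k' (N k k' x)"
    using N1 hom_one[OF transfer_hom[OF k'(1) k(1) kk] Mk'.is_group Mk.is_group] by (simp add: k_def k'_def)
  also have "\<dots> = finprod (M k) (\<lambda>\<tau>. act k (galois_lift k \<tau>) x) (carrier (galois_group k k'))"
    by (rule transfer_norm[OF k'(1) k(1) kk xk])
  also have "\<dots> = finprod (M k) (\<lambda>r. act k (galois_lift k (restrict r k)) x) R"
    unfolding img[symmetric] by (rule Mk.finprod_reindex[OF _ inj]) (auto simp: eq cl)
  also have "\<dots> = finprod (M k) (\<lambda>r. act k (galois_lift K r) x) R"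
    by (rule Mk.finprod_cong') (auto simp: eq cl)
  finally show ?thesis by (simp add: k_def)
qed

lemma norm_system_fld:
  "norm_system G (\<lambda>H. M (fld H)) (\<lambda>H g. act (fld H) (galois_lift K g)) (\<lambda>H H'. N (fld H) (fld H'))"
proof (rule norm_system.intro[OF G.comm_group_axioms], rule norm_system_axioms.intro)
  show "finite (carrier G)" by (rule fin_G)
next
  fix H assume H: "subgroup H G"
  show "comm_group (M (fld H))" by (rule comm_group_M[OF fld_abelian[OF H]])
  show "finite (carrier (M (fld H)))" by (rule fin_M[OF fld_abelian[OF H]])
  note k = fld_abelian[OF H]
  {
    fix g assume g: "g \<in> carrier G"
    show "act (fld H) (galois_lift K g) \<in> hom (M (fld H)) (M (fld H))"
      by (rule act_hom[OF k lift_K(1)[OF g]])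
    fix h x assume h: "h \<in> carrier G" and x: "x \<in> carrier (M (fld H))"
    note Q = Qab_subfield
    interpret g: group Gab by (rule group_galois_group[OF Q subfield_Rats[OF Q]])
    have gh: "galois_lift K g \<otimes>\<^bsub>Gab\<^esub> galois_lift K h \<in> carrier Gab" using lift_K(1)[OF g] lift_K(1)[OF h] by simp
    have "act (fld H) (galois_lift K (g \<otimes>\<^bsub>G\<^esub> h)) x = act (fld H) (galois_lift K g \<otimes>\<^bsub>Gab\<^esub> galois_lift K h) x"
    proof (rule act_cong[OF k lift_K(1)[OF G.m_closed[OF g h]] gh x])
      fix y assume "y \<in> fld H"
      then have y: "y \<in> K" "y \<in> Qab" using fld_sub Kf(2) by auto
      have "(galois_lift K g \<otimes>\<^bsub>Gab\<^esub> galois_lift K h) y = galois_lift K g (galois_lift K h y)"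
        by (rule gal_mult_apply[OF Q lift_K(1)[OF g] lift_K(1)[OF h] y(2)])
      also have "\<dots> = g (h y)" using lift_K(2)[OF h y(1)] lift_K(2)[OF g gal_closed[OF Kf(1) h y(1)]] by simp
      finally show "galois_lift K (g \<otimes>\<^bsub>G\<^esub> h) y = (galois_lift K g \<otimes>\<^bsub>Gab\<^esub> galois_lift K h) y"
        using lift_K(2)[OF G.m_closed[OF g h] y(1)] gal_mult_apply[OF Kf(1) g h y(1)] by simp
    qed
    then show "act (fld H) (galois_lift K (g \<otimes>\<^bsub>G\<^esub> h)) x = act (fld H) (galois_lift K g) (act (fld H) (galois_lift K h) x)"
      using act_mult_Gab[OF k lift_K(1)[OF g] lift_K(1)[OF h] x] by simp
  }
  {
    fix h x assume h: "h \<in> H" and x: "x \<in> carrier (M (fld H))"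
    have hG: "h \<in> carrier G" using h subgroup.mem_carrier[OF H] by auto
    have "galois_lift K h y = y" if y: "y \<in> fld H" for y
      using lift_K(2)[OF hG, of y] y h by (auto simp: fixed_field_def)
    then have "galois_lift K h \<in> carrier (galois_group Qab (fld H))"
      using lift_K(1)[OF hG] by (simp add: galois_group_iff[OF Qab_subfield])
    then show "act (fld H) (galois_lift K h) x = x" by (rule act_trivial[OF k _ x])
  }
  fix H' assume H': "subgroup H' G" and HH: "H \<subseteq> H'"
  note k' = fld_abelian[OF H']
  show "N (fld H) (fld H') \<in> hom (M (fld H)) (M (fld H'))" by (rule norm_hom[OF k' k fld_antimono[OF HH]])
  show "N (fld H) (fld H') ` carrier (M (fld H)) = carrier (M (fld H'))"
    by (rule surj[OF k k' fld_antimono[OF HH] fld_sub])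
  {
    fix g x assume g: "g \<in> carrier G" and x: "x \<in> carrier (M (fld H))"
    show "N (fld H) (fld H') (act (fld H) (galois_lift K g) x) = act (fld H') (galois_lift K g) (N (fld H) (fld H') x)"
      by (rule norm_equivariant[OF k' k fld_antimono[OF HH] lift_K(1)[OF g] x])
  }
  {
    fix H'' x assume H'': "subgroup H'' G" and HH': "H' \<subseteq> H''" and x: "x \<in> carrier (M (fld H))"
    show "N (fld H') (fld H'') (N (fld H) (fld H') x) = N (fld H) (fld H'') x"
      by (rule norm_trans[OF fld_abelian[OF H''] k' k fld_antimono[OF HH'] fld_antimono[OF HH] x])
  }
  {
    fix R x assume R: "R \<subseteq> H'" and ex1: "\<And>h. h \<in> H' \<Longrightarrow> \<exists>!r. r \<in> R \<and> h \<otimes>\<^bsub>G\<^esub> inv\<^bsub>G\<^esub> r \<in> H"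
      and x: "x \<in> carrier (M (fld H))" and N1: "N (fld H) (fld H') x = \<one>\<^bsub>M (fld H')\<^esub>"
    show "finprod (M (fld H)) (\<lambda>r. act (fld H) (galois_lift K r) x) R = \<one>\<^bsub>M (fld H)\<^esub>"
      by (rule finprod_transversal[OF H H' HH R ex1 x N1])
  }
qed

text \<open>The set of elements of the module \<open>M\<^sup>a\<^sup>r\<close> of a character with field \<open>k\<close>.\<close>

definition arith :: "complex set \<Rightarrow> 'a set" where
  "arith k = {x \<in> carrier (M k). \<forall>k'. subfield k' complex_field \<and> k' \<subset> k \<longrightarrow> N k k' x = \<one>\<^bsub>M k'\<^esub>}"

lemma comp_fld:
  assumes H: "subgroup H G"
  shows "norm_system.comp G (\<lambda>H. M (fld H)) (\<lambda>H H'. N (fld H) (fld H')) H = arith (fld H)"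
proof -
  interpret S: norm_system G "\<lambda>H. M (fld H)" "\<lambda>H g. act (fld H) (galois_lift K g)" "\<lambda>H H'. N (fld H) (fld H')"
    by (rule norm_system_fld)
  have "(\<forall>H'. subgroup H' G \<longrightarrow> H \<subset> H' \<longrightarrow> N (fld H) (fld H') x = \<one>\<^bsub>M (fld H')\<^esub>) \<longleftrightarrow>
    (\<forall>k'. subfield k' complex_field \<and> k' \<subset> fld H \<longrightarrow> N (fld H) k' x = \<one>\<^bsub>M k'\<^esub>)" (is "?A \<longleftrightarrow> ?B") for x
  proof
    assume A: ?A
    show ?B
    proof (intro allI impI, elim conjE)
      fix k' assume k': "subfield k' complex_field" "k' \<subset> fld H"
      have kK: "k' \<subseteq> K" using k'(2) fld_sub by auto
      define H' where "H' = carrier (galois_group K k')"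
      have sH': "subgroup H' G" unfolding H'_def by (rule subgroup_gal[OF k'(1) kK])
      have e: "fld H' = k'" unfolding H'_def by (rule fld_gal[OF k'(1) kK])
      have "H \<subseteq> H'"
      proof -
        have "carrier (galois_group K (fld H)) \<subseteq> carrier (galois_group K k')"
          by (rule gal_mono[OF Kf(1)]) (use k'(2) in auto)
        then show ?thesis using gal_fld[OF H] by (simp add: H'_def)
      qed
      moreover have "H \<noteq> H'" using e k'(2) by auto
      ultimately show "N (fld H) k' x = \<one>\<^bsub>M k'\<^esub>" using A sH' e by blast
    qed
  next
    assume B: ?B
    show ?A
    proof (intro allI impI)
      fix H' assume H': "subgroup H' G" "H \<subset> H'"
      have "fld H' \<subseteq> fld H" using H'(2) by (intro fld_antimono) auto
      moreover have "fld H' \<noteq> fld H" using gal_fld[OF H] gal_fld[OF H'(1)] H'(2) by auto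
      ultimately show "N (fld H) (fld H') x = \<one>\<^bsub>M (fld H')\<^esub>" using B fld_subfield[OF H'(1)] by blast
    qed
  qed
  then show ?thesis by (simp add: S.comp_def arith_def)
qed

lemma cyclic_quotient_fld:
  assumes H: "subgroup H G"
  shows "(\<exists>g\<in>carrier G. \<forall>x\<in>carrier G. \<exists>i::nat. x \<otimes>\<^bsub>G\<^esub> inv\<^bsub>G\<^esub> (g [^]\<^bsub>G\<^esub> i) \<in> H)
    \<longleftrightarrow> cyclic_group (galois_group (fld H) \<rat>)"
proof -
  define k where "k = fld H"
  have k: "subfield k complex_field" "k \<subseteq> K" "k \<in> abelian_fields"
    using fld_subfield[OF H] fld_sub fld_abelian[OF H] by (auto simp: k_def)
  interpret r: group_hom G "galois_group k \<rat>" "\<lambda>g. restrict g k" by (rule restrict_hom(1)[OF k(1,2)])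
  have key: "x \<otimes>\<^bsub>G\<^esub> inv\<^bsub>G\<^esub> y \<in> H \<longleftrightarrow> restrict x k = restrict y k" if xy: "x \<in> carrier G" "y \<in> carrier G" for x y
  proof -
    have "x \<otimes>\<^bsub>G\<^esub> inv\<^bsub>G\<^esub> y \<in> H \<longleftrightarrow> restrict (x \<otimes>\<^bsub>G\<^esub> inv\<^bsub>G\<^esub> y) k = \<one>\<^bsub>galois_group k \<rat>\<^esub>"
      using restrict_hom(3)[OF k(1,2), of "x \<otimes>\<^bsub>G\<^esub> inv\<^bsub>G\<^esub> y"] xy gal_fld[OF H] by (simp add: k_def)
    also have "restrict (x \<otimes>\<^bsub>G\<^esub> inv\<^bsub>G\<^esub> y) k = restrict x k \<otimes>\<^bsub>galois_group k \<rat>\<^esub> inv\<^bsub>galois_group k \<rat>\<^esub> restrict y k"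
      using r.hom_mult[OF xy(1) G.inv_closed[OF xy(2)]] r.hom_inv[OF xy(2)] by simp
    also have "\<dots> = \<one>\<^bsub>galois_group k \<rat>\<^esub> \<longleftrightarrow> restrict x k = restrict y k"
      using r.hom_closed[OF xy(1)] r.hom_closed[OF xy(2)]
      by (metis r.H.inv_closed r.H.inv_equality r.H.inv_inv r.H.r_inv)
    finally show ?thesis .
  qed
  have fink: "finite (carrier (galois_group k \<rat>))"
    by (rule finite_galois_group[OF abelian_fieldsD(1,3)[OF k(3)]])
  have "(\<exists>g\<in>carrier G. \<forall>x\<in>carrier G. \<exists>i::nat. x \<otimes>\<^bsub>G\<^esub> inv\<^bsub>G\<^esub> (g [^]\<^bsub>G\<^esub> i) \<in> H)
    \<longleftrightarrow> (\<exists>\<gamma>\<in>carrier (galois_group k \<rat>). \<forall>\<tau>\<in>carrier (galois_group k \<rat>). \<exists>i::nat. \<tau> = \<gamma> [^]\<^bsub>galois_group k \<rat>\<^esub> i)"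
  proof -
    have "(\<forall>x\<in>carrier G. \<exists>i::nat. x \<otimes>\<^bsub>G\<^esub> inv\<^bsub>G\<^esub> (g [^]\<^bsub>G\<^esub> i) \<in> H)
      \<longleftrightarrow> (\<forall>x\<in>carrier G. \<exists>i::nat. restrict x k = restrict g k [^]\<^bsub>galois_group k \<rat>\<^esub> i)" if g: "g \<in> carrier G" for g
      using key[OF _ G.nat_pow_closed[OF g]] r.hom_nat_pow[OF g] by simp
    then show ?thesis unfolding restrict_hom(2)[OF k(1,2), symmetric] by simp
  qed
  also have "\<dots> \<longleftrightarrow> cyclic_group (galois_group k \<rat>)" by (rule r.H.cyclic_group_iff_nat_pow[OF fink, symmetric])
  finally show ?thesis by (simp add: k_def)
qed

text \<open>The counting formula for subgroups, translated by the Galois correspondence.\<close>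

theorem multiplicity_card_M:
  assumes p: "Factorial_Ring.prime p" and P: "sylow_subgroup p G P" and cyc: "cyclic_group (G\<lparr>carrier := P\<rparr>)"
  shows "multiplicity p (card (carrier (M K)))
    = (\<Sum>k | subfield k complex_field \<and> k \<subseteq> K \<and> cyclic_group (galois_group k \<rat>). multiplicity p (card (arith k)))"
proof -
  interpret S: norm_system G "\<lambda>H. M (fld H)" "\<lambda>H g. act (fld H) (galois_lift K g)" "\<lambda>H H'. N (fld H) (fld H')"
    by (rule norm_system_fld)
  interpret S: norm_system_sylow G "\<lambda>H. M (fld H)" "\<lambda>H g. act (fld H) (galois_lift K g)" "\<lambda>H H'. N (fld H) (fld H')" p P
    by (rule norm_system_sylow.intro[OF S.norm_system_axioms], rule norm_system_sylow_axioms.intro)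
      (use p P cyc in \<open>simp_all add: sylow_subgroup_def\<close>)
  define C where "C = {H. subgroup H G \<and> S.cyclic_quotient H}"
  have cq: "S.cyclic_quotient H \<longleftrightarrow> cyclic_group (galois_group (fld H) \<rat>)" if "subgroup H G" for H
    using cyclic_quotient_fld[OF that] by (simp add: S.cyclic_quotient_def)
  have inj: "inj_on fld C" by (rule inj_on_subset[OF fld_inj]) (auto simp: C_def)
  have img: "fld ` C = {k. subfield k complex_field \<and> k \<subseteq> K \<and> cyclic_group (galois_group k \<rat>)}"
  proof -
    have "fld ` C = {k \<in> fld ` {H. subgroup H G}. cyclic_group (galois_group k \<rat>)}" using cq by (auto simp: C_def)
    then show ?thesis by (auto simp: fld_image)
  qed
  have "multiplicity p (card (carrier (M K))) = (\<Sum>H\<in>C. multiplicity p (card (S.comp H)))"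
    using S.multiplicity_card_cyclic by (simp add: fld_trivial C_def)
  also have "\<dots> = (\<Sum>H\<in>C. multiplicity p (card (arith (fld H))))"
    by (intro sum.cong refl) (simp add: comp_fld C_def)
  also have "\<dots> = (\<Sum>k\<in>fld ` C. multiplicity p (card (arith k)))"
    using sum.reindex[OF inj, of "\<lambda>k. multiplicity p (card (arith k))"] by simp
  finally show ?thesis by (simp add: img)
qed

end

section \<open>Conjugates of roots of unity\<close>

abbreviation ip :: "int poly \<Rightarrow> complex poly" where "ip \<equiv> map_poly of_int"

lemma ip_simps:
  "ip (p + q) = ip p + ip q" "ip (p - q) = ip p - ip q" "ip (p * q) = ip p * ip q"
  "ip (smult c p) = smult (of_int c) (ip p)" "ip 1 = 1" "ip 0 = 0" "ip [:c:] = [:of_int c:]"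
  "ip (p ^ n) = ip p ^ n" "ip (pderiv p) = pderiv (ip p)" "ip (pcompose p q) = pcompose (ip p) (ip q)"
  "ip (monom c n) = monom (of_int c) n"
proof -
  show a: "ip (p + q) = ip p + ip q" for p q by (rule poly_eqI) (simp add: coeff_map_poly)
  show "ip (p - q) = ip p - ip q" for p q by (rule poly_eqI) (simp add: coeff_map_poly)
  show m: "ip (p * q) = ip p * ip q" for p q
    by (rule poly_eqI) (simp add: coeff_map_poly coeff_mult)
  show "ip (smult c p) = smult (of_int c) (ip p)" by (rule poly_eqI) (simp add: coeff_map_poly)
  show o: "ip 1 = 1" by (rule poly_eqI) (simp add: coeff_map_poly coeff_1)
  show "ip 0 = 0" by simp
  show c: "ip [:c:] = [:of_int c:]" for c by (simp add: map_poly_pCons)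
  show "ip (p ^ n) = ip p ^ n" by (induction n) (simp_all add: m o)
  show "ip (pderiv p) = pderiv (ip p)" by (rule poly_eqI) (simp add: coeff_map_poly coeff_pderiv)
  show "ip (pcompose p q) = pcompose (ip p) (ip q)"
    by (induction p) (simp_all add: pcompose_pCons a m c map_poly_pCons)
  show "ip (monom c n) = monom (of_int c) n" by (rule poly_eqI) (simp add: coeff_map_poly)
qed

lemma dvd_binomial_prime:
  fixes x y :: "'a :: comm_ring_1"
  assumes q: "Factorial_Ring.prime q"
  shows "of_nat q dvd (x + y) ^ q - (x ^ q + y ^ q)"
proof -
  have q0: "q > 0" using q prime_gt_0_nat by auto
  have "(x + y) ^ q = (\<Sum>k\<le>q. of_nat (q choose k) * x ^ k * y ^ (q - k))" by (rule binomial_ring)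
  also have "{..q} = insert 0 (insert q {1..<q})" using q0 by auto
  also have "(\<Sum>k\<in>\<dots>. of_nat (q choose k) * x ^ k * y ^ (q - k))
    = x ^ q + y ^ q + (\<Sum>k\<in>{1..<q}. of_nat (q choose k) * x ^ k * y ^ (q - k))"
    using q0 by (subst sum.insert, simp, simp, subst sum.insert) auto
  finally have "(x + y) ^ q - (x ^ q + y ^ q) = (\<Sum>k\<in>{1..<q}. of_nat (q choose k) * x ^ k * y ^ (q - k))" by simp
  also have "of_nat q dvd \<dots>"
  proof (rule dvd_sum)
    fix k assume "k \<in> {1..<q}"
    then have "q dvd (q choose k)" using q by (intro dvd_choose_prime) auto
    then have "(of_nat q :: 'a) dvd of_nat (q choose k)" by (metis dvd_def of_nat_mult)
    then show "of_nat q dvd of_nat (q choose k) * x ^ k * y ^ (q - k)" by (simp add: mult.assoc)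
  qed
  finally show ?thesis .
qed

text \<open>Fermat's little theorem for all integers, from additivity of the \<open>q\<close>-th power modulo \<open>q\<close>.\<close>

lemma fermat_int:
  assumes q: "Factorial_Ring.prime q" shows "int q dvd a ^ q - a"
proof (induction a rule: int_induct[where k = 0])
  case base
  then show ?case using q prime_gt_0_nat[OF q] by (simp add: power_0_left)
next
  case (step1 i)
  have "int q dvd (i + 1) ^ q - (i ^ q + 1 ^ q)" using dvd_binomial_prime[OF q, of i 1] by simp
  then have "int q dvd ((i + 1) ^ q - (i ^ q + 1 ^ q)) + (i ^ q - i)" using step1(2) by (rule dvd_add)
  then show ?case by (simp add: algebra_simps)
next
  case (step2 i)
  have "int q dvd ((i - 1) + 1) ^ q - ((i - 1) ^ q + 1 ^ q)" using dvd_binomial_prime[OF q, of "i - 1" 1] by simp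
  then have "int q dvd i ^ q - ((i - 1) ^ q + 1)" by simp
  with step2(2) have "int q dvd (i ^ q - i) - (i ^ q - ((i - 1) ^ q + 1))" by (rule dvd_diff)
  then show ?case by (simp add: algebra_simps)
qed

text \<open>The congruence of \<open>f(X^q)\<close> and \<open>f(X)^q\<close> modulo \<open>q\<close>: the \<open>q\<close>-th power is additive modulo \<open>q\<close>, and it
fixes the coefficients by Fermat.\<close>

lemma frobenius_int_poly:
  fixes f :: "int poly"
  assumes q: "Factorial_Ring.prime q"
  shows "[:int q:] dvd pcompose f (monom 1 q) - f ^ q"
proof (induction f)
  case 0
  then show ?case using prime_gt_0_nat[OF q] by (simp add: power_0_left)
next
  case (pCons a f)
  let ?D = "[:int q:]"
  have D: "?D = of_nat q" by (simp add: of_nat_poly)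
  have e: "pCons a f = [:a:] + monom 1 1 * f" by (simp add: monom_altdef)
  have split: "pcompose (pCons a f) (monom 1 q) - (pCons a f) ^ q
     = ([:a:] - [:a:] ^ q) + monom 1 q * (pcompose f (monom 1 q) - f ^ q)
       - (([:a:] + monom 1 1 * f) ^ q - ([:a:] ^ q + (monom 1 1 * f) ^ q))"
    by (subst (2) e) (simp add: pcompose_pCons algebra_simps power_mult_distrib monom_power)
  have d1: "?D dvd [:a:] - [:a:] ^ q"
  proof -
    have "[:a:] - [:a:] ^ q = [:a - a ^ q:]" by (simp add: poly_const_pow)
    moreover have "int q dvd a - a ^ q" using fermat_int[OF q, of a] by (metis dvd_minus_iff minus_diff_eq)
    then obtain k where "a - a ^ q = int q * k" by (rule dvdE)
    then have "[:a - a ^ q:] = ?D * [:k:]" by simp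
    ultimately show ?thesis by (metis dvd_triv_left)
  qed
  have d2: "?D dvd monom 1 q * (pcompose f (monom 1 q) - f ^ q)" using pCons.IH by (rule dvd_mult)
  have d3: "?D dvd ([:a:] + monom 1 1 * f) ^ q - ([:a:] ^ q + (monom 1 1 * f) ^ q)"
    unfolding D by (rule dvd_binomial_prime[OF q])
  show ?case unfolding split by (rule dvd_diff[OF dvd_add[OF d1 d2] d3])
qed

text \<open>The primitive integer polynomial of least degree. Gauss's lemma turns divisibility after multiplication by
a constant, obtained by pseudo-division, into divisibility over the integers.\<close>

lemma minimal_int_poly:
  assumes z: "algebraic (z :: complex)"
  obtains f :: "int poly" where "f \<noteq> 0" "poly (ip f) z = 0"
    "\<And>g. poly (ip g) z = 0 \<Longrightarrow> f dvd g" "\<And>g. poly (ip g) z = 0 \<Longrightarrow> degree g < degree f \<Longrightarrow> g = 0"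
proof -
  define S where "S = {g :: int poly. g \<noteq> 0 \<and> poly (ip g) z = 0}"
  obtain c :: "int poly" where "c \<in> S" using algebraicE'[OF z] by (auto simp: S_def)
  then obtain f0 where f0: "f0 \<in> S" "\<And>g. g \<in> S \<Longrightarrow> degree f0 \<le> degree g"
    using ex_has_least_nat[of "\<lambda>p. p \<in> S" _ degree] by blast
  define f where "f = primitive_part f0"
  have f00: "f0 \<noteq> 0" using f0(1) by (simp add: S_def)
  have f: "f \<noteq> 0" "content f = 1" "degree f = degree f0" using f00 by (simp_all add: f_def)
  have "ip f0 = smult (of_int (content f0)) (ip f)"
    using content_times_primitive_part[of f0] ip_simps(4)[of "content f0" f] by (simp add: f_def)
  then have fz: "poly (ip f) z = 0" using f0(1) f00 by (auto simp: S_def)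
  have small: "g = 0" if "poly (ip g) z = 0" "degree g < degree f" for g
    using f0(2)[of g] that f(3) by (auto simp: S_def)
  have dvd: "f dvd g" if g: "poly (ip g) z = 0" for g
  proof -
    obtain s r where sr: "pseudo_divmod g f = (s, r)" by fastforce
    define c where "c = coeff f (degree f) ^ (Suc (degree g) - degree f)"
    have c0: "c \<noteq> 0" using f(1) by (simp add: c_def)
    have eq: "smult c g = f * s + r" "r = 0 \<or> degree r < degree f"
      using pseudo_divmod[OF f(1) sr] by (simp_all add: c_def)
    have "poly (ip (smult c g)) z = 0" using g by (simp add: ip_simps)
    then have "poly (ip r) z = 0" using fz by (simp add: eq(1) ip_simps)
    then have "r = 0" using eq(2) small by blast
    then have e: "smult c g = f * s" using eq(1) by simp
    have "content (smult c g) = content (f * s)" using e by simp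
    then have "normalize c * content g = content s" using f(2) by (simp add: content_mult)
    then have "c dvd content s" by (metis dvd_triv_left normalize_dvd_iff)
    then have "[:c:] dvd s" by (simp add: const_poly_dvd_iff_dvd_content)
    then obtain t where "s = [:c:] * t" by (rule dvdE)
    then have "smult c g = smult c (f * t)" using e by simp
    then have "smult c (g - f * t) = 0" by (simp add: smult_diff_right)
    then have "g = f * t" using c0 by simp
    then show ?thesis by simp
  qed
  show ?thesis by (rule that[OF f(1) fz dvd small])
qed

lemma root_of_unity_Qbar: "n > 0 \<Longrightarrow> z ^ n = 1 \<Longrightarrow> z \<in> Qbar"
proof -
  assume n: "n > 0" and z: "z ^ n = 1"
  define U :: "complex poly" where "U = monom 1 n - 1"
  have "U \<noteq> 0"
  proof
    assume "U = 0"
    then have "coeff U n = 0" by simp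
    then show False using n by (simp add: U_def coeff_1)
  qed
  then have "algebraic z" using z by (intro algebraicI[of U]) (auto simp: U_def poly_monom coeff_1)
  then show ?thesis by (simp add: Qbar_def)
qed

text \<open>The key step in the irreducibility of cyclotomic polynomials. Let \<open>f\<close> be the minimal polynomial of \<open>z\<close>, let
\<open>X^n - 1 = f h\<close> and \<open>\<omega> = z^q\<close>, and suppose that \<open>f(\<omega>) \<noteq> 0\<close>. Then \<open>h(\<omega>) = 0\<close>, and differentiation gives
\<open>n \<omega>^(n-1) = f(\<omega>) h'(\<omega>)\<close>. Since \<open>f(z^q)\<close> is congruent to \<open>f(z)^q = 0\<close> modulo \<open>q\<close> in \<open>\<int>[z]\<close>, it follows that
\<open>n \<in> q \<int>[z]\<close>. As the leading coefficient of \<open>f\<close> is a unit, the powers \<open>z^i\<close> with \<open>i < degree f\<close> are a basis of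
\<open>\<int>[z]\<close>, so \<open>q\<close> divides \<open>n\<close>.\<close>

lemma root_of_unity_prime_power:
  fixes z :: complex and g :: "int poly"
  assumes n: "n > 0" and z: "z ^ n = 1" and q: "Factorial_Ring.prime q" "\<not> q dvd n"
    and g: "poly (ip g) z = 0"
  shows "poly (ip g) (z ^ q) = 0"
proof -
  define U :: "int poly" where "U = monom 1 n - 1"
  have U: "poly (ip U) w = w ^ n - 1" for w by (simp add: U_def ip_simps poly_monom)
  have "poly (ip U) z = 0" using z U by simp
  have "algebraic z" using root_of_unity_Qbar[OF n z] by (simp add: Qbar_def)
  then obtain f where f: "f \<noteq> 0" "poly (ip f) z = 0" "\<And>g. poly (ip g) z = 0 \<Longrightarrow> f dvd g"
    "\<And>g. poly (ip g) z = 0 \<Longrightarrow> degree g < degree f \<Longrightarrow> g = 0" by (rule minimal_int_poly) blast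
  define \<omega> where "\<omega> = z ^ q"
  have w: "\<omega> ^ n = 1" unfolding \<omega>_def using z by (metis power_mult mult.commute power_one)
  have "f dvd U" using f(3) \<open>poly (ip U) z = 0\<close> by blast
  then obtain h where h: "U = f * h" by (rule dvdE)
  have "poly (ip f) \<omega> = 0"
  proof (rule ccontr)
    assume nz: "poly (ip f) \<omega> \<noteq> 0"
    have "poly (ip f) \<omega> * poly (ip h) \<omega> = 0" using U[of \<omega>] w by (simp add: h ip_simps)
    then have h0: "poly (ip h) \<omega> = 0" using nz by simp
    have "poly (ip (pderiv U)) \<omega> = of_nat n * \<omega> ^ (n - 1)"
      by (simp add: U_def ip_simps pderiv_diff pderiv_monom poly_monom)
    moreover have "poly (ip (pderiv U)) \<omega> = poly (ip f) \<omega> * poly (ip (pderiv h)) \<omega>"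
      using h0 by (simp add: h ip_simps pderiv_mult)
    ultimately have d: "of_nat n * \<omega> ^ (n - 1) = poly (ip f) \<omega> * poly (ip (pderiv h)) \<omega>" by simp
    obtain t where t: "pcompose f (monom 1 q) - f ^ q = [:int q:] * t" using frobenius_int_poly[OF q(1), of f] by (rule dvdE)
    have q0: "q > 0" using q(1) prime_gt_0_nat by auto
    have "poly (ip (pcompose f (monom 1 q) - f ^ q)) z = poly (ip f) \<omega> - poly (ip f) z ^ q"
      by (simp add: ip_simps poly_pcompose poly_monom \<omega>_def)
    then have "poly (ip f) \<omega> = of_nat q * poly (ip t) z" using f(2) q0 by (simp add: t ip_simps)
    then have fw: "of_nat n * \<omega> ^ (n - 1) = of_nat q * poly (ip t) z * poly (ip (pderiv h)) \<omega>" using d by simp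
    have "\<omega> ^ (n - 1) * \<omega> = 1" using w n by (metis power_minus_mult)
    then have "of_nat n = of_nat n * (\<omega> ^ (n - 1) * \<omega>)" by simp
    also have "\<dots> = (of_nat n * \<omega> ^ (n - 1)) * \<omega>" by (simp only: mult.assoc)
    also have "\<dots> = of_nat q * (poly (ip t) z * poly (ip (pderiv h)) \<omega> * \<omega>)" unfolding fw by (simp only: mult.assoc)
    finally have nq: "of_nat n = of_nat q * (poly (ip t) z * poly (ip (pderiv h)) \<omega> * \<omega>)" .
    define u where "u = t * pcompose (pderiv h) (monom 1 q) * monom 1 q"
    have "poly (ip u) z = poly (ip t) z * poly (ip (pderiv h)) \<omega> * \<omega>"
      by (simp add: u_def ip_simps poly_pcompose poly_monom \<omega>_def)
    then have uz: "of_nat n = of_nat q * poly (ip u) z" using nq by simp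
    have lf: "lead_coeff f * lead_coeff h = 1"
    proof -
      have "degree U = n"
      proof (rule antisym)
        show "degree U \<le> n" unfolding U_def by (rule degree_diff_le) (simp_all add: degree_monom_le)
        show "n \<le> degree U" by (rule le_degree) (use n in \<open>simp add: U_def coeff_1\<close>)
      qed
      then have "lead_coeff U = 1" using n by (simp add: U_def coeff_1)
      then show ?thesis by (simp add: h lead_coeff_mult)
    qed
    \<comment> \<open>Reduce \<open>u\<close> modulo \<open>f\<close> and compare constant coefficients in degree less than that of \<open>f\<close>. The factor \<open>c\<close>
      from pseudo-division is a unit.\<close>
    obtain a r where ar: "pseudo_divmod u f = (a, r)" by fastforce
    define c where "c = coeff f (degree f) ^ (Suc (degree u) - degree f)"
    have cu: "smult c u = f * a + r" "r = 0 \<or> degree r < degree f"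
      using pseudo_divmod[OF f(1) ar] by (simp_all add: c_def)
    have "is_unit (lead_coeff f)" using lf by (metis dvd_triv_left)
    then have c1: "is_unit c" using is_unit_power_iff[of "lead_coeff f"] unfolding c_def by blast
    have "of_int c * poly (ip u) z = poly (ip r) z"
    proof -
      have "of_int c * poly (ip u) z = poly (ip (smult c u)) z" by (simp add: ip_simps)
      then show ?thesis using f(2) by (simp add: cu(1) ip_simps)
    qed
    then have "poly (ip ([:c * int n:] - smult (int q) r)) z = 0"
      using uz by (simp add: ip_simps algebra_simps)
    moreover have "degree ([:c * int n:] - smult (int q) r) < degree f"
    proof -
      have "degree f > 0"
      proof (rule ccontr)
        assume "\<not> degree f > 0"
        then obtain b where "f = [:b:]" by (metis degree_eq_zeroE neq0_conv)
        then show False using f(1,2) by (simp add: ip_simps)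
      qed
      moreover have "degree (smult (int q) r) < degree f" using cu(2) calculation by auto
      ultimately show ?thesis by (intro degree_diff_less) auto
    qed
    ultimately have "[:c * int n:] - smult (int q) r = 0" by (rule f(4))
    then have "coeff ([:c * int n:] - smult (int q) r) 0 = 0" by simp
    then have "c * int n = int q * coeff r 0" by simp
    then have "int q dvd c * int n" by simp
    then have "int q dvd int n" using c1 by (simp add: dvd_mult_unit_iff')
    then show False using q(2) by simp
  qed
  moreover obtain v where "g = f * v" using f(3)[OF g] by (rule dvdE)
  ultimately show ?thesis by (simp add: \<omega>_def ip_simps)
qed

lemma root_of_unity_coprime_power:
  fixes z :: complex and g :: "int poly"
  assumes n: "n > 0" and z: "z ^ n = 1" and a: "a > 0" "coprime a n" and g: "poly (ip g) z = 0"
  shows "poly (ip g) (z ^ a) = 0"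
  using z a g
proof (induction a arbitrary: z rule: less_induct)
  case (less a)
  show ?case
  proof (cases "a = 1")
    case False
    then obtain q where q: "Factorial_Ring.prime q" "q dvd a" using prime_factor_nat by blast
    then obtain b where b: "a = q * b" by auto
    have "b < a" "b > 0" using less.prems(2) b prime_gt_1_nat[OF q(1)] by auto
    moreover have "coprime b n" using less.prems(3) b by simp
    ultimately have g1: "poly (ip g) (z ^ b) = 0" using less.IH[of b z] less.prems by blast
    have "\<not> q dvd n"
    proof
      assume "q dvd n"
      then have "q dvd 1" using q(2) less.prems(3) by (metis coprime_common_divisor_nat dvd_refl)
      then show False using q(1) by simp
    qed
    moreover have "(z ^ b) ^ n = 1" using less.prems(1) by (metis power_mult mult.commute power_one)
    ultimately have "poly (ip g) ((z ^ b) ^ q) = 0" using root_of_unity_prime_power[OF n _ q(1) _ g1] by blast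
    then show ?thesis by (simp add: b power_mult[symmetric] mult.commute)
  qed (use less.prems in simp)
qed

lemma rational_to_int_poly:
  fixes p :: "complex poly"
  assumes "\<forall>i. coeff p i \<in> \<rat>"
  obtains d :: int and g :: "int poly" where "d \<noteq> 0" "smult (of_int d) p = ip g"
proof -
  have "\<exists>d::int. \<exists>g::int poly. d \<noteq> 0 \<and> smult (of_int d) p = ip g"
    using assms
  proof (induction p)
    case 0
    show ?case by (rule exI[of _ 1], rule exI[of _ 0]) simp
  next
    case (pCons a p)
    have "a \<in> \<rat>" using pCons.prems[rule_format, of 0] by simp
    then obtain b c :: int where bc: "a = of_int b / of_int c" "c \<noteq> 0"
      by (auto elim!: Rats_cases')
    have "\<forall>i. coeff p i \<in> \<rat>"
    proof
      fix i show "coeff p i \<in> \<rat>" using pCons.prems[rule_format, of "Suc i"] by simp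
    qed
    then obtain d g where dg: "d \<noteq> 0" "smult (of_int d) p = ip g" using pCons.IH by blast
    have "smult (of_int (d * c)) (pCons a p) = pCons (of_int (d * b)) (smult (of_int c) (smult (of_int d) p))"
      using bc by (simp add: mult.commute)
    also have "\<dots> = ip (pCons (d * b) (smult c g))" by (simp add: dg(2) map_poly_pCons ip_simps)
    finally have "smult (of_int (d * c)) (pCons a p) = ip (pCons (d * b) (smult c g))" .
    then show ?case using dg(1) bc(2) by (intro exI[of _ "d * c"] exI[of _ "pCons (d * b) (smult c g)"]) simp
  qed
  then show ?thesis using that by blast
qed

text \<open>Every rational polynomial that vanishes at \<open>z\<close> vanishes at \<open>z^a\<close>, by induction over the prime factors of \<open>a\<close>.\<close>

theorem root_of_unity_conjugate:
  assumes n: "n > 0" and z: "z ^ n = 1" and a: "a > 0" "coprime a n"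
  obtains \<tau> where "\<tau> \<in> carrier (galois_group Qbar \<rat>)" "\<tau> z = z ^ a"
proof -
  have zQ: "z \<in> Qbar" by (rule root_of_unity_Qbar[OF n z])
  have "\<forall>p. (\<forall>i. coeff p i \<in> \<rat>) \<longrightarrow> poly p z = 0 \<longrightarrow> poly p (z ^ a) = 0"
  proof (intro allI impI)
    fix p :: "complex poly" assume p: "\<forall>i. coeff p i \<in> \<rat>" "poly p z = 0"
    obtain d :: int and g :: "int poly" where dg: "d \<noteq> 0" "smult (of_int d) p = ip g"
      by (rule rational_to_int_poly[OF p(1)])
    have "poly (ip g) z = 0" using p(2) by (simp add: dg(2)[symmetric])
    then have "poly (ip g) (z ^ a) = 0" by (rule root_of_unity_coprime_power[OF n z a])
    then show "poly p (z ^ a) = 0" using dg(1) by (simp add: dg(2)[symmetric])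
  qed
  then show ?thesis
    by (rule extend_to_conjugate[OF subfield_Rats_complex subfield_Rats[OF Qbar_subfield] zQ]) (rule that)
qed

section \<open>Rational characters and cyclic subfields\<close>

lemma group_Gab: "group Gab"
  by (rule group_galois_group[OF Qab_subfield subfield_Rats[OF Qab_subfield]])

abbreviation Cx :: "complex monoid" where "Cx \<equiv> units_of complex_field"

lemma Cx_simps [simp]: "x \<otimes>\<^bsub>Cx\<^esub> y = x * y" "\<one>\<^bsub>Cx\<^esub> = 1" "carrier Cx = {x. x \<noteq> 0}"
proof -
  show "x \<otimes>\<^bsub>Cx\<^esub> y = x * y" "\<one>\<^bsub>Cx\<^esub> = 1" by (simp_all add: units_of_def)
  have "x \<in> Units complex_field \<longleftrightarrow> x \<noteq> 0" for x :: complex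
  proof
    assume "x \<in> Units complex_field" then show "x \<noteq> 0" by (auto simp: Units_def)
  next
    assume "x \<noteq> 0"
    then have "inverse x * x = 1" "x * inverse x = 1" by simp_all
    then show "x \<in> Units complex_field" unfolding Units_def by (auto simp del: left_inverse right_inverse)
  qed
  then show "carrier Cx = {x. x \<noteq> 0}" by (auto simp: units_of_def)
qed

lemma comm_group_Cx: "comm_group Cx"
  by (rule comm_monoid.units_comm_group, rule cring.axioms(2), rule cring_from_type_algebra)

lemma group_Cx: "group Cx" using comm_group_Cx by (simp add: comm_group_def)

lemma monoid_Cx: "Group.monoid Cx" by (rule group.is_monoid[OF group_Cx])

lemma Cx_pow: "x [^]\<^bsub>Cx\<^esub> (n::nat) = x ^ n"
  by (induction n) (simp_all add: nat_pow_def)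

abbreviation chker :: "((complex \<Rightarrow> complex) \<Rightarrow> complex) \<Rightarrow> (complex \<Rightarrow> complex) set" where
  "chker \<psi> \<equiv> kernel Gab Cx \<psi>"

lemma chker_iff: "\<sigma> \<in> chker \<psi> \<longleftrightarrow> \<sigma> \<in> carrier Gab \<and> \<psi> \<sigma> = 1"
  by (simp add: kernel_def)

lemma linear_charactersD:
  assumes "\<psi> \<in> linear_characters"
  shows "\<psi> \<in> hom Gab Cx" "\<psi> \<in> extensional (carrier Gab)"
    "\<exists>n>0. \<forall>\<sigma>\<in>carrier Gab. \<psi> \<sigma> ^ n = 1"
    "\<exists>L\<in>abelian_fields. carrier (galois_group Qab L) \<subseteq> chker \<psi>"
  using assms by (auto simp: linear_characters_def)

lemma character_group_hom: "\<psi> \<in> linear_characters \<Longrightarrow> group_hom Gab Cx \<psi>"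
  using linear_charactersD(1) group_Gab comm_group_Cx
  by (simp add: group_hom_def group_hom_axioms_def comm_group_def)

lemma restrict_Gab_hom:
  assumes k: "subfield k complex_field" "k \<subseteq> Qab"
  shows "group_hom Gab (galois_group k \<rat>) (\<lambda>g. restrict g k)"
    and "(\<lambda>g. restrict g k) ` carrier Gab = carrier (galois_group k \<rat>)"
    and "\<And>g. g \<in> carrier Gab \<Longrightarrow> restrict g k = \<one>\<^bsub>galois_group k \<rat>\<^esub> \<longleftrightarrow> g \<in> carrier (galois_group Qab k)"
proof -
  have "\<forall>g\<in>carrier Gab. \<forall>x\<in>k. g x \<in> k" by (intro ballI) (rule Gab_into[OF k])
  note hom = restriction_hom[OF Qab_subfield k order.trans[OF k(2) Qab_algebraic] this]
  show "group_hom Gab (galois_group k \<rat>) (\<lambda>g. restrict g k)" by (rule hom(1))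
  show "\<And>g. g \<in> carrier Gab \<Longrightarrow> restrict g k = \<one>\<^bsub>galois_group k \<rat>\<^esub> \<longleftrightarrow> g \<in> carrier (galois_group Qab k)"
    by (rule hom(2))
  show "(\<lambda>g. restrict g k) ` carrier Gab = carrier (galois_group k \<rat>)"
  proof
    show "(\<lambda>g. restrict g k) ` carrier Gab \<subseteq> carrier (galois_group k \<rat>)" by (rule image_subsetI) (rule restrict_Gab[OF k])
    show "carrier (galois_group k \<rat>) \<subseteq> (\<lambda>g. restrict g k) ` carrier Gab"
    proof
      fix \<tau> assume t: "\<tau> \<in> carrier (galois_group k \<rat>)"
      obtain \<sigma> where s: "\<sigma> \<in> carrier Gab" "restrict \<sigma> k = \<tau>"
        by (rule gal_lift[OF k subfield_Rats[OF k(1)] t]) (rule that)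
      then show "\<tau> \<in> (\<lambda>g. restrict g k) ` carrier Gab" by blast
    qed
  qed
qed

text \<open>The Galois correspondence for the kernel of a character. Since the kernel contains \<open>Gal(Qab/L)\<close> for some
number field \<open>L\<close>, it is the preimage of a subgroup of the finite group \<open>Gal(L/\<rat>)\<close>, to which Artin's theorem
applies.\<close>

lemma kernel_field:
  assumes \<psi>: "\<psi> \<in> linear_characters"
  defines "k \<equiv> fixed_field Qab (chker \<psi>)"
  shows "k \<in> abelian_fields" "carrier (galois_group Qab k) = chker \<psi>"
proof -
  note Q = Qab_subfield
  interpret Ga: group Gab by (rule group_Gab)
  interpret h: group_hom Gab Cx \<psi> by (rule character_group_hom[OF \<psi>])
  obtain L where L: "L \<in> abelian_fields" "carrier (galois_group Qab L) \<subseteq> chker \<psi>"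
    using linear_charactersD(4)[OF \<psi>] by blast
  note Lf = abelian_fieldsD[OF L(1)]
  have ksub: "chker \<psi> \<subseteq> carrier Gab" by (auto simp: kernel_def)
  have k: "subfield k complex_field" unfolding k_def by (rule subfield_fixed_field[OF Q ksub])
  have kL: "k \<subseteq> L"
  proof
    fix x assume x: "x \<in> k"
    show "x \<in> L"
      by (rule Qab_fixed[OF Lf(1,2)]) (use x L(2) in \<open>auto simp: k_def fixed_field_def\<close>)
  qed
  show "k \<in> abelian_fields" by (rule abelian_fields_sub[OF L(1) k kL])
  interpret r: group_hom Gab "galois_group L \<rat>" "\<lambda>g. restrict g L" by (rule restrict_Gab_hom(1)[OF Lf(1,2)])
  define H where "H = (\<lambda>g. restrict g L) ` chker \<psi>"
  have H: "subgroup H (galois_group L \<rat>)" unfolding H_def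
    by (rule r.subgroup_img_is_subgroup[OF h.subgroup_kernel])
  have fH: "fixed_field L H = k"
  proof
    show "fixed_field L H \<subseteq> k"
    proof
      fix x assume x: "x \<in> fixed_field L H"
      then have xL: "x \<in> L" by (simp add: fixed_field_def)
      have "\<sigma> x = x" if "\<sigma> \<in> chker \<psi>" for \<sigma>
      proof -
        have "restrict \<sigma> L \<in> H" using that by (simp add: H_def)
        then have "restrict \<sigma> L x = x" using x unfolding fixed_field_def by blast
        then show ?thesis using xL by simp
      qed
      then show "x \<in> k" using xL Lf(2) by (auto simp: k_def fixed_field_def)
    qed
    show "k \<subseteq> fixed_field L H"
    proof
      fix x assume x: "x \<in> k"
      then have "x \<in> L" using kL by auto
      moreover have "\<tau> x = x" if "\<tau> \<in> H" for \<tau> using that x calculation by (auto simp: H_def k_def fixed_field_def)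
      ultimately show "x \<in> fixed_field L H" by (simp add: fixed_field_def)
    qed
  qed
  show "carrier (galois_group Qab k) = chker \<psi>"
  proof
    show "chker \<psi> \<subseteq> carrier (galois_group Qab k)"
    proof
      fix \<sigma> assume s: "\<sigma> \<in> chker \<psi>"
      then have "\<sigma> \<in> carrier Gab" using ksub by auto
      then show "\<sigma> \<in> carrier (galois_group Qab k)" using s by (auto simp: galois_group_iff[OF Q] k_def fixed_field_def)
    qed
    show "carrier (galois_group Qab k) \<subseteq> chker \<psi>"
    proof
      fix \<sigma> assume s: "\<sigma> \<in> carrier (galois_group Qab k)"
      have sG: "\<sigma> \<in> carrier Gab" using s gal_mono[OF Q subfield_Rats[OF k]] by auto
      have "restrict \<sigma> L \<in> carrier (galois_group L k)"
        by (rule restrict_Gab_fix[OF Lf(1,2) sG gal_fix[OF Q s] kL])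
      then have "restrict \<sigma> L \<in> H" using artin[OF Lf(1,3) H] fH by simp
      then obtain \<tau> where t: "\<tau> \<in> chker \<psi>" "restrict \<sigma> L = restrict \<tau> L" by (auto simp: H_def)
      have tG: "\<tau> \<in> carrier Gab" using t ksub by auto
      have m: "inv\<^bsub>Gab\<^esub> \<tau> \<otimes>\<^bsub>Gab\<^esub> \<sigma> \<in> carrier Gab" using tG sG by simp
      have e: "restrict (inv\<^bsub>Gab\<^esub> \<tau> \<otimes>\<^bsub>Gab\<^esub> \<sigma>) L = \<one>\<^bsub>galois_group L \<rat>\<^esub>"
        using r.hom_mult[OF Ga.inv_closed[OF tG] sG] r.hom_inv[OF tG] t(2) r.hom_closed[OF tG] by simp
      have "inv\<^bsub>Gab\<^esub> \<tau> \<otimes>\<^bsub>Gab\<^esub> \<sigma> \<in> carrier (galois_group Qab L)"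
        by (rule iffD1[OF restrict_Gab_hom(3)[OF Lf(1,2) m] e])
      then have "\<psi> (inv\<^bsub>Gab\<^esub> \<tau> \<otimes>\<^bsub>Gab\<^esub> \<sigma>) = 1" using L(2) by (auto simp: kernel_def)
      moreover have "\<sigma> = \<tau> \<otimes>\<^bsub>Gab\<^esub> (inv\<^bsub>Gab\<^esub> \<tau> \<otimes>\<^bsub>Gab\<^esub> \<sigma>)" using tG sG by (simp add: Ga.m_assoc[symmetric])
      then have "\<psi> \<sigma> = \<psi> \<tau> * \<psi> (inv\<^bsub>Gab\<^esub> \<tau> \<otimes>\<^bsub>Gab\<^esub> \<sigma>)"
        using h.hom_mult[OF tG Ga.m_closed[OF Ga.inv_closed[OF tG] sG]] by simp
      ultimately show "\<sigma> \<in> chker \<psi>" using t(1) sG by (simp add: kernel_def)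
    qed
  qed
qed

text \<open>The values form a finite subgroup of the multiplicative group of a field, which is cyclic; \<open>m\<close> is its order.\<close>

lemma character_generator:
  assumes \<psi>: "\<psi> \<in> linear_characters"
  obtains g m where "g \<in> carrier Gab" "m > 0" "\<And>\<sigma>. \<sigma> \<in> carrier Gab \<Longrightarrow> \<exists>i::nat. \<psi> \<sigma> = \<psi> g ^ i"
    "\<And>i::nat. \<psi> g ^ i = 1 \<longleftrightarrow> m dvd i"
proof -
  interpret Ga: group Gab by (rule group_Gab)
  interpret h: group_hom Gab Cx \<psi> by (rule character_group_hom[OF \<psi>])
  obtain n where n: "n > 0" "\<And>\<sigma>. \<sigma> \<in> carrier Gab \<Longrightarrow> \<psi> \<sigma> ^ n = 1" using linear_charactersD(3)[OF \<psi>] by blast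
  define I where "I = \<psi> ` carrier Gab"
  have I: "subgroup I Cx" unfolding I_def by (rule h.img_is_subgroup)
  interpret CI: group "Cx\<lparr>carrier := I\<rparr>" by (rule group.subgroup_imp_group[OF group_Cx I])
  interpret CI: comm_group "Cx\<lparr>carrier := I\<rparr>"
    by (rule CI.group_comm_groupI) (simp add: mult.commute)
  have pw: "x [^]\<^bsub>Cx\<lparr>carrier := I\<rparr>\<^esub> (i::nat) = x ^ i" for x i
    by (simp add: monoid.nat_pow_consistent[OF monoid_Cx, symmetric] Cx_pow)
  have roots: "finite {z::complex. z ^ q = 1}" "card {z::complex. z ^ q = 1} = q" if "q > 0" for q
  proof -
    show c: "card {z::complex. z ^ q = 1} = q" by (rule card_roots_unity_eq[OF that])
    show "finite {z::complex. z ^ q = 1}" by (rule card_ge_0_finite) (use c that in simp)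
  qed
  have "I \<subseteq> {z. z ^ n = 1}" using n(2) by (auto simp: I_def)
  then have finI: "finite (carrier (Cx\<lparr>carrier := I\<rparr>))" using roots(1)[OF n(1)] by (simp add: finite_subset)
  have few: "card {x \<in> carrier (Cx\<lparr>carrier := I\<rparr>). x [^]\<^bsub>Cx\<lparr>carrier := I\<rparr>\<^esub> q = \<one>\<^bsub>Cx\<lparr>carrier := I\<rparr>\<^esub>} \<le> q"
    if q: "Factorial_Ring.prime q" for q
  proof -
    have q0: "q > 0" using q prime_gt_0_nat by auto
    have "card {x \<in> carrier (Cx\<lparr>carrier := I\<rparr>). x [^]\<^bsub>Cx\<lparr>carrier := I\<rparr>\<^esub> q = \<one>\<^bsub>Cx\<lparr>carrier := I\<rparr>\<^esub>} \<le> card {z::complex. z ^ q = 1}"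
      by (intro card_mono roots(1)[OF q0]) (auto simp: pw)
    then show ?thesis using roots(2)[OF q0] by simp
  qed
  obtain c where c: "c \<in> carrier (Cx\<lparr>carrier := I\<rparr>)" "CI.ord c = Coset.order (Cx\<lparr>carrier := I\<rparr>)"
    "\<And>x. x \<in> carrier (Cx\<lparr>carrier := I\<rparr>) \<Longrightarrow> \<exists>i::nat. x = c [^]\<^bsub>Cx\<lparr>carrier := I\<rparr>\<^esub> i"
    by (rule CI.cyclic_if_few_prime_roots[OF finI few]) (assumption, rule that)
  obtain g where g: "g \<in> carrier Gab" "c = \<psi> g" using c(1) by (auto simp: I_def)
  show ?thesis
  proof (rule that[OF g(1), of "CI.ord c"])
    show "CI.ord c > 0" using CI.ord_ge_1[OF finI c(1)] by simp
    fix \<sigma> assume "\<sigma> \<in> carrier Gab"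
    then have "\<psi> \<sigma> \<in> carrier (Cx\<lparr>carrier := I\<rparr>)" by (simp add: I_def)
    from c(3)[OF this] show "\<exists>i::nat. \<psi> \<sigma> = \<psi> g ^ i" by (simp add: pw g(2))
  next
    fix i :: nat
    show "\<psi> g ^ i = 1 \<longleftrightarrow> CI.ord c dvd i" using CI.pow_eq_id[OF c(1), of i] by (simp add: pw g(2))
  qed
qed

lemma character_pow:
  assumes "\<psi> \<in> linear_characters" "g \<in> carrier Gab"
  shows "\<psi> (g [^]\<^bsub>Gab\<^esub> (i::nat)) = \<psi> g ^ i"
proof -
  interpret Ga: group Gab by (rule group_Gab)
  interpret h: group_hom Gab Cx \<psi> by (rule character_group_hom[OF assms(1)])
  show ?thesis using h.hom_nat_pow[OF assms(2), of i] by (simp add: Cx_pow)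
qed

text \<open>The powers of \<open>\<zeta>\<close> exhaust the \<open>m\<close>-th roots of unity.\<close>

lemma primitive_root_power:
  fixes \<zeta> \<xi> :: complex
  assumes m: "m > 0" and z: "\<And>i::nat. \<zeta> ^ i = 1 \<longleftrightarrow> m dvd i" and x: "\<And>i::nat. \<xi> ^ i = 1 \<longleftrightarrow> m dvd i"
  obtains a where "a > 0" "coprime a m" "\<xi> = \<zeta> ^ a"
proof -
  have z0: "\<zeta> \<noteq> 0" using z[of m] m by (auto simp: power_0_left)
  have inj: "inj_on (\<lambda>i. \<zeta> ^ i) {..<m}"
  proof (rule linorder_inj_onI)
    fix i j assume ij: "i < j" "i \<in> {..<m}" "j \<in> {..<m}"
    show "\<zeta> ^ i \<noteq> \<zeta> ^ j"
    proof
      assume "\<zeta> ^ i = \<zeta> ^ j"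
      then have "\<zeta> ^ (j - i) = 1" using ij(1) z0 by (simp add: power_diff)
      then have "m dvd j - i" using z by simp
      then show False using ij by (auto dest: dvd_imp_le)
    qed
  qed auto
  have sub: "(\<lambda>i. \<zeta> ^ i) ` {..<m} \<subseteq> {w. w ^ m = 1}"
  proof clarify
    fix i
    have "(\<zeta> ^ i) ^ m = (\<zeta> ^ m) ^ i" by (simp add: power_mult[symmetric] mult.commute)
    then show "(\<zeta> ^ i) ^ m = 1" using z[of m] by simp
  qed
  have c: "card {w::complex. w ^ m = 1} = m" by (rule card_roots_unity_eq[OF m])
  have "finite {w::complex. w ^ m = 1}" by (rule card_ge_0_finite) (use c m in simp)
  then have "(\<lambda>i. \<zeta> ^ i) ` {..<m} = {w. w ^ m = 1}"
    using sub c card_image[OF inj] by (intro card_subset_eq) simp_all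
  moreover have "\<xi> ^ m = 1" using x by simp
  ultimately obtain b where b: "\<xi> = \<zeta> ^ b" by auto
  \<comment> \<open>The exponent \<open>b\<close> may be \<open>0\<close>, if \<open>m = 1\<close>.\<close>
  define a where "a = b + m"
  have a: "\<xi> = \<zeta> ^ a" using b z[of m] by (simp add: a_def power_add)
  have "coprime a m"
  proof (rule ccontr)
    assume "\<not> coprime a m"
    then obtain d where d: "d dvd a" "d dvd m" "d \<noteq> 1" by (auto simp: coprime_def)
    obtain e where e: "a = d * e" using d(1) by (rule dvdE)
    obtain f where f: "m = d * f" using d(2) by (rule dvdE)
    note ef = e f
    have "\<xi> ^ f = (\<zeta> ^ m) ^ e" by (simp add: a ef power_mult[symmetric] ac_simps)
    then have "m dvd f" using z[of m] x[of f] by simp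
    then have "d * f \<le> f" using m ef by (auto dest: dvd_imp_le)
    then show False using d(3) m ef by (cases d) auto
  qed
  moreover have "a > 0" using m by (simp add: a_def)
  ultimately show ?thesis using a that by blast
qed

lemma emb_power: "subfield F complex_field \<Longrightarrow> field_emb F \<tau> \<Longrightarrow> x \<in> F \<Longrightarrow> \<tau> (x ^ n) = \<tau> x ^ n"
  by (induction n) (simp_all add: emb_one emb_mult subfield_power)

lemma character_decompose:
  assumes \<psi>: "\<psi> \<in> linear_characters" and g: "g \<in> carrier Gab" and s: "\<sigma> \<in> carrier Gab"
    and eq: "\<psi> \<sigma> = \<psi> g ^ i"
  obtains \<rho> where "\<rho> \<in> carrier Gab" "\<sigma> = \<rho> \<otimes>\<^bsub>Gab\<^esub> g [^]\<^bsub>Gab\<^esub> (i::nat)" "\<psi> \<rho> = 1"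
proof -
  interpret Ga: group Gab by (rule group_Gab)
  interpret h: group_hom Gab Cx \<psi> by (rule character_group_hom[OF \<psi>])
  have gi: "g [^]\<^bsub>Gab\<^esub> i \<in> carrier Gab" using g by simp
  define \<rho> where "\<rho> = \<sigma> \<otimes>\<^bsub>Gab\<^esub> inv\<^bsub>Gab\<^esub> (g [^]\<^bsub>Gab\<^esub> i)"
  have r: "\<rho> \<in> carrier Gab" "\<sigma> = \<rho> \<otimes>\<^bsub>Gab\<^esub> g [^]\<^bsub>Gab\<^esub> i" using s gi by (simp_all add: \<rho>_def Ga.m_assoc)
  have "\<psi> g ^ i \<noteq> 0" using h.hom_closed[OF gi] by (simp add: character_pow[OF \<psi> g])
  moreover have "\<psi> \<sigma> = \<psi> \<rho> * \<psi> g ^ i" using h.hom_mult[OF r(1) gi] r(2) by (simp add: character_pow[OF \<psi> g])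
  then have "\<psi> \<rho> * \<psi> g ^ i = \<psi> g ^ i" using eq by simp
  ultimately have "\<psi> \<rho> = 1" by (simp only: mult_cancel_right2 simp_thms)
  with r show ?thesis by (rule that)
qed

text \<open>Let \<open>\<psi>\<^sub>1 g\<close> generate the values of \<open>\<psi>\<^sub>1\<close>. As the kernels agree, \<open>\<psi>\<^sub>1 g\<close> and \<open>\<psi>\<^sub>2 g\<close> are primitive roots of unity
of the same order, hence conjugate; and \<open>g\<close> generates modulo the common kernel.\<close>

lemma equal_kernel_conjugate:
  assumes p1: "\<psi>\<^sub>1 \<in> linear_characters" and p2: "\<psi>\<^sub>2 \<in> linear_characters" and ker: "chker \<psi>\<^sub>1 = chker \<psi>\<^sub>2"
  obtains \<tau> where "\<tau> \<in> carrier (galois_group Qbar \<rat>)" "\<forall>\<sigma>\<in>carrier Gab. \<psi>\<^sub>2 \<sigma> = \<tau> (\<psi>\<^sub>1 \<sigma>)"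
proof -
  interpret Ga: group Gab by (rule group_Gab)
  interpret h1: group_hom Gab Cx \<psi>\<^sub>1 by (rule character_group_hom[OF p1])
  interpret h2: group_hom Gab Cx \<psi>\<^sub>2 by (rule character_group_hom[OF p2])
  obtain g m where g: "g \<in> carrier Gab" "m > 0" "\<And>\<sigma>. \<sigma> \<in> carrier Gab \<Longrightarrow> \<exists>i::nat. \<psi>\<^sub>1 \<sigma> = \<psi>\<^sub>1 g ^ i"
    "\<And>i::nat. \<psi>\<^sub>1 g ^ i = 1 \<longleftrightarrow> m dvd i" by (rule character_generator[OF p1]) (rule that)
  have kiff: "\<psi>\<^sub>1 \<sigma> = 1 \<longleftrightarrow> \<psi>\<^sub>2 \<sigma> = 1" if "\<sigma> \<in> carrier Gab" for \<sigma>
    using ker that by (auto simp: set_eq_iff chker_iff)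
  have g2: "\<psi>\<^sub>2 g ^ i = 1 \<longleftrightarrow> m dvd i" for i :: nat
    using kiff[of "g [^]\<^bsub>Gab\<^esub> i"] g(1) g(4)[of i] by (simp add: character_pow[OF p1 g(1)] character_pow[OF p2 g(1)])
  obtain a where a: "a > 0" "coprime a m" "\<psi>\<^sub>2 g = \<psi>\<^sub>1 g ^ a"
    by (rule primitive_root_power[OF g(2,4) g2]) (rule that)
  have z: "\<psi>\<^sub>1 g ^ m = 1" using g(4) by simp
  obtain \<tau> where t: "\<tau> \<in> carrier (galois_group Qbar \<rat>)" "\<tau> (\<psi>\<^sub>1 g) = \<psi>\<^sub>1 g ^ a"
    by (rule root_of_unity_conjugate[OF g(2) z a(1,2)]) (rule that)
  have zQ: "\<psi>\<^sub>1 g \<in> Qbar" by (rule root_of_unity_Qbar[OF g(2) z])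
  have "\<psi>\<^sub>2 \<sigma> = \<tau> (\<psi>\<^sub>1 \<sigma>)" if s: "\<sigma> \<in> carrier Gab" for \<sigma>
  proof -
    obtain i :: nat where i: "\<psi>\<^sub>1 \<sigma> = \<psi>\<^sub>1 g ^ i" using g(3)[OF s] by blast
    have gi: "g [^]\<^bsub>Gab\<^esub> i \<in> carrier Gab" using g(1) by simp
    obtain \<rho> where r: "\<rho> \<in> carrier Gab" "\<sigma> = \<rho> \<otimes>\<^bsub>Gab\<^esub> g [^]\<^bsub>Gab\<^esub> i" "\<psi>\<^sub>1 \<rho> = 1"
      by (rule character_decompose[OF p1 g(1) s i]) (rule that)
    have "\<psi>\<^sub>2 \<rho> = 1" using kiff[OF r(1)] r(3) by simp
    then have "\<psi>\<^sub>2 \<sigma> = \<psi>\<^sub>2 g ^ i" using h2.hom_mult[OF r(1) gi] r(2) by (simp add: character_pow[OF p2 g(1)])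
    also have "\<dots> = \<tau> (\<psi>\<^sub>1 g) ^ i" using a(3) t(2) by simp
    also have "\<dots> = \<tau> (\<psi>\<^sub>1 \<sigma>)" using emb_power[OF Qbar_subfield gal_emb[OF Qbar_subfield t(1)] zQ] i by simp
    finally show ?thesis .
  qed
  then show ?thesis using that t(1) by blast
qed

lemma character_value_Qbar:
  assumes "\<psi> \<in> linear_characters" "\<sigma> \<in> carrier Gab" shows "\<psi> \<sigma> \<in> Qbar"
  using linear_charactersD(3)[OF assms(1)] assms(2) root_of_unity_Qbar by blast

lemma conjugates_subset:
  assumes p1: "\<psi>\<^sub>1 \<in> linear_characters" and p2: "\<psi>\<^sub>2 \<in> linear_characters" and ker: "chker \<psi>\<^sub>1 = chker \<psi>\<^sub>2"
  shows "conjugate_characters \<psi>\<^sub>2 \<subseteq> conjugate_characters \<psi>\<^sub>1"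
proof -
  interpret Gb: group "galois_group Qbar \<rat>" by (rule group_galois_group[OF Qbar_subfield subfield_Rats[OF Qbar_subfield]])
  obtain \<tau> where t: "\<tau> \<in> carrier (galois_group Qbar \<rat>)" "\<forall>\<sigma>\<in>carrier Gab. \<psi>\<^sub>2 \<sigma> = \<tau> (\<psi>\<^sub>1 \<sigma>)"
    by (rule equal_kernel_conjugate[OF p1 p2 ker]) (rule that)
  show ?thesis unfolding conjugate_characters_def
  proof (rule image_subsetI)
    fix \<rho> assume r: "\<rho> \<in> carrier (galois_group Qbar \<rat>)"
    have "(\<lambda>\<sigma>\<in>carrier Gab. \<rho> (\<psi>\<^sub>2 \<sigma>)) = (\<lambda>\<sigma>\<in>carrier Gab. (\<rho> \<otimes>\<^bsub>galois_group Qbar \<rat>\<^esub> \<tau>) (\<psi>\<^sub>1 \<sigma>))"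
      by (rule restrict_ext) (simp add: t(2) gal_mult_apply[OF Qbar_subfield r t(1) character_value_Qbar[OF p1]])
    then show "(\<lambda>\<sigma>\<in>carrier Gab. \<rho> (\<psi>\<^sub>2 \<sigma>)) \<in> (\<lambda>\<tau>. \<lambda>\<sigma>\<in>carrier Gab. \<tau> (\<psi>\<^sub>1 \<sigma>)) ` carrier (galois_group Qbar \<rat>)"
      using Gb.m_closed[OF r t(1)] by blast
  qed
qed

lemma rational_character_cong:
  assumes "\<psi>\<^sub>1 \<in> linear_characters" "\<psi>\<^sub>2 \<in> linear_characters" "chker \<psi>\<^sub>1 = chker \<psi>\<^sub>2"
  shows "rational_character \<psi>\<^sub>1 = rational_character \<psi>\<^sub>2"
  using conjugates_subset[OF assms] conjugates_subset[OF assms(2,1) assms(3)[symmetric]]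
  by (simp add: rational_character_def subset_antisym)

text \<open>A sum of \<open>n\<close> roots of unity equals \<open>n\<close> only if all of them are \<open>1\<close>, as one sees from the real parts. So the kernel
of \<open>\<psi>\<close> can be read off from the sum of its conjugates.\<close>

lemma rational_character_kernel:
  assumes \<psi>: "\<psi> \<in> linear_characters" and s: "\<sigma> \<in> carrier Gab"
  shows "rational_character \<psi> \<sigma> = rational_character \<psi> \<one>\<^bsub>Gab\<^esub> \<longleftrightarrow> \<psi> \<sigma> = 1"
proof -
  interpret Ga: group Gab by (rule group_Gab)
  interpret h: group_hom Gab Cx \<psi> by (rule character_group_hom[OF \<psi>])
  interpret Gb: group "galois_group Qbar \<rat>" by (rule group_galois_group[OF Qbar_subfield subfield_Rats[OF Qbar_subfield]])
  note emb = gal_emb[OF Qbar_subfield]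
  obtain g m where g: "g \<in> carrier Gab" "m > 0" "\<And>\<sigma>. \<sigma> \<in> carrier Gab \<Longrightarrow> \<exists>i::nat. \<psi> \<sigma> = \<psi> g ^ i"
    "\<And>i::nat. \<psi> g ^ i = 1 \<longleftrightarrow> m dvd i" by (rule character_generator[OF \<psi>]) (rule that)
  have "\<forall>\<sigma>\<in>carrier Gab. \<exists>i::nat. \<psi> \<sigma> = \<psi> g ^ i" using g(3) by blast
  then obtain e :: "(complex \<Rightarrow> complex) \<Rightarrow> nat" where e: "\<And>\<sigma>. \<sigma> \<in> carrier Gab \<Longrightarrow> \<psi> \<sigma> = \<psi> g ^ e \<sigma>" by metis
  have gQ: "\<psi> g \<in> Qbar" by (rule character_value_Qbar[OF \<psi> g(1)])
  have cm: "card {w::complex. w ^ m = 1} = m" by (rule card_roots_unity_eq[OF g(2)])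
  then have fm: "finite {w::complex. w ^ m = 1}" by (intro card_ge_0_finite) (use g(2) in simp)
  have tm: "\<tau> (\<psi> \<sigma>) ^ m = 1" if t: "\<tau> \<in> carrier (galois_group Qbar \<rat>)" and s: "\<sigma> \<in> carrier Gab" for \<tau> \<sigma>
  proof -
    have "\<psi> \<sigma> ^ m = (\<psi> g ^ m) ^ e \<sigma>" using e[OF s] by (simp add: power_mult[symmetric] mult.commute)
    then have "\<psi> \<sigma> ^ m = 1" using g(4)[of m] by simp
    then show ?thesis
      using emb_power[OF Qbar_subfield emb[OF t] character_value_Qbar[OF \<psi> s], of m] emb_one[OF Qbar_subfield emb[OF t]] by simp
  qed
  \<comment> \<open>There are finitely many conjugates: each is determined by its value at \<open>g\<close>, an \<open>m\<close>-th root of unity.\<close>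
  have "conjugate_characters \<psi> \<subseteq> (\<lambda>w. \<lambda>\<sigma>\<in>carrier Gab. w ^ e \<sigma>) ` {w. w ^ m = 1}"
    unfolding conjugate_characters_def
  proof (rule image_subsetI)
    fix \<tau> assume t: "\<tau> \<in> carrier (galois_group Qbar \<rat>)"
    have "(\<lambda>\<sigma>\<in>carrier Gab. \<tau> (\<psi> \<sigma>)) = (\<lambda>\<sigma>\<in>carrier Gab. \<tau> (\<psi> g) ^ e \<sigma>)"
      by (rule restrict_ext) (simp add: e emb_power[OF Qbar_subfield emb[OF t] gQ])
    then show "(\<lambda>\<sigma>\<in>carrier Gab. \<tau> (\<psi> \<sigma>)) \<in> (\<lambda>w. \<lambda>\<sigma>\<in>carrier Gab. w ^ e \<sigma>) ` {w. w ^ m = 1}"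
      using tm[OF t g(1)] by blast
  qed
  then have fin: "finite (conjugate_characters \<psi>)" using fm finite_surj by blast
  have norm1: "cmod (\<phi> \<sigma>) = 1" if p: "\<phi> \<in> conjugate_characters \<psi>" for \<phi>
  proof -
    obtain \<tau> where t: "\<tau> \<in> carrier (galois_group Qbar \<rat>)" "\<phi> = (\<lambda>\<sigma>\<in>carrier Gab. \<tau> (\<psi> \<sigma>))"
      using p by (auto simp: conjugate_characters_def)
    have "\<phi> \<sigma> ^ m = 1" using tm[OF t(1) s] s by (simp add: t(2))
    then have "cmod (\<phi> \<sigma>) ^ m = 1 ^ m" by (metis norm_one norm_power power_one)
    from power_eq_imp_eq_base[OF this _ _ g(2)] show ?thesis by simp
  qed
  have at1: "\<phi> \<one>\<^bsub>Gab\<^esub> = 1" if p: "\<phi> \<in> conjugate_characters \<psi>" for \<phi>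
  proof -
    obtain \<tau> where t: "\<tau> \<in> carrier (galois_group Qbar \<rat>)" "\<phi> = (\<lambda>\<sigma>\<in>carrier Gab. \<tau> (\<psi> \<sigma>))"
      using p by (auto simp: conjugate_characters_def)
    show ?thesis using h.hom_one emb_one[OF Qbar_subfield emb[OF t(1)]] by (simp add: t(2))
  qed
  have r1: "rational_character \<psi> \<one>\<^bsub>Gab\<^esub> = of_nat (card (conjugate_characters \<psi>))"
    by (simp add: rational_character_def at1)
  have rs: "rational_character \<psi> \<sigma> = (\<Sum>\<phi>\<in>conjugate_characters \<psi>. \<phi> \<sigma>)" using s by (simp add: rational_character_def)
  have self: "\<psi> \<in> conjugate_characters \<psi>"
  proof -
    have e: "(\<lambda>\<sigma>\<in>carrier Gab. \<one>\<^bsub>galois_group Qbar \<rat>\<^esub> (\<psi> \<sigma>)) = \<psi>"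
    proof (rule extensionalityI[OF restrict_extensional linear_charactersD(2)[OF \<psi>]])
      fix \<sigma> assume "\<sigma> \<in> carrier Gab"
      then show "(\<lambda>\<sigma>\<in>carrier Gab. \<one>\<^bsub>galois_group Qbar \<rat>\<^esub> (\<psi> \<sigma>)) \<sigma> = \<psi> \<sigma>"
        using character_value_Qbar[OF \<psi>] by (simp add: gal_one[OF Qbar_subfield])
    qed
    have "(\<lambda>\<sigma>\<in>carrier Gab. \<one>\<^bsub>galois_group Qbar \<rat>\<^esub> (\<psi> \<sigma>)) \<in> conjugate_characters \<psi>"
      unfolding conjugate_characters_def by (rule image_eqI[OF refl Gb.one_closed])
    then show ?thesis unfolding e .
  qed
  show ?thesis
  proof
    assume p1: "\<psi> \<sigma> = 1"
    have one: "\<phi> \<sigma> = 1" if p: "\<phi> \<in> conjugate_characters \<psi>" for \<phi>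
    proof -
      obtain \<tau> where t: "\<tau> \<in> carrier (galois_group Qbar \<rat>)" "\<phi> = (\<lambda>\<sigma>\<in>carrier Gab. \<tau> (\<psi> \<sigma>))"
        using p by (auto simp: conjugate_characters_def)
      show ?thesis using p1 s emb_one[OF Qbar_subfield emb[OF t(1)]] by (simp add: t(2))
    qed
    have "(\<Sum>\<phi>\<in>conjugate_characters \<psi>. \<phi> \<sigma>) = (\<Sum>\<phi>\<in>conjugate_characters \<psi>. 1)"
      by (rule sum.cong[OF refl one])
    then show "rational_character \<psi> \<sigma> = rational_character \<psi> \<one>\<^bsub>Gab\<^esub>" by (simp add: r1 rs)
  next
    assume "rational_character \<psi> \<sigma> = rational_character \<psi> \<one>\<^bsub>Gab\<^esub>"
    then have "Re (\<Sum>\<phi>\<in>conjugate_characters \<psi>. \<phi> \<sigma>) = real (card (conjugate_characters \<psi>))" by (simp add: r1 rs)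
    then have "(\<Sum>\<phi>\<in>conjugate_characters \<psi>. 1 - Re (\<phi> \<sigma>)) = 0" by (simp add: sum_subtractf)
    moreover have "0 \<le> 1 - Re (\<phi> \<sigma>)" if "\<phi> \<in> conjugate_characters \<psi>" for \<phi>
      using norm1[OF that] complex_Re_le_cmod[of "\<phi> \<sigma>"] by simp
    ultimately have "1 - Re (\<psi> \<sigma>) = 0" using self fin by (simp add: sum_nonneg_eq_0_iff)
    then have "Re (\<psi> \<sigma>) = 1" by simp
    moreover have "Im (\<psi> \<sigma>) = 0"
      using norm1[OF self] calculation cmod_power2[of "\<psi> \<sigma>"] by simp
    ultimately show "\<psi> \<sigma> = 1" by (simp add: complex_eq_iff)
  qed
qed

lemma character_field_eq:
  assumes \<psi>: "\<psi> \<in> linear_characters"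
  shows "character_field (rational_character \<psi>) = fixed_field Qab (chker \<psi>)"
  unfolding character_field_def
proof (rule the_equality)
  show "\<exists>\<psi>'\<in>linear_characters. rational_character \<psi> = rational_character \<psi>' \<and> fixed_field Qab (chker \<psi>) = fixed_field Qab (chker \<psi>')"
    using \<psi> by blast
  fix L assume "\<exists>\<psi>'\<in>linear_characters. rational_character \<psi> = rational_character \<psi>' \<and> L = fixed_field Qab (chker \<psi>')"
  then obtain \<psi>' where p: "\<psi>' \<in> linear_characters" "rational_character \<psi> = rational_character \<psi>'" "L = fixed_field Qab (chker \<psi>')"
    by blast
  have "\<psi> \<sigma> = 1 \<longleftrightarrow> \<psi>' \<sigma> = 1" if "\<sigma> \<in> carrier Gab" for \<sigma>
    using rational_character_kernel[OF \<psi> that] rational_character_kernel[OF p(1) that] p(2) by simp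
  then have "chker \<psi> = chker \<psi>'" by (auto simp: chker_iff set_eq_iff)
  then show "L = fixed_field Qab (chker \<psi>)" using p(3) by simp
qed

lemma inj_character_field: "inj_on character_field irreducible_rational_characters"
proof (rule inj_onI)
  fix \<chi> \<chi>' assume "\<chi> \<in> irreducible_rational_characters" "\<chi>' \<in> irreducible_rational_characters"
    and eq: "character_field \<chi> = character_field \<chi>'"
  then obtain \<psi> \<psi>' where p: "\<psi> \<in> linear_characters" "\<chi> = rational_character \<psi>"
    "\<psi>' \<in> linear_characters" "\<chi>' = rational_character \<psi>'" by (auto simp: irreducible_rational_characters_def)
  have "fixed_field Qab (chker \<psi>) = fixed_field Qab (chker \<psi>')"
    using eq by (simp add: p(2,4) character_field_eq[OF p(1)] character_field_eq[OF p(3)])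
  then have "chker \<psi> = chker \<psi>'" using kernel_field(2)[OF p(1)] kernel_field(2)[OF p(3)] by metis
  then show "\<chi> = \<chi>'" using rational_character_cong[OF p(1,3)] p(2,4) by simp
qed

lemma character_field_cyclic:
  assumes \<psi>: "\<psi> \<in> linear_characters"
  shows "cyclic_group (galois_group (fixed_field Qab (chker \<psi>)) \<rat>)"
proof -
  define k where "k = fixed_field Qab (chker \<psi>)"
  note k = abelian_fieldsD[OF kernel_field(1)[OF \<psi>], folded k_def]
  interpret Ga: group Gab by (rule group_Gab)
  interpret h: group_hom Gab Cx \<psi> by (rule character_group_hom[OF \<psi>])
  interpret r: group_hom Gab "galois_group k \<rat>" "\<lambda>g. restrict g k" by (rule restrict_Gab_hom(1)[OF k(1,2)])
  obtain g m where g: "g \<in> carrier Gab" "m > 0" "\<And>\<sigma>. \<sigma> \<in> carrier Gab \<Longrightarrow> \<exists>i::nat. \<psi> \<sigma> = \<psi> g ^ i"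
    "\<And>i::nat. \<psi> g ^ i = 1 \<longleftrightarrow> m dvd i" by (rule character_generator[OF \<psi>]) (rule that)
  have "\<forall>\<tau>\<in>carrier (galois_group k \<rat>). \<exists>i::nat. \<tau> = restrict g k [^]\<^bsub>galois_group k \<rat>\<^esub> i"
  proof
    fix \<tau> assume "\<tau> \<in> carrier (galois_group k \<rat>)"
    then obtain \<sigma> where s: "\<sigma> \<in> carrier Gab" "\<tau> = restrict \<sigma> k"
      unfolding restrict_Gab_hom(2)[OF k(1,2), symmetric] by blast
    obtain i :: nat where i: "\<psi> \<sigma> = \<psi> g ^ i" using g(3)[OF s(1)] by blast
    have gi: "g [^]\<^bsub>Gab\<^esub> i \<in> carrier Gab" using g(1) by simp
    obtain \<rho> where r: "\<rho> \<in> carrier Gab" "\<sigma> = \<rho> \<otimes>\<^bsub>Gab\<^esub> g [^]\<^bsub>Gab\<^esub> i" "\<psi> \<rho> = 1"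
      by (rule character_decompose[OF \<psi> g(1) s(1) i]) (rule that)
    have "\<rho> \<in> carrier (galois_group Qab k)" using r(1,3) kernel_field(2)[OF \<psi>] by (simp add: k_def chker_iff)
    then have "restrict \<rho> k = \<one>\<^bsub>galois_group k \<rat>\<^esub>" using restrict_Gab_hom(3)[OF k(1,2) r(1)] by simp
    then have "\<tau> = restrict g k [^]\<^bsub>galois_group k \<rat>\<^esub> i"
      using r.hom_mult[OF r(1) gi] r.hom_nat_pow[OF g(1), of i] r.hom_closed[OF gi] by (simp add: s(2) r(2)[symmetric])
    then show "\<exists>i::nat. \<tau> = restrict g k [^]\<^bsub>galois_group k \<rat>\<^esub> i" by blast
  qed
  then have "cyclic_group (galois_group k \<rat>)"
    unfolding r.H.cyclic_group_iff_nat_pow[OF finite_galois_group[OF k(1,3)]] by (rule bexI[OF _ r.hom_closed[OF g(1)]])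
  then show ?thesis by (simp only: k_def)
qed

text \<open>Send a generator \<open>\<gamma>\<close> of the cyclic group \<open>Gal(k/\<rat>)\<close> of order \<open>m\<close> to a primitive \<open>m\<close>-th root of unity.\<close>

lemma faithful_character_exists:
  assumes k: "k \<in> abelian_fields" and cyc: "cyclic_group (galois_group k \<rat>)"
  obtains \<psi> where "\<psi> \<in> linear_characters" "fixed_field Qab (chker \<psi>) = k"
proof -
  note kf = abelian_fieldsD[OF k]
  interpret G: group Gab by (rule group_Gab)
  interpret r: group_hom Gab "galois_group k \<rat>" "\<lambda>g. restrict g k" by (rule restrict_Gab_hom(1)[OF kf(1,2)])
  have fink: "finite (carrier (galois_group k \<rat>))" by (rule finite_galois_group[OF kf(1,3)])
  obtain \<gamma> where g: "\<gamma> \<in> carrier (galois_group k \<rat>)"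
    "\<forall>\<tau>\<in>carrier (galois_group k \<rat>). \<exists>i::nat. \<tau> = \<gamma> [^]\<^bsub>galois_group k \<rat>\<^esub> i"
    using cyc unfolding r.H.cyclic_group_iff_nat_pow[OF fink] by blast
  define m where "m = r.H.ord \<gamma>"
  have m: "m > 0" using r.H.ord_ge_1[OF fink g(1)] by (simp add: m_def)
  have "\<forall>\<sigma>\<in>carrier Gab. \<exists>i::nat. restrict \<sigma> k = \<gamma> [^]\<^bsub>galois_group k \<rat>\<^esub> i" by (intro ballI bspec[OF g(2)] r.hom_closed)
  then obtain e :: "(complex \<Rightarrow> complex) \<Rightarrow> nat" where e: "\<And>\<sigma>. \<sigma> \<in> carrier Gab \<Longrightarrow> restrict \<sigma> k = \<gamma> [^]\<^bsub>galois_group k \<rat>\<^esub> e \<sigma>" by metis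
  define \<zeta> where "\<zeta> = cis (2 * pi / real m)"
  have zp: "\<zeta> ^ i = cis (2 * pi * real i / real m)" for i :: nat by (simp add: \<zeta>_def DeMoivre mult.commute)
  have zm: "\<zeta> ^ m = 1" using m by (simp add: zp)
  have z0: "\<zeta> \<noteq> 0" using zm m by (auto simp: power_0_left)
  have zmod: "\<zeta> ^ i = \<zeta> ^ (i mod m)" for i :: nat
  proof -
    have "\<zeta> ^ i = (\<zeta> ^ m) ^ (i div m) * \<zeta> ^ (i mod m)" by (simp add: power_mult[symmetric] power_add[symmetric])
    then show ?thesis by (simp add: zm)
  qed
  have z1: "\<zeta> ^ i = 1 \<longleftrightarrow> m dvd i" for i :: nat
  proof
    assume "\<zeta> ^ i = 1"
    then have "\<zeta> ^ (i mod m) = \<zeta> ^ 0" using zmod[of i] by simp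
    moreover have inj: "inj_on (\<lambda>i. \<zeta> ^ i) {..<m}" using bij_betw_roots_unity[OF m] by (simp add: bij_betw_def zp)
    ultimately have "i mod m = 0" using inj_onD[OF inj, of "i mod m" 0] m by simp
    then show "m dvd i" by auto
  next
    assume "m dvd i"
    then show "\<zeta> ^ i = 1" using zmod[of i] by (simp add: dvd_imp_mod_0)
  qed
  have zeq: "\<zeta> ^ i = \<zeta> ^ j" if "\<gamma> [^]\<^bsub>galois_group k \<rat>\<^esub> i = \<gamma> [^]\<^bsub>galois_group k \<rat>\<^esub> j" for i j :: nat
    using that
  proof (induction i j rule: linorder_wlog)
    case (le i j)
    then have "\<gamma> [^]\<^bsub>galois_group k \<rat>\<^esub> (j - i) = \<one>\<^bsub>galois_group k \<rat>\<^esub>" using g(1) by (simp add: r.H.pow_eq_div2)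
    then have "m dvd j - i" using r.H.pow_eq_id[OF g(1)] by (simp add: m_def)
    then have "\<zeta> ^ (j - i) = 1" using z1 by simp
    then have "\<zeta> ^ (j - i) * \<zeta> ^ i = \<zeta> ^ i" by simp
    then show ?case using le(1) by (simp add: power_add[symmetric])
  next
    case (sym i j)
    then show ?case by simp
  qed
  define \<psi> where "\<psi> = (\<lambda>\<sigma>\<in>carrier Gab. \<zeta> ^ e \<sigma>)"
  have ker: "chker \<psi> = carrier (galois_group Qab k)"
  proof -
    have "\<psi> \<sigma> = 1 \<longleftrightarrow> \<sigma> \<in> carrier (galois_group Qab k)" if s: "\<sigma> \<in> carrier Gab" for \<sigma>
    proof -
      have "\<psi> \<sigma> = 1 \<longleftrightarrow> m dvd e \<sigma>" using s z1 by (simp add: \<psi>_def)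
      also have "\<dots> \<longleftrightarrow> restrict \<sigma> k = \<one>\<^bsub>galois_group k \<rat>\<^esub>" using r.H.pow_eq_id[OF g(1)] e[OF s] by (simp add: m_def)
      also have "\<dots> \<longleftrightarrow> \<sigma> \<in> carrier (galois_group Qab k)" by (rule restrict_Gab_hom(3)[OF kf(1,2) s])
      finally show ?thesis .
    qed
    moreover have "carrier (galois_group Qab k) \<subseteq> carrier Gab" by (rule gal_mono[OF Qab_subfield subfield_Rats[OF kf(1)]])
    ultimately show ?thesis by (auto simp: chker_iff)
  qed
  have "\<psi> \<in> hom Gab Cx"
  proof (rule homI)
    fix \<sigma> assume "\<sigma> \<in> carrier Gab" then show "\<psi> \<sigma> \<in> carrier Cx" using z0 by (simp add: \<psi>_def)
    fix \<tau> assume t: "\<tau> \<in> carrier Gab" and s: "\<sigma> \<in> carrier Gab"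
    have "\<gamma> [^]\<^bsub>galois_group k \<rat>\<^esub> e (\<sigma> \<otimes>\<^bsub>Gab\<^esub> \<tau>) = restrict (\<sigma> \<otimes>\<^bsub>Gab\<^esub> \<tau>) k" using e s t by simp
    also have "\<dots> = \<gamma> [^]\<^bsub>galois_group k \<rat>\<^esub> (e \<sigma> + e \<tau>)"
      using r.hom_mult[OF s t] e[OF s] e[OF t] g(1) by (simp add: r.H.nat_pow_mult)
    finally have "\<zeta> ^ e (\<sigma> \<otimes>\<^bsub>Gab\<^esub> \<tau>) = \<zeta> ^ (e \<sigma> + e \<tau>)" by (rule zeq)
    then show "\<psi> (\<sigma> \<otimes>\<^bsub>Gab\<^esub> \<tau>) = \<psi> \<sigma> \<otimes>\<^bsub>Cx\<^esub> \<psi> \<tau>" using s t by (simp add: \<psi>_def power_add)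
  qed
  moreover have "\<psi> \<sigma> ^ m = 1" if "\<sigma> \<in> carrier Gab" for \<sigma>
  proof -
    have "(\<zeta> ^ e \<sigma>) ^ m = (\<zeta> ^ m) ^ e \<sigma>" by (simp add: power_mult[symmetric] mult.commute)
    then show ?thesis using that zm by (simp add: \<psi>_def)
  qed
  moreover have "\<psi> \<in> extensional (carrier Gab)" by (simp add: \<psi>_def)
  ultimately have "\<psi> \<in> linear_characters" using m k ker by (auto simp: linear_characters_def)
  moreover have "fixed_field Qab (chker \<psi>) = k"
    unfolding ker by (rule fixed_field_gal[OF Qab_subfield order.refl kf(1,2)])
  ultimately show ?thesis by (rule that)
qed

theorem character_field_image:
  assumes K: "K \<in> abelian_fields"
  shows "character_field ` characters_of_field K = {k. subfield k complex_field \<and> k \<subseteq> K \<and> cyclic_group (galois_group k \<rat>)}"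
proof
  show "character_field ` characters_of_field K \<subseteq> {k. subfield k complex_field \<and> k \<subseteq> K \<and> cyclic_group (galois_group k \<rat>)}"
  proof clarify
    fix \<chi> assume c: "\<chi> \<in> characters_of_field K"
    then obtain \<psi> where p: "\<psi> \<in> linear_characters" "\<chi> = rational_character \<psi>" "character_field \<chi> \<subseteq> K"
      by (auto simp: characters_of_field_def irreducible_rational_characters_def)
    note e = character_field_eq[OF p(1), folded p(2)]
    show "subfield (character_field \<chi>) complex_field \<and> character_field \<chi> \<subseteq> K \<and> cyclic_group (galois_group (character_field \<chi>) \<rat>)"
      using p(3) abelian_fieldsD(1)[OF kernel_field(1)[OF p(1)]] character_field_cyclic[OF p(1)] by (simp add: e)
  qed
  show "{k. subfield k complex_field \<and> k \<subseteq> K \<and> cyclic_group (galois_group k \<rat>)} \<subseteq> character_field ` characters_of_field K"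
  proof clarify
    fix k assume k: "subfield k complex_field" "k \<subseteq> K" "cyclic_group (galois_group k \<rat>)"
    obtain \<psi> where p: "\<psi> \<in> linear_characters" "fixed_field Qab (chker \<psi>) = k"
      by (rule faithful_character_exists[OF abelian_fields_sub[OF K k(1,2)] k(3)]) (rule that)
    have e: "character_field (rational_character \<psi>) = k" using character_field_eq[OF p(1)] p(2) by simp
    then have "rational_character \<psi> \<in> characters_of_field K"
      using p(1) k(2) by (simp add: characters_of_field_def irreducible_rational_characters_def)
    then show "k \<in> character_field ` characters_of_field K" using e by blast
  qed
qed

section \<open>Tensor products of abelian groups\<close>

locale tensor_product = A: comm_group A for A :: "'a monoid" (structure) +
  fixes B :: "'b monoid"
  assumes B_closed: "\<lbrakk>z \<in> carrier B; z' \<in> carrier B\<rbrakk> \<Longrightarrow> z \<otimes>\<^bsub>B\<^esub> z' \<in> carrier B"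
begin

definition free :: "('a \<times> 'b \<Rightarrow>\<^sub>0 int) monoid" where
  "free = free_Abelian_group (carrier A \<times> carrier B)"

definition relations :: "('a \<times> 'b \<Rightarrow>\<^sub>0 int) set" where
  "relations = generate free (bilinear_relations A B)"

definition T :: "('a \<times> 'b \<Rightarrow>\<^sub>0 int) set monoid" where
  "T = tensor_Z A B"

definition pure :: "'a \<Rightarrow> 'b \<Rightarrow> ('a \<times> 'b \<Rightarrow>\<^sub>0 int) set" where
  "pure a z = relations #>\<^bsub>free\<^esub> frag_of (a, z)"

lemma T_eq: "T = free Mod relations"
  by (simp add: T_def tensor_Z_def Let_def free_def relations_def)

lemma comm_group_free: "comm_group free"
  unfolding free_def by (rule abelian_free_Abelian_group)

lemma free_simps: "x \<otimes>\<^bsub>free\<^esub> y = x + y" "\<one>\<^bsub>free\<^esub> = 0"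
  by (simp_all add: free_def)

lemma free_carrier: "x \<in> carrier free \<longleftrightarrow> Poly_Mapping.keys x \<subseteq> carrier A \<times> carrier B"
  by (simp add: free_def)

lemma inv_free: "x \<in> carrier free \<Longrightarrow> inv\<^bsub>free\<^esub> x = - x"
  by (simp add: free_def)

lemma diff_free: "\<lbrakk>x \<in> carrier free; y \<in> carrier free\<rbrakk> \<Longrightarrow> x - y \<in> carrier free"
  using keys_diff[of x y] by (auto simp: free_carrier)

lemma frag_free: "\<lbrakk>a \<in> carrier A; z \<in> carrier B\<rbrakk> \<Longrightarrow> frag_of (a, z) \<in> carrier free"
  by (simp add: free_carrier)

lemma bilinear_relation_cases:
  assumes "x \<in> bilinear_relations A B"
  obtains (left) a a' b where "x = frag_of (a \<otimes> a', b) - frag_of (a, b) - frag_of (a', b)"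
      "a \<in> carrier A" "a' \<in> carrier A" "b \<in> carrier B"
    | (right) a b b' where "x = frag_of (a, b \<otimes>\<^bsub>B\<^esub> b') - frag_of (a, b) - frag_of (a, b')"
      "a \<in> carrier A" "b \<in> carrier B" "b' \<in> carrier B"
  using assms unfolding bilinear_relations_def by blast

lemma bilinear_relations_free: "bilinear_relations A B \<subseteq> carrier free"
proof
  fix x assume "x \<in> bilinear_relations A B"
  then show "x \<in> carrier free"
  proof (cases rule: bilinear_relation_cases)
    case (left a a' b)
    then show ?thesis unfolding left(1) by (intro diff_free frag_free A.m_closed)
  next
    case (right a b b')
    then show ?thesis unfolding right(1) by (intro diff_free frag_free B_closed)
  qed
qed

lemma normal_relations: "relations \<lhd> free"
proof -
  interpret F: comm_group free by (rule comm_group_free)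
  show ?thesis unfolding relations_def
    by (rule F.subgroup_imp_normal[OF F.generate_is_subgroup[OF bilinear_relations_free]])
qed

lemma subgroup_relations: "subgroup relations free"
  by (rule normal_imp_subgroup[OF normal_relations])

lemma comm_group_T: "comm_group T"
proof -
  interpret F: comm_group free by (rule comm_group_free)
  show ?thesis unfolding T_eq by (rule F.abelian_FactGroup[OF subgroup_relations])
qed

sublocale T: comm_group T by (rule comm_group_T)

lemma coset_T: "x \<in> carrier free \<Longrightarrow> relations #>\<^bsub>free\<^esub> x \<in> carrier T"
  unfolding T_eq FactGroup_def RCOSETS_def by auto

lemma coset_eq:
  assumes "x \<in> carrier free" "y \<in> carrier free" "x - y \<in> relations"
  shows "relations #>\<^bsub>free\<^esub> x = relations #>\<^bsub>free\<^esub> y"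
proof -
  interpret F: comm_group free by (rule comm_group_free)
  show ?thesis using F.rcos_eq_iff[OF subgroup_relations assms(1,2)] assms by (simp add: free_simps inv_free)
qed

lemma coset_add:
  assumes "x \<in> carrier free" "y \<in> carrier free"
  shows "(relations #>\<^bsub>free\<^esub> x) \<otimes>\<^bsub>T\<^esub> (relations #>\<^bsub>free\<^esub> y) = relations #>\<^bsub>free\<^esub> (x + y)"
proof -
  interpret R: normal relations free by (rule normal_relations)
  show ?thesis using R.rcos_sum[OF assms] by (simp add: T_eq free_simps)
qed

lemma pure_closed: "\<lbrakk>a \<in> carrier A; z \<in> carrier B\<rbrakk> \<Longrightarrow> pure a z \<in> carrier T"
  unfolding pure_def by (intro coset_T frag_free)

lemma pure_sum_if_relation:
  assumes "u \<in> carrier A \<times> carrier B" "v \<in> carrier A \<times> carrier B" "w \<in> carrier A \<times> carrier B"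
    and "frag_of w - frag_of u - frag_of v \<in> bilinear_relations A B"
  shows "relations #>\<^bsub>free\<^esub> frag_of w = (relations #>\<^bsub>free\<^esub> frag_of u) \<otimes>\<^bsub>T\<^esub> (relations #>\<^bsub>free\<^esub> frag_of v)"
proof -
  interpret F: comm_group free by (rule comm_group_free)
  have c: "frag_of u \<in> carrier free" "frag_of v \<in> carrier free" "frag_of w \<in> carrier free"
    using assms(1-3) by (simp_all add: free_carrier)
  have "frag_of u + frag_of v \<in> carrier free" using F.m_closed[OF c(1,2)] by (simp add: free_simps)
  moreover have "frag_of w - (frag_of u + frag_of v) \<in> relations"
    unfolding relations_def by (rule generate.incl) (use assms(4) in \<open>simp add: diff_diff_eq\<close>)
  ultimately show ?thesis using c by (simp add: coset_add coset_eq)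
qed

lemma pure_left:
  assumes "a \<in> carrier A" "a' \<in> carrier A" "z \<in> carrier B"
  shows "pure (a \<otimes> a') z = pure a z \<otimes>\<^bsub>T\<^esub> pure a' z"
proof -
  have "frag_of (a \<otimes> a', z) - frag_of (a, z) - frag_of (a', z) \<in> bilinear_relations A B"
    unfolding bilinear_relations_def using assms by blast
  then show ?thesis unfolding pure_def using assms by (intro pure_sum_if_relation) auto
qed

lemma pure_right:
  assumes "a \<in> carrier A" "z \<in> carrier B" "z' \<in> carrier B"
  shows "pure a (z \<otimes>\<^bsub>B\<^esub> z') = pure a z \<otimes>\<^bsub>T\<^esub> pure a z'"
proof -
  have "frag_of (a, z \<otimes>\<^bsub>B\<^esub> z') - frag_of (a, z) - frag_of (a, z') \<in> bilinear_relations A B"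
    unfolding bilinear_relations_def using assms by blast
  then show ?thesis unfolding pure_def using assms B_closed by (intro pure_sum_if_relation) auto
qed

lemma pure_hom: "z \<in> carrier B \<Longrightarrow> group_hom A T (\<lambda>a. pure a z)"
  by (intro group_hom.intro group_hom_axioms.intro A.is_group T.is_group homI pure_closed pure_left)

lemma pure_pow:
  "\<lbrakk>a \<in> carrier A; z \<in> carrier B\<rbrakk> \<Longrightarrow> pure (a [^] (m::nat)) z = pure a z [^]\<^bsub>T\<^esub> m"
  by (rule group_hom.hom_nat_pow[OF pure_hom])

text \<open>The pure tensors generate, so surjectivity onto the tensor product can be checked on them.\<close>

lemma subgroup_containing_pure:
  assumes S: "subgroup S T" and gen: "\<And>a z. \<lbrakk>a \<in> carrier A; z \<in> carrier B\<rbrakk> \<Longrightarrow> pure a z \<in> S"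
  shows "S = carrier T"
proof
  interpret S: subgroup S T by (rule S)
  interpret F: comm_group free by (rule comm_group_free)
  show "S \<subseteq> carrier T" by (rule S.subset)
  have "relations #>\<^bsub>free\<^esub> x \<in> S" if x: "x \<in> carrier free" for x
  proof -
    have "Poly_Mapping.keys x \<subseteq> carrier A \<times> carrier B" using x by (simp add: free_carrier)
    then have "x \<in> carrier free \<and> relations #>\<^bsub>free\<^esub> x \<in> S"
    proof (induction x rule: frag_induction)
      case zero
      have "\<one>\<^bsub>T\<^esub> = relations" unfolding T_eq by simp
      then have "relations #>\<^bsub>free\<^esub> 0 = \<one>\<^bsub>T\<^esub>"
        using F.coset_mult_one[OF subgroup.subset[OF subgroup_relations]] by (simp add: free_simps)
      then show ?case using S.one_closed F.one_closed by (simp add: free_simps)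
    next
      case (one x)
      then show ?case using gen frag_free by (cases x) (auto simp: pure_def)
    next
      case (diff x y)
      have d: "x - y \<in> carrier free" using diff diff_free by blast
      have t: "relations #>\<^bsub>free\<^esub> x \<in> carrier T" "relations #>\<^bsub>free\<^esub> y \<in> carrier T"
          "relations #>\<^bsub>free\<^esub> (x - y) \<in> carrier T"
        using diff d coset_T by auto
      have "(relations #>\<^bsub>free\<^esub> (x - y)) \<otimes>\<^bsub>T\<^esub> (relations #>\<^bsub>free\<^esub> y) = relations #>\<^bsub>free\<^esub> x"
        using coset_add[OF d, of y] diff by simp
      then have "relations #>\<^bsub>free\<^esub> (x - y)
          = (relations #>\<^bsub>free\<^esub> x) \<otimes>\<^bsub>T\<^esub> inv\<^bsub>T\<^esub> (relations #>\<^bsub>free\<^esub> y)"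
        by (metis T.inv_solve_right t)
      then show ?case using d diff S.m_closed S.m_inv_closed by simp
    qed
    then show ?thesis by simp
  qed
  then show "carrier T \<subseteq> S"
    unfolding T_eq FactGroup_def RCOSETS_def by auto
qed

text \<open>The part of the universal property that serves to detect nontrivial tensors: a bilinear map is trivial on a
pair whose tensor is trivial.\<close>

lemma bilinear_eq_one_if_pure_eq_one:
  assumes C: "comm_group C"
    and f: "\<And>a z. \<lbrakk>a \<in> carrier A; z \<in> carrier B\<rbrakk> \<Longrightarrow> f a z \<in> carrier C"
    and left: "\<And>a a' z. \<lbrakk>a \<in> carrier A; a' \<in> carrier A; z \<in> carrier B\<rbrakk>
      \<Longrightarrow> f (a \<otimes> a') z = f a z \<otimes>\<^bsub>C\<^esub> f a' z"
    and right: "\<And>a z z'. \<lbrakk>a \<in> carrier A; z \<in> carrier B; z' \<in> carrier B\<rbrakk>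
      \<Longrightarrow> f a (z \<otimes>\<^bsub>B\<^esub> z') = f a z \<otimes>\<^bsub>C\<^esub> f a z'"
    and az: "a \<in> carrier A" "z \<in> carrier B" "pure a z = \<one>\<^bsub>T\<^esub>"
  shows "f a z = \<one>\<^bsub>C\<^esub>"
proof -
  interpret C: comm_group C by (rule C)
  interpret F: comm_group free by (rule comm_group_free)
  have "(\<lambda>(a, z). f a z) ` (carrier A \<times> carrier B) \<subseteq> carrier C" using f by auto
  then obtain h where h0: "h \<in> hom free C" and
      h1: "\<And>x. x \<in> carrier A \<times> carrier B \<Longrightarrow> h (frag_of x) = (\<lambda>(a, z). f a z) x"
    unfolding free_def using C.free_Abelian_group_universal by blast
  have h: "h (frag_of (a, z)) = f a z" if "a \<in> carrier A" "z \<in> carrier B" for a z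
    using h1[of "(a, z)"] that by simp
  interpret h: group_hom free C h
    using h0 F.is_group C.is_group by (simp add: group_hom_def group_hom_axioms_def)
  \<comment> \<open>A homomorphism kills a relation \<open>w - u - v\<close> as soon as it turns it into a product.\<close>
  have triangle: "h (w - u - v) = \<one>\<^bsub>C\<^esub>"
    if c: "u \<in> carrier free" "v \<in> carrier free" "w \<in> carrier free" and e: "h w = h u \<otimes>\<^bsub>C\<^esub> h v" for u v w
  proof -
    have d: "w - u - v \<in> carrier free" using c by (intro diff_free)
    have "h ((w - u - v) + (u + v)) = h (w - u - v) \<otimes>\<^bsub>C\<^esub> (h u \<otimes>\<^bsub>C\<^esub> h v)"
      using h.hom_mult[OF d F.m_closed[OF c(1,2)]] h.hom_mult[OF c(1,2)] by (simp add: free_simps)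
    then have eq: "h u \<otimes>\<^bsub>C\<^esub> h v = h (w - u - v) \<otimes>\<^bsub>C\<^esub> (h u \<otimes>\<^bsub>C\<^esub> h v)" using e by (simp add: algebra_simps)
    have "h u \<otimes>\<^bsub>C\<^esub> h v \<in> carrier C" using c by (intro C.m_closed h.hom_closed)
    then show ?thesis using C.r_cancel_one'[OF _ h.hom_closed[OF d], of "h u \<otimes>\<^bsub>C\<^esub> h v"] eq by simp
  qed
  have "bilinear_relations A B \<subseteq> {x \<in> carrier free. h x = \<one>\<^bsub>C\<^esub>}"
  proof
    fix x assume x: "x \<in> bilinear_relations A B"
    then have "h x = \<one>\<^bsub>C\<^esub>"
    proof (cases rule: bilinear_relation_cases)
      case (left a a' b)
      then show ?thesis unfolding left(1) using assms(3) by (intro triangle frag_free A.m_closed) (simp_all add: h)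
    next
      case (right a b b')
      then show ?thesis unfolding right(1) using assms(4) by (intro triangle frag_free B_closed) (simp_all add: h B_closed)
    qed
    then show "x \<in> {x \<in> carrier free. h x = \<one>\<^bsub>C\<^esub>}" using x bilinear_relations_free by auto
  qed
  moreover have "subgroup {x \<in> carrier free. h x = \<one>\<^bsub>C\<^esub>} free"
    using h.subgroup_kernel by (simp add: kernel_def)
  ultimately have "relations \<subseteq> {x \<in> carrier free. h x = \<one>\<^bsub>C\<^esub>}"
    unfolding relations_def by (rule F.generate_subgroup_incl)
  moreover have "\<one>\<^bsub>T\<^esub> = relations" unfolding T_eq by simp
  then have "frag_of (a, z) \<in> relations"
    using az(3) F.rcos_self[OF frag_free[OF az(1,2)] subgroup_relations] by (simp add: pure_def)
  ultimately show ?thesis using h[OF az(1,2)] by auto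
qed

end

section \<open>The order of the tensor product with the p-adic integers\<close>

lemma prime_power_if_unique_prime_factor:
  assumes "n > 0" "Factorial_Ring.prime (p::nat)" "\<And>q. Factorial_Ring.prime q \<Longrightarrow> q dvd n \<Longrightarrow> q = p"
  shows "n = p ^ multiplicity p n"
proof -
  have "n \<noteq> 0" "\<not> is_unit p" using assms(1,2) by (auto simp: not_prime_unit)
  then obtain x where x: "n = p ^ multiplicity p n * x" "\<not> p dvd x" using multiplicity_decompose' by blast
  have "x = 1"
  proof (rule ccontr)
    assume "x \<noteq> 1"
    then obtain q where q: "Factorial_Ring.prime q" "q dvd x" using prime_factor_nat by blast
    then have "q dvd n" using x(1) by (metis dvd_mult)
    then show False using assms(3)[OF q(1)] q(2) x(2) by simp
  qed
  then show ?thesis using x(1) by simp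
qed

definition padic_group :: "nat \<Rightarrow> (nat \<Rightarrow> int) monoid" where
  "padic_group p = add_monoid (padic_integers p)"

locale prime_number = fixes p :: nat assumes p: "Factorial_Ring.prime p"
begin

abbreviation Zp :: "(nat \<Rightarrow> int) monoid" where "Zp \<equiv> padic_group p"

lemma Zp_carrier: "x \<in> carrier Zp \<longleftrightarrow> (\<forall>n. x n \<in> {0..<int p ^ n} \<and> x (Suc n) mod int p ^ n = x n)"
  by (simp add: padic_group_def padic_integers_def)

lemma Zp_mult: "x \<otimes>\<^bsub>Zp\<^esub> y = (\<lambda>n. (x n + y n) mod int p ^ n)"
  by (simp add: padic_group_def padic_integers_def)

lemma pn_pos: "int p ^ n > 0" using prime_gt_0_nat[OF p] by simp

lemma mod_Suc_pn: "a mod int p ^ Suc n mod int p ^ n = a mod int p ^ n"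
  by (simp add: mod_mod_cancel)

lemma Zp_D: "x \<in> carrier Zp \<Longrightarrow> x n mod int p ^ n = x n" "x \<in> carrier Zp \<Longrightarrow> x (Suc n) mod int p ^ n = x n"
  "x \<in> carrier Zp \<Longrightarrow> 0 \<le> x n"
  by (simp_all add: Zp_carrier)

lemma Zp_coherent: "x \<in> carrier Zp \<Longrightarrow> x (n + k) mod int p ^ n = x n"
proof (induction k)
  case (Suc k)
  have "x (n + Suc k) mod int p ^ n = x (Suc (n + k)) mod int p ^ (n + k) mod int p ^ n"
    by (simp add: mod_mod_cancel le_imp_power_dvd)
  then show ?case using Suc Zp_D(2) by simp
qed (simp add: Zp_D)

text \<open>Coherent sequences of residues, from integers that need not be reduced.\<close>

definition reduce :: "(nat \<Rightarrow> int) \<Rightarrow> nat \<Rightarrow> int" where "reduce f = (\<lambda>n. f n mod int p ^ n)"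

lemma reduce_in: "(\<And>n. f (Suc n) mod int p ^ n = f n mod int p ^ n) \<Longrightarrow> reduce f \<in> carrier Zp"
  using pn_pos unfolding Zp_carrier reduce_def by (simp add: mod_mod_cancel)

lemma Zp_closed: "x \<in> carrier Zp \<Longrightarrow> y \<in> carrier Zp \<Longrightarrow> x \<otimes>\<^bsub>Zp\<^esub> y \<in> carrier Zp"
proof -
  assume x: "x \<in> carrier Zp" and y: "y \<in> carrier Zp"
  have "reduce (\<lambda>n. x n + y n) \<in> carrier Zp"
    by (rule reduce_in) (metis Zp_D(1,2) mod_add_eq x y)
  then show ?thesis by (simp add: Zp_mult reduce_def)
qed

definition nmul :: "nat \<Rightarrow> (nat \<Rightarrow> int) \<Rightarrow> nat \<Rightarrow> int" where
  "nmul m w = reduce (\<lambda>n. int m * w n)"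

lemma nmul_in: "w \<in> carrier Zp \<Longrightarrow> nmul m w \<in> carrier Zp"
  unfolding nmul_def by (rule reduce_in) (metis Zp_D(1,2) mod_mult_right_eq)

lemma nmul_0: "nmul 0 w \<otimes>\<^bsub>Zp\<^esub> nmul 0 w = nmul 0 w"
  by (simp add: nmul_def reduce_def Zp_mult)

lemma nmul_Suc: "w \<in> carrier Zp \<Longrightarrow> nmul (Suc m) w = nmul m w \<otimes>\<^bsub>Zp\<^esub> w"
  by (simp add: nmul_def reduce_def Zp_mult mod_simps algebra_simps)

definition padic_one :: "nat \<Rightarrow> int" where "padic_one = reduce (\<lambda>n. 1)"

lemma padic_one_in: "padic_one \<in> carrier Zp" unfolding padic_one_def by (rule reduce_in) simp

text \<open>Subtracting the residue modulo \<open>p^e\<close> leaves \<open>p^e\<close> times the sequence of the \<open>z (n + e) div p^e\<close>.\<close>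

lemma Zp_split:
  assumes z: "z \<in> carrier Zp"
  obtains w where "w \<in> carrier Zp" "z = nmul (nat (z e)) padic_one \<otimes>\<^bsub>Zp\<^esub> nmul (p ^ e) w"
proof -
  define w where "w n = z (n + e) div int p ^ e" for n
  have w: "w \<in> carrier Zp" unfolding Zp_carrier
  proof (intro allI conjI)
    fix n
    have z2: "z (n + e) < int p ^ n * int p ^ e" "0 \<le> z (n + e)"
      using z unfolding Zp_carrier by (auto simp: power_add[symmetric])
    then have "z (n + e) div int p ^ e < int p ^ n"
    proof -
      have "z (n + e) div int p ^ e * int p ^ e \<le> z (n + e)" 
        using pos_mod_sign[OF pn_pos[of e], of "z (n + e)"] by (simp add: minus_mod_eq_div_mult[symmetric])
      then have "z (n + e) div int p ^ e * int p ^ e < int p ^ n * int p ^ e" using z2(1) by linarith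
      then show ?thesis using pn_pos[of e] by (simp only: mult_less_cancel_right_pos)
    qed
    then show "w n \<in> {0..<int p ^ n}" using z2(2) pn_pos[of e] by (simp add: w_def pos_imp_zdiv_nonneg_iff)
    have "z (Suc n + e) mod (int p ^ e * int p ^ n) = z (n + e)"
      using Zp_D(2)[OF z, of "n + e"] by (simp add: power_add mult.commute)
    moreover have "z (Suc n + e) mod (int p ^ e * int p ^ n)
       = int p ^ e * (z (Suc n + e) div int p ^ e mod int p ^ n) + z (Suc n + e) mod int p ^ e"
      by (rule zmod_zmult2_eq) simp
    ultimately have "z (n + e) div int p ^ e
       = (int p ^ e * (z (Suc n + e) div int p ^ e mod int p ^ n) + z (Suc n + e) mod int p ^ e) div int p ^ e" by simp
    also have "\<dots> = z (Suc n + e) div int p ^ e mod int p ^ n"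
      using pn_pos[of e] by (simp add: div_add1_eq)
    finally show "w (Suc n) mod int p ^ n = w n" by (simp add: w_def)
  qed
  have "z n = (nmul (nat (z e)) padic_one \<otimes>\<^bsub>Zp\<^esub> nmul (p ^ e) w) n" for n
  proof -
    have "(nmul (nat (z e)) padic_one \<otimes>\<^bsub>Zp\<^esub> nmul (p ^ e) w) n = (z e + int p ^ e * w n) mod int p ^ n"
      using Zp_D(3)[OF z, of e] by (simp add: nmul_def reduce_def padic_one_def Zp_mult mod_simps)
    also have "z e + int p ^ e * w n = z (n + e)"
      using Zp_coherent[OF z, of e n] mod_mult_div_eq[of "z (e + n)" "int p ^ e"]
      by (simp add: w_def add.commute[of n e])
    also have "z (n + e) mod int p ^ n = z n" by (rule Zp_coherent[OF z])
    finally show ?thesis by simp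
  qed
  then have "z = nmul (nat (z e)) padic_one \<otimes>\<^bsub>Zp\<^esub> nmul (p ^ e) w" by (rule ext)
  then show ?thesis using that w by blast
qed

text \<open>Integers prime to \<open>p\<close> are units: \<open>r\<close> has an inverse modulo every \<open>p^n\<close>, and the quotients are coherent because
they are unique.\<close>

lemma Zp_divisible:
  assumes w: "w \<in> carrier Zp" and r: "\<not> p dvd r"
  obtains v where "v \<in> carrier Zp" "w = nmul r v"
proof -
  have cop: "coprime (int r) (int p ^ n)" for n
    using r p by (metis coprime_commute coprime_int_iff coprime_power_right_iff prime_imp_coprime_nat)
  have "\<exists>y. y \<in> {0..<int p ^ n} \<and> (int r * y) mod int p ^ n = w n" for n
  proof -
    obtain a b where "a * int r + b * int p ^ n = gcd (int r) (int p ^ n)" using bezout_int by blast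
    then have ab: "a * int r + b * int p ^ n = 1" using cop[of n] by simp
    define y where "y = (a * w n) mod int p ^ n"
    have "(int r * y) mod int p ^ n = (int r * (a * w n)) mod int p ^ n" by (simp add: y_def mod_simps)
    also have "int r * (a * w n) = w n - (b * w n) * int p ^ n"
    proof -
      have "int r * (a * w n) = (a * int r + b * int p ^ n) * w n - (b * w n) * int p ^ n" by (simp add: algebra_simps)
      then show ?thesis by (simp add: ab)
    qed
    also have "(w n - (b * w n) * int p ^ n) mod int p ^ n = w n mod int p ^ n"
      by (metis mod_mult_self1 diff_add_cancel)
    also have "\<dots> = w n" by (rule Zp_D(1)[OF w])
    finally show ?thesis using pn_pos[of n] by (intro exI[of _ y]) (simp add: y_def)
  qed
  then obtain v where v: "\<And>n. v n \<in> {0..<int p ^ n}" "\<And>n. (int r * v n) mod int p ^ n = w n" by metis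
  have "v (Suc n) mod int p ^ n = v n" for n
  proof -
    have "(int r * v (Suc n)) mod int p ^ n = (int r * v (Suc n)) mod int p ^ Suc n mod int p ^ n"
      by (simp only: mod_Suc_pn)
    also have "\<dots> = (int r * v n) mod int p ^ n" using v(2)[of "Suc n"] v(2)[of n] Zp_D(2)[OF w, of n] by simp
    finally have "int p ^ n dvd int r * v (Suc n) - int r * v n" by (simp add: mod_eq_dvd_iff)
    then have "int p ^ n dvd int r * (v (Suc n) - v n)" by (simp add: right_diff_distrib)
    then have "int p ^ n dvd v (Suc n) - v n" using cop[of n] by (metis coprime_commute coprime_dvd_mult_right_iff)
    then have "v (Suc n) mod int p ^ n = v n mod int p ^ n" by (simp add: mod_eq_dvd_iff)
    then show ?thesis using v(1)[of n] by simp
  qed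
  then have "v \<in> carrier Zp" using v(1) by (simp add: Zp_carrier)
  moreover have "w = nmul r v" using v(2) by (auto simp: nmul_def reduce_def)
  ultimately show ?thesis by (rule that)
qed

end

locale finite_tensor_Zp = prime_number p + tensor_product A "padic_group p" for p and A :: "'a monoid" +
  assumes finA: "finite (carrier A)"
begin

lemma pure_nmul:
  assumes a: "a \<in> carrier A" and z: "z \<in> carrier Zp"
  shows "pure a (nmul m z) = pure a z [^]\<^bsub>T\<^esub> m"
proof (induction m)
  case 0
  have c: "pure a (nmul 0 z) \<in> carrier T" by (rule pure_closed[OF a nmul_in[OF z]])
  have "pure a (nmul 0 z) \<otimes>\<^bsub>T\<^esub> pure a (nmul 0 z) = pure a (nmul 0 z)"
    using pure_right[OF a nmul_in[OF z] nmul_in[OF z], of 0 0] by (simp add: nmul_0)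
  then show ?case using T.r_cancel_one[OF c c] by simp
next
  case (Suc m)
  then show ?case using pure_right[OF a nmul_in[OF z] z, of m] by (simp add: nmul_Suc[OF z])
qed

definition expo :: nat where "expo = multiplicity p (card (carrier A))"
definition cofactor :: nat where "cofactor = card (carrier A) div p ^ expo"

lemma card_A_pos: "card (carrier A) > 0" using A.one_closed finA by (auto simp: card_gt_0_iff)

lemma card_A: "card (carrier A) = p ^ expo * cofactor" by (simp add: cofactor_def expo_def multiplicity_dvd)

lemma not_dvd_cofactor: "\<not> p dvd cofactor"
  unfolding cofactor_def expo_def
  by (rule multiplicity_decompose) (use card_A_pos p in \<open>auto simp: not_prime_unit\<close>)

lemma pow_card: "a \<in> carrier A \<Longrightarrow> (a [^]\<^bsub>A\<^esub> (p ^ expo)) [^]\<^bsub>A\<^esub> cofactor = \<one>\<^bsub>A\<^esub>"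
  using A.pow_order_eq_1[of a] card_A by (simp add: A.nat_pow_pow Coset.order_def)

text \<open>Write \<open>z\<close> as \<open>cofactor\<close> times \<open>v\<close> and move the factor to the left.\<close>

lemma pure_of_cofactor_torsion:
  assumes a: "a \<in> carrier A" "a [^]\<^bsub>A\<^esub> cofactor = \<one>\<^bsub>A\<^esub>" and z: "z \<in> carrier Zp"
  shows "pure a z = \<one>\<^bsub>T\<^esub>"
proof -
  obtain v where v: "v \<in> carrier Zp" "z = nmul cofactor v" by (rule Zp_divisible[OF z not_dvd_cofactor])
  have "pure a z = pure (a [^]\<^bsub>A\<^esub> cofactor) v" using pure_nmul[OF a(1) v(1)] pure_pow[OF a(1) v(1)] v(2) by simp
  also have "\<dots> = \<one>\<^bsub>T\<^esub>" using group_hom.hom_one[OF pure_hom[OF v(1)]] a(2) by simp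
  finally show ?thesis .
qed

text \<open>The part of \<open>z\<close> divisible by \<open>p ^ expo\<close> contributes nothing: moved to the left, that factor gives an element
of prime-to-\<open>p\<close> order.\<close>

lemma pure_eq_pure_one:
  assumes a: "a \<in> carrier A" and z: "z \<in> carrier Zp"
  shows "pure a z = pure (a [^]\<^bsub>A\<^esub> nat (z expo)) padic_one"
proof -
  obtain w where w: "w \<in> carrier Zp" "z = nmul (nat (z expo)) padic_one \<otimes>\<^bsub>Zp\<^esub> nmul (p ^ expo) w"
    by (rule Zp_split[OF z])
  have "pure a z = pure a (nmul (nat (z expo)) padic_one \<otimes>\<^bsub>Zp\<^esub> nmul (p ^ expo) w)"
    by (rule arg_cong[OF w(2)])
  also have "\<dots> = pure a (nmul (nat (z expo)) padic_one) \<otimes>\<^bsub>T\<^esub> pure a (nmul (p ^ expo) w)"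
    by (rule pure_right[OF a nmul_in[OF padic_one_in] nmul_in[OF w(1)]])
  also have "pure a (nmul (p ^ expo) w) = pure (a [^]\<^bsub>A\<^esub> (p ^ expo)) w"
    using pure_nmul[OF a w(1)] pure_pow[OF a w(1)] by simp
  also have "\<dots> = \<one>\<^bsub>T\<^esub>" by (rule pure_of_cofactor_torsion[OF _ pow_card[OF a] w(1)]) (use a in simp)
  also have "pure a (nmul (nat (z expo)) padic_one) = pure (a [^]\<^bsub>A\<^esub> nat (z expo)) padic_one"
    using pure_nmul[OF a padic_one_in] pure_pow[OF a padic_one_in] by simp
  finally show ?thesis using pure_closed[OF A.nat_pow_closed[OF a] padic_one_in] by simp
qed

lemma range_pure_one: "(\<lambda>a. pure a padic_one) ` carrier A = carrier T"
proof (rule subgroup_containing_pure)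
  interpret h: group_hom A T "\<lambda>a. pure a padic_one" by (rule pure_hom[OF padic_one_in])
  show "subgroup ((\<lambda>a. pure a padic_one) ` carrier A) T" by (rule h.img_is_subgroup)
  fix a z assume "a \<in> carrier A" "z \<in> carrier Zp"
  then show "pure a z \<in> (\<lambda>a. pure a padic_one) ` carrier A" using pure_eq_pure_one A.nat_pow_closed by auto
qed

text \<open>The bilinear map that takes \<open>(a, z)\<close> to the \<open>cofactor\<close>-th power of \<open>a\<close>, raised to the residue of \<open>z\<close>
modulo \<open>p ^ expo\<close>, detects the \<open>p\<close>-part of \<open>a\<close>.\<close>

lemma cofactor_torsion_of_pure_one:
  assumes a: "a \<in> carrier A" and t: "pure a padic_one = \<one>\<^bsub>T\<^esub>"
  shows "a [^]\<^bsub>A\<^esub> cofactor = \<one>\<^bsub>A\<^esub>"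
proof -
  define f where "f a z = (a [^]\<^bsub>A\<^esub> cofactor) [^]\<^bsub>A\<^esub> nat (z expo)" for a and z :: "nat \<Rightarrow> int"
  have "f a padic_one = \<one>\<^bsub>A\<^esub>"
  proof (rule bilinear_eq_one_if_pure_eq_one[OF A.comm_group_axioms _ _ _ a padic_one_in t])
    fix a z assume "a \<in> carrier A" "z \<in> carrier Zp"
    then show "f a z \<in> carrier A" by (simp add: f_def)
  next
    fix a a' z assume "a \<in> carrier A" "a' \<in> carrier A" "z \<in> carrier Zp"
    then show "f (a \<otimes>\<^bsub>A\<^esub> a') z = f a z \<otimes>\<^bsub>A\<^esub> f a' z" by (simp add: f_def A.nat_pow_distrib)
  next
    fix a z z' assume h: "a \<in> carrier A" "z \<in> carrier Zp" "z' \<in> carrier Zp"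
    define c where "c = a [^]\<^bsub>A\<^esub> cofactor"
    have c: "c \<in> carrier A" "c [^]\<^bsub>A\<^esub> (p ^ expo) = \<one>\<^bsub>A\<^esub>"
      using h pow_card[of a] by (simp_all add: c_def A.nat_pow_pow mult.commute)
    have "nat ((z \<otimes>\<^bsub>Zp\<^esub> z') expo) = (nat (z expo) + nat (z' expo)) mod p ^ expo"
      using Zp_D(3)[OF h(2), of expo] Zp_D(3)[OF h(3), of expo]
      by (simp add: Zp_mult nat_mod_distrib nat_add_distrib nat_power_eq)
    then have "f a (z \<otimes>\<^bsub>Zp\<^esub> z') = c [^]\<^bsub>A\<^esub> (nat (z expo) + nat (z' expo))"
      using A.pow_mod[OF c] by (simp add: f_def c_def[symmetric])
    then show "f a (z \<otimes>\<^bsub>Zp\<^esub> z') = f a z \<otimes>\<^bsub>A\<^esub> f a z'" using c by (simp add: f_def c_def[symmetric] A.nat_pow_mult)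
  qed
  then have f1: "(a [^]\<^bsub>A\<^esub> cofactor) [^]\<^bsub>A\<^esub> nat (padic_one expo) = \<one>\<^bsub>A\<^esub>" by (simp add: f_def)
  show ?thesis
  \<comment> \<open>For \<open>expo = 0\<close> the residue of \<open>1\<close> modulo \<open>p ^ expo\<close> is \<open>0\<close>; but then \<open>cofactor\<close> is the order of the group.\<close>
  proof (cases "expo = 0")
    case True
    then show ?thesis using pow_card[OF a] a by simp
  next
    case False
    then have "int p ^ expo > 1" using prime_gt_1_nat[OF p] by (intro one_less_power) auto
    then have "padic_one expo = 1" by (simp add: padic_one_def reduce_def)
    then show ?thesis using f1 a by simp
  qed
qed

text \<open>The map from \<open>A\<close> that takes \<open>a\<close> to its tensor with \<open>1\<close> is surjective, and its kernel is the prime-to-\<open>p\<close> part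
of \<open>A\<close>.\<close>

theorem order_T: "Coset.order T = p ^ multiplicity p (card (carrier A))"
proof -
  interpret h: group_hom A "T" "\<lambda>a. pure a padic_one" by (rule pure_hom[OF padic_one_in])
  define W where "W = {a \<in> carrier A. a [^]\<^bsub>A\<^esub> cofactor = \<one>\<^bsub>A\<^esub>}"
  have W: "subgroup W A" unfolding W_def
    by (rule A.subgroupI) (auto simp: A.nat_pow_distrib A.nat_pow_inv intro!: exI[of _ "\<one>\<^bsub>A\<^esub>"])
  interpret WG: group "A\<lparr>carrier := W\<rparr>" by (rule A.subgroup_imp_group[OF W])
  have ker: "{a \<in> carrier A. pure a padic_one = \<one>\<^bsub>T\<^esub>} = W"
    using cofactor_torsion_of_pure_one pure_of_cofactor_torsion[OF _ _ padic_one_in] by (auto simp: W_def)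
  have cardA: "card (carrier A) = card W * card (carrier T)"
    using card_hom_kernel_image[OF A.is_group T.is_group h.homh finA] by (simp add: ker range_pure_one)
  have T0: "card (carrier T) > 0" "card W > 0" using cardA card_A_pos by auto
  have finT: "finite (carrier T)" using T0(1) card_ge_0_finite by blast
  have "\<not> p dvd Coset.order (A\<lparr>carrier := W\<rparr>)"
  proof (rule WG.prime_not_dvd_order[OF p])
    show "finite (carrier (A\<lparr>carrier := W\<rparr>))" using finA by (simp add: W_def)
    fix x assume "x \<in> carrier (A\<lparr>carrier := W\<rparr>)"
    then have "x [^]\<^bsub>A\<^esub> cofactor = \<one>\<^bsub>A\<^esub>" by (simp add: W_def)
    then show "\<exists>m::nat. \<not> p dvd m \<and> x [^]\<^bsub>A\<lparr>carrier := W\<rparr>\<^esub> m = \<one>\<^bsub>A\<lparr>carrier := W\<rparr>\<^esub>"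
      using not_dvd_cofactor by (intro exI[of _ cofactor]) (simp add: A.nat_pow_consistent[symmetric])
  qed
  then have "multiplicity p (card W) = 0" by (simp add: Coset.order_def not_dvd_imp_multiplicity_0)
  then have mult: "multiplicity p (card (carrier T)) = multiplicity p (card (carrier A))"
    using T0 p by (simp add: cardA prime_elem_multiplicity_mult_distrib)
  have "q = p" if q: "Factorial_Ring.prime q" "q dvd card (carrier T)" for q
  proof (rule ccontr)
    assume "q \<noteq> p"
    then have nq: "\<not> q dvd p ^ expo" using q(1) p prime_dvd_power[OF q(1)] primes_dvd_imp_eq[OF q(1) p] by blast
    have "\<not> q dvd Coset.order (T)"
    proof (rule T.prime_not_dvd_order[OF q(1) finT])
      fix x assume "x \<in> carrier T"
      then obtain a where a: "a \<in> carrier A" "x = pure a padic_one" using range_pure_one by blast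
      have "x [^]\<^bsub>T\<^esub> (p ^ expo) = pure (a [^]\<^bsub>A\<^esub> (p ^ expo)) padic_one" using pure_pow[OF a(1) padic_one_in] a(2) by simp
      also have "\<dots> = \<one>\<^bsub>T\<^esub>" by (rule pure_of_cofactor_torsion[OF _ pow_card[OF a(1)] padic_one_in]) (use a in simp)
      finally show "\<exists>m::nat. \<not> q dvd m \<and> x [^]\<^bsub>T\<^esub> m = \<one>\<^bsub>T\<^esub>" using nq by blast
    qed
    then show False using q(2) by (simp add: Coset.order_def)
  qed
  then have "card (carrier T) = p ^ multiplicity p (card (carrier T))"
    by (rule prime_power_if_unique_prime_factor[OF T0(1) p])
  then show ?thesis using mult by (simp add: Coset.order_def)
qed

end

theorem order_tensor_Zp:
  fixes A :: "'a monoid"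
  assumes "comm_group A" "finite (carrier A)" "Factorial_Ring.prime p"
  shows "Coset.order (tensor_Zp A p) = p ^ multiplicity p (card (carrier A))"
proof -
  interpret prime_number p by (rule prime_number.intro[OF assms(3)])
  interpret finite_tensor_Zp p A
    using assms Zp_closed
    by (intro finite_tensor_Zp.intro finite_tensor_Zp_axioms.intro tensor_product.intro tensor_product_axioms.intro prime_number_axioms)
  show ?thesis by (rule order_T[unfolded T_def, unfolded padic_group_def])
qed

section \<open>Counting the modules of an arithmetic family\<close>

text \<open>The subgroup generated by \<open>c [^] r\<close>, where \<open>c\<close> is a generator and \<open>r\<close> is the prime-to-\<open>p\<close> part of the order.\<close>

lemma (in group) cyclic_sylow_subgroup:
  assumes cyc: "cyclic_group G" and fin: "finite (carrier G)" and p: "Factorial_Ring.prime (p::nat)"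
  obtains P where "sylow_subgroup p G P" "cyclic_group (G\<lparr>carrier := P\<rparr>)"
proof -
  obtain c where c: "c \<in> carrier G" "subgroup_generated G {c} = G"
    using cyc by (auto simp: cyclic_group_def)
  have gen: "generate G {c} = carrier G"
    using c carrier_subgroup_generated[of G "{c}"] by simp
  have ordc: "ord c = Coset.order G" using generate_pow_card[OF c(1)] gen by (simp add: Coset.order_def)
  define r where "r = Coset.order G div p ^ multiplicity p (Coset.order G)"
  have o: "Coset.order G = r * p ^ multiplicity p (Coset.order G)" by (simp add: r_def multiplicity_dvd)
  have pos: "Coset.order G > 0" using fin order_gt_0_iff_finite by blast
  then have "r > 0" using o by (cases r) auto
  define d where "d = c [^] r"
  have d: "d \<in> carrier G" using c by (simp add: d_def)
  have ordd: "ord d = p ^ multiplicity p (Coset.order G)"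
  proof -
    have "r dvd ord c" using o ordc by (metis dvd_triv_left)
    then have "ord d = ord c div r" unfolding d_def using c(1) \<open>r > 0\<close> by (intro ord_pow) auto
    then show ?thesis using o ordc \<open>r > 0\<close> by (metis nonzero_mult_div_cancel_left less_numeral_extra(3))
  qed
  define P where "P = generate G {d}"
  have "sylow_subgroup p G P"
    unfolding sylow_subgroup_def P_def
    using generate_is_subgroup[of "{d}"] generate_pow_card[OF d] ordd d by simp
  moreover have "subgroup_generated G {d} = G\<lparr>carrier := P\<rparr>"
    using d by (simp add: subgroup_generated_def P_def)
  then have "cyclic_group (G\<lparr>carrier := P\<rparr>)" using cyclic_group_generated by metis
  ultimately show ?thesis by (rule that)
qed

context arithmetic_family_over
begin

lemma character_field_bij:
  "bij_betw character_field (characters_of_field K)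
     {k. subfield k complex_field \<and> k \<subseteq> K \<and> cyclic_group (galois_group k \<rat>)}"
proof -
  have "inj_on character_field (characters_of_field K)"
    by (rule inj_on_subset[OF inj_character_field]) (simp add: characters_of_field_def)
  then show ?thesis using character_field_image[OF K] by (simp add: bij_betw_def)
qed

lemma finite_characters: "finite (characters_of_field K)"
  unfolding bij_betw_finite[OF character_field_bij] by (rule finite_subset[OF _ finite_subfields]) auto

lemma arithmetic_component_eq:
  "arithmetic_component M N \<chi> = (M (character_field \<chi>))\<lparr>carrier := arith (character_field \<chi>)\<rparr>"
  by (simp add: arithmetic_component_def arith_def)

lemma subgroup_arith:
  assumes k: "subfield k complex_field" "k \<subseteq> K"
  shows "subgroup (arith k) (M k)"
proof -
  interpret S: norm_system G "\<lambda>H. M (fld H)" "\<lambda>H g. act (fld H) (galois_lift K g)" "\<lambda>H H'. N (fld H) (fld H')"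
    by (rule norm_system_fld)
  have H: "subgroup (carrier (galois_group K k)) G" by (rule subgroup_gal[OF k])
  show ?thesis using S.subgroup_comp[OF H] comp_fld[OF H] fld_gal[OF k] by simp
qed

lemma component:
  assumes "\<chi> \<in> characters_of_field K"
  shows "comm_group (arithmetic_component M N \<chi>)" "finite (carrier (arithmetic_component M N \<chi>))"
    "Coset.order (arithmetic_component M N \<chi>) = card (arith (character_field \<chi>))"
    "card (arith (character_field \<chi>)) > 0"
proof -
  define k where "k = character_field \<chi>"
  have k: "subfield k complex_field" "k \<subseteq> K"
    using bij_betwE[OF character_field_bij] assms by (auto simp: k_def)
  have ab: "k \<in> abelian_fields" by (rule abelian_fields_sub[OF K k])
  interpret Mk: comm_group "M k" by (rule comm_group_M[OF ab])
  interpret I: subgroup "arith k" "M k" by (rule subgroup_arith[OF k])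
  have f: "finite (arith k)" using finite_subset[OF I.subset fin_M[OF ab]] .
  show "comm_group (arithmetic_component M N \<chi>)"
    unfolding arithmetic_component_eq k_def[symmetric]
    using I.subset Mk.m_comm
    by (intro group.group_comm_groupI[OF Mk.subgroup_imp_group[OF I.subgroup_axioms]]) auto
  show "finite (carrier (arithmetic_component M N \<chi>))" "Coset.order (arithmetic_component M N \<chi>) = card (arith (character_field \<chi>))"
    using f unfolding arithmetic_component_eq k_def[symmetric] by (simp_all add: Coset.order_def)
  show "card (arith (character_field \<chi>)) > 0"
    unfolding k_def[symmetric] using f by (metis card_gt_0_iff empty_iff I.one_closed)
qed

lemma multiplicity_order_M:
  assumes "Factorial_Ring.prime p" "sylow_subgroup p G P" "cyclic_group (G\<lparr>carrier := P\<rparr>)"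
  shows "multiplicity p (Coset.order (M K))
    = (\<Sum>\<chi>\<in>characters_of_field K. multiplicity p (Coset.order (arithmetic_component M N \<chi>)))"
proof -
  have "multiplicity p (Coset.order (M K)) = (\<Sum>\<chi>\<in>characters_of_field K. multiplicity p (card (arith (character_field \<chi>))))"
    unfolding Coset.order_def multiplicity_card_M[OF assms]
    by (rule sum.reindex_bij_betw[OF character_field_bij, symmetric])
  then show ?thesis using component(3) by simp
qed

lemma order_M_cyclic:
  assumes cyc: "cyclic_group G"
  shows "Coset.order (M K) = (\<Prod>\<chi>\<in>characters_of_field K. Coset.order (arithmetic_component M N \<chi>))"
proof (rule multiplicity_eq_nat)
  interpret MK: comm_group "M K" by (rule comm_group_M[OF K])
  show "Coset.order (M K) > 0" using fin_M[OF K] MK.order_gt_0_iff_finite by blast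
  have nz: "\<And>\<chi>. \<chi> \<in> characters_of_field K \<Longrightarrow> Coset.order (arithmetic_component M N \<chi>) \<noteq> 0"
    using component(3,4) by simp
  then show "(\<Prod>\<chi>\<in>characters_of_field K. Coset.order (arithmetic_component M N \<chi>)) > 0"
    by (intro prod_pos) auto
  fix p :: nat assume p: "Factorial_Ring.prime p"
  obtain P where "sylow_subgroup p G P" "cyclic_group (G\<lparr>carrier := P\<rparr>)"
    by (rule G.cyclic_sylow_subgroup[OF cyc fin_G p])
  then have "multiplicity p (Coset.order (M K))
    = (\<Sum>\<chi>\<in>characters_of_field K. multiplicity p (Coset.order (arithmetic_component M N \<chi>)))"
    by (rule multiplicity_order_M[OF p])
  also have "\<dots> = multiplicity p (\<Prod>\<chi>\<in>characters_of_field K. Coset.order (arithmetic_component M N \<chi>))"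
    by (rule prime_elem_multiplicity_prod_distrib[symmetric])
       (use nz finite_characters p in \<open>auto simp: image_iff\<close>)
  finally show "multiplicity p (Coset.order (M K))
    = multiplicity p (\<Prod>\<chi>\<in>characters_of_field K. Coset.order (arithmetic_component M N \<chi>))" .
qed

lemma order_tensor_sylow:
  assumes p: "Factorial_Ring.prime p" and P: "sylow_subgroup p G P" "cyclic_group (G\<lparr>carrier := P\<rparr>)"
  shows "Coset.order (tensor_Zp (M K) p)
    = (\<Prod>\<chi>\<in>characters_of_field K. Coset.order (tensor_Zp (arithmetic_component M N \<chi>) p))"
proof -
  have "Coset.order (tensor_Zp (M K) p) = p ^ multiplicity p (Coset.order (M K))"
    unfolding Coset.order_def[of "M K"] by (rule order_tensor_Zp[OF comm_group_M[OF K] fin_M[OF K] p])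
  also have "\<dots> = (\<Prod>\<chi>\<in>characters_of_field K. p ^ multiplicity p (Coset.order (arithmetic_component M N \<chi>)))"
    unfolding multiplicity_order_M[OF p P] by (rule power_sum)
  also have "\<dots> = (\<Prod>\<chi>\<in>characters_of_field K. Coset.order (tensor_Zp (arithmetic_component M N \<chi>) p))"
    unfolding Coset.order_def[of "arithmetic_component M N _"]
    using order_tensor_Zp[OF component(1,2) p] by (intro prod.cong refl) simp
  finally show ?thesis .
qed

end

theorem theorem3p12:
  fixes M :: "complex set \<Rightarrow> 'a monoid"
    and act :: "complex set \<Rightarrow> (complex \<Rightarrow> complex) \<Rightarrow> 'a \<Rightarrow> 'a"
    and N J :: "complex set \<Rightarrow> complex set \<Rightarrow> 'a \<Rightarrow> 'a"
    and K :: "complex set"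
  assumes "arithmetic_family M act N J"
    and "\<And>k. k \<in> abelian_fields \<Longrightarrow> finite (carrier (M k))"
    and "K \<in> abelian_fields"
    and "\<And>k k'. \<lbrakk>k \<in> abelian_fields; k' \<in> abelian_fields; k' \<subseteq> k; k \<subseteq> K\<rbrakk>
      \<Longrightarrow> N k k' ` carrier (M k) = carrier (M k')"
  shows "(cyclic_group (galois_group K \<rat>) \<longrightarrow>
            Coset.order (M K) = (\<Prod>\<chi>\<in>characters_of_field K. Coset.order (arithmetic_component M N \<chi>)))
       \<and> (\<forall>p P. Factorial_Ring.prime p \<longrightarrow> sylow_subgroup p (galois_group K \<rat>) P \<longrightarrow>
            cyclic_group ((galois_group K \<rat>)\<lparr>carrier := P\<rparr>) \<longrightarrow>
            Coset.order (tensor_Zp (M K) p) =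
              (\<Prod>\<chi>\<in>characters_of_field K. Coset.order (tensor_Zp (arithmetic_component M N \<chi>) p)))"
proof -
  interpret arithmetic_family_over K M act N J
    by (rule arithmetic_family_over.intro[OF abelian_field.intro[OF assms(3)] assms(1)],
        rule arithmetic_family_over_axioms.intro) (rule assms(2,4); assumption)+
  show ?thesis by (intro conjI impI allI order_M_cyclic order_tensor_sylow)
qed

end
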